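(* Let $\sigma,\tau:\mathbb R_+\to\mathbb R$ satisfy $\sup_{x>0}\int_x^{x+1}\sigma(t)^2\,dt<\infty$ and $\sup_{x>0}\int_x^{x+1}|\tau(t)|\,dt<\infty$. If $\sigma\in\ell^1(L^2)$ and $\tau\in\ell^1(L^1)=L^1(\mathbb R_+)$, then $H^\alpha$ has purely absolutely continuous spectrum on $(0,\infty)$ for every $\alpha\in[0,\pi)$.
   Context: $\mathbb R_+=(0,\infty)$ and $\ell^p(L^q)=\{f:\mathbb R_+\to\mathbb C\mid\sum_{n=0}^\infty\|f\chi_{[n,n+1)}\|_q^p<\infty\}$. For $u\in AC_{\mathrm{loc}}(\mathbb R_+)$ put $u^{[1]}:=u'-\sigma u$, let $\mathfrak D:=\{u\in AC_{\mathrm{loc}}(\mathbb R_+): u^{[1]}\in AC_{\mathrm{loc}}(\mathbb R_+)\}$ and, for $u\in\mathfrak D$, $\ell u:=-(u^{[1]})'-\sigma u^{[1]}+(\tau-\sigma^2)u$. The endpoint $0$ is regular, so $u(0),u^{[1]}(0)$ exist as limits whenever $u\in L^2(\mathbb R_+)\cap\mathfrak D$, $\ell u\in L^2(\mathbb R_+)$, or $\ell u=zu$; the endpoint $\infty$ is limit point. $H^\alpha$ is the self-adjoint operator in $L^2(\mathbb R_+)$ given by $H^\alpha u=\ell u$ on $\mathrm{dom}(H^\alpha)=\{u\in L^2(\mathbb R_+): u\in\mathfrak D,\ \ell u\in L^2(\mathbb R_+),\ u(0)\cos\alpha+u^{[1]}(0)\sin\alpha=0\}$. For $z\in\mathbb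 C\setminus\mathbb R$ there is, up to multiples, a unique nontrivial solution $\psi_z\in L^2(\mathbb R_+)$ of $\ell\psi_z=z\psi_z$; set $$m_\alpha(z)=\frac{\cos(\alpha)\psi_z^{[1]}(0)-\sin(\alpha)\psi_z(0)}{\sin(\alpha)\psi_z^{[1]}(0)+\cos(\alpha)\psi_z(0)},$$ a Herglotz function. The spectral measure $\mu^\alpha$ is the Borel measure on $\mathbb R$ with $\mu^\alpha((\lambda_1,\lambda_2])=\lim_{\delta\downarrow0}\lim_{\varepsilon\downarrow0}\frac1\pi\int_{\lambda_1+\delta}^{\lambda_2+\delta}\mathrm{Im}\,m_\alpha(\lambda+i\varepsilon)\,d\lambda$ for $\lambda_1<\lambda_2$; $H^\alpha$ is unitarily equivalent to multiplication by the independent variable in $L^2(\mathbb R,\mu^\alpha)$. Purely absolutely continuous spectrum on an interval $I$ means that the restriction of $\mu^\alpha$ to $I$ is absolutely continuous with respect to Lebesgue measure. *)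

theory Defs
  imports "HOL-Analysis.Analysis"
begin

text \<open>
  The half-line is the set \<open>{0<..}\<close>. Functions on it are total functions on \<^typ>\<open>real\<close> whose
  values at nonpositive arguments are never used; elements of Lebesgue spaces are functions, not
  classes modulo null sets.
\<close>

subsection \<open>Function spaces\<close>

definition Lq_space :: "real \<Rightarrow> (real \<Rightarrow> complex) set" where
  "Lq_space q = {f \<in> borel_measurable (lebesgue_on {0<..}).
     integrable (lebesgue_on {0<..}) (\<lambda>x. norm (f x) powr q)}"

definition Lq_norm :: "real \<Rightarrow> (real \<Rightarrow> complex) \<Rightarrow> real" where
  "Lq_norm q f = (\<integral>x. norm (f x) powr q \<partial>lebesgue_on {0<..}) powr (1 / q)"

definition chop :: "nat \<Rightarrow> (real \<Rightarrow> complex) \<Rightarrow> real \<Rightarrow> complex" where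
  "chop n f x = indicator {real n..<real n + 1} x * f x"

text \<open>
  \<open>amalgam p q\<close> is $\ell^p(L^q)$ for finite exponents. Membership of every piece in $L^q$ is stated
  separately because the Bochner integral of a non-integrable function is \<open>0\<close>.
\<close>

definition amalgam :: "real \<Rightarrow> real \<Rightarrow> (real \<Rightarrow> complex) set" where
  "amalgam p q = {f. (\<forall>n. chop n f \<in> Lq_space q) \<and> summable (\<lambda>n. Lq_norm q (chop n f) powr p)}"

definition absolutely_continuous_on :: "real set \<Rightarrow> (real \<Rightarrow> complex) \<Rightarrow> bool" where
  "absolutely_continuous_on S f \<longleftrightarrow>
     (\<forall>\<epsilon>>0. \<exists>\<delta>>0. \<forall>(n::nat) a b.
        (\<forall>i<n. a i \<le> b i \<and> {a i..b i} \<subseteq> S) \<longrightarrow>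
        disjoint_family_on (\<lambda>i. {a i<..<b i}) {..<n} \<longrightarrow>
        (\<Sum>i<n. b i - a i) < \<delta> \<longrightarrow>
        (\<Sum>i<n. norm (f (b i) - f (a i))) < \<epsilon>)"

definition AC_loc :: "(real \<Rightarrow> complex) set" where
  "AC_loc = {f. \<forall>a b. 0 < a \<longrightarrow> a < b \<longrightarrow> absolutely_continuous_on {a..b} f}"

subsection \<open>The differential expression\<close>

text \<open>
  \<open>is_quasi_deriv \<sigma> u v\<close>: both functions are locally absolutely continuous and $v = u' - \sigma u$
  almost everywhere, that is, $v$ is the (continuous) representative of $u^{[1]}$. It is determined
  by \<open>u\<close> on \<open>{0<..}\<close>, so the choice in \<open>quasi_deriv\<close> is immaterial there.
\<close>

definition is_quasi_deriv ::
    "(real \<Rightarrow> real) \<Rightarrow> (real \<Rightarrow> complex) \<Rightarrow> (real \<Rightarrow> complex) \<Rightarrow> bool" where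
  "is_quasi_deriv \<sigma> u v \<longleftrightarrow> u \<in> AC_loc \<and> v \<in> AC_loc \<and>
     (AE x in lebesgue_on {0<..}.
        \<exists>d. (u has_vector_derivative d) (at x) \<and> v x = d - of_real (\<sigma> x) * u x)"

definition quasi_domain :: "(real \<Rightarrow> real) \<Rightarrow> (real \<Rightarrow> complex) set" where
  "quasi_domain \<sigma> = {u. \<exists>v. is_quasi_deriv \<sigma> u v}"

definition quasi_deriv :: "(real \<Rightarrow> real) \<Rightarrow> (real \<Rightarrow> complex) \<Rightarrow> real \<Rightarrow> complex" where
  "quasi_deriv \<sigma> u = (SOME v. is_quasi_deriv \<sigma> u v)"

text \<open>
  \<open>ell_eq \<sigma> \<tau> u w\<close> says that \<open>u\<close> lies in the domain of the expression $\ell$ and $\ell u = w$; as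
  $\ell u$ is only defined almost everywhere, it is given as a relation.
\<close>

definition ell_eq ::
    "(real \<Rightarrow> real) \<Rightarrow> (real \<Rightarrow> real) \<Rightarrow> (real \<Rightarrow> complex) \<Rightarrow> (real \<Rightarrow> complex) \<Rightarrow> bool" where
  "ell_eq \<sigma> \<tau> u w \<longleftrightarrow> u \<in> quasi_domain \<sigma> \<and>
     (AE x in lebesgue_on {0<..}.
        \<exists>d. (quasi_deriv \<sigma> u has_vector_derivative d) (at x) \<and>
            w x = - d - of_real (\<sigma> x) * quasi_deriv \<sigma> u x + of_real (\<tau> x - (\<sigma> x)\<^sup>2) * u x)"

definition value_at_0 :: "(real \<Rightarrow> complex) \<Rightarrow> complex" where
  "value_at_0 u = Lim (at_right 0) u"

subsection \<open>The operator, its Weyl function and its spectral measure\<close>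

text \<open>
  The graph of $H^\alpha$. Its spectral type is expressed below through the spectral measure
  $\mu^\alpha$, which depends on the operator only through \<open>\<sigma>\<close>, \<open>\<tau>\<close> and \<open>\<alpha>\<close>.
\<close>

definition H_graph ::
    "(real \<Rightarrow> real) \<Rightarrow> (real \<Rightarrow> real) \<Rightarrow> real \<Rightarrow> ((real \<Rightarrow> complex) \<times> (real \<Rightarrow> complex)) set" where
  "H_graph \<sigma> \<tau> \<alpha> = {(u, w). u \<in> Lq_space 2 \<and> w \<in> Lq_space 2 \<and> ell_eq \<sigma> \<tau> u w \<and>
     value_at_0 u * of_real (cos \<alpha>) + value_at_0 (quasi_deriv \<sigma> u) * of_real (sin \<alpha>) = 0}"

definition is_weyl_solution ::
    "(real \<Rightarrow> real) \<Rightarrow> (real \<Rightarrow> real) \<Rightarrow> complex \<Rightarrow> (real \<Rightarrow> complex) \<Rightarrow> bool" where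
  "is_weyl_solution \<sigma> \<tau> z \<psi> \<longleftrightarrow>
     \<psi> \<in> Lq_space 2 \<and> ell_eq \<sigma> \<tau> \<psi> (\<lambda>x. z * \<psi> x) \<and> (\<exists>x>0. \<psi> x \<noteq> 0)"

text \<open>
  For nonreal \<open>z\<close> the Weyl solution is unique up to multiples, which cancel in the quotient.
\<close>

definition weyl_solution :: "(real \<Rightarrow> real) \<Rightarrow> (real \<Rightarrow> real) \<Rightarrow> complex \<Rightarrow> real \<Rightarrow> complex" where
  "weyl_solution \<sigma> \<tau> z = (SOME \<psi>. is_weyl_solution \<sigma> \<tau> z \<psi>)"

definition m_function :: "(real \<Rightarrow> real) \<Rightarrow> (real \<Rightarrow> real) \<Rightarrow> real \<Rightarrow> complex \<Rightarrow> complex" where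
  "m_function \<sigma> \<tau> \<alpha> z =
     (let \<psi> = weyl_solution \<sigma> \<tau> z;
          \<psi>0 = value_at_0 \<psi>;
          \<psi>1 = value_at_0 (quasi_deriv \<sigma> \<psi>)
      in (of_real (cos \<alpha>) * \<psi>1 - of_real (sin \<alpha>) * \<psi>0) /
         (of_real (sin \<alpha>) * \<psi>1 + of_real (cos \<alpha>) * \<psi>0))"

definition stieltjes_inversion :: "(complex \<Rightarrow> complex) \<Rightarrow> real \<Rightarrow> real \<Rightarrow> real" where
  "stieltjes_inversion m a b =
     Lim (at_right 0) (\<lambda>\<delta>. Lim (at_right 0) (\<lambda>\<epsilon>.
       1 / pi * (LBINT t:{a + \<delta>..b + \<delta>}. Im (m (Complex t \<epsilon>)))))"

text \<open>
  The Borel measure with prescribed values on half-open intervals, obtained as in the definition of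
  \<^const>\<open>interval_measure\<close>; it is unique because these intervals form a generator stable under
  intersections up to the empty set. Its existence is the classical Stieltjes inversion theorem for
  Herglotz functions (\<^const>\<open>extend_measure\<close> is total: on values with no extension it is \<open>0\<close>).
\<close>

definition spectral_measure :: "(real \<Rightarrow> real) \<Rightarrow> (real \<Rightarrow> real) \<Rightarrow> real \<Rightarrow> real measure" where
  "spectral_measure \<sigma> \<tau> \<alpha> =
     extend_measure UNIV {(a, b). a < b} (\<lambda>(a, b). {a<..b})
       (\<lambda>(a, b). ennreal (stieltjes_inversion (m_function \<sigma> \<tau> \<alpha>) a b))"

definition purely_ac_spectrum_on ::
    "(real \<Rightarrow> real) \<Rightarrow> (real \<Rightarrow> real) \<Rightarrow> real \<Rightarrow> real set \<Rightarrow> bool" where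
  "purely_ac_spectrum_on \<sigma> \<tau> \<alpha> I \<longleftrightarrow>
     absolutely_continuous (restrict_space lborel I)
       (restrict_space (spectral_measure \<sigma> \<tau> \<alpha>) I)"

end

theory Submission
  imports Defs
begin

text \<open>
  Since $\sigma \in L^1 \cap L^2$ and $\tau \in L^1$, the equation $\ell u = k^2 u$ is, as a first
  order system for $(u, u^{[1]})$, an integrable perturbation of $-u'' = k^2 u$. It therefore has a Jost
  solution behaving like $e^{ikx}$ at infinity for every $k$ with $\Im k \ge 0$ and $\Re k > 0$. In the
  variables $e^{-ikx}(u^{[1]} \pm iku)$ it solves a Volterra equation, which is a contraction in a
  weighted sup norm for functions of $(x, k)$ jointly, so the solution is jointly continuous up to real
  $k$. The quantity $\Im (\overline{u} u^{[1]})$ is nonincreasing in $x$ and eventually positive; so the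
  denominator of $m_\alpha$ never vanishes, and $m_\alpha$, whose Weyl solution is the Jost solution,
  extends continuously to the positive half-axis. By Stieltjes inversion the spectral measure has
  there the density $\pi^{-1} \Im m_\alpha$.
\<close>

subsection \<open>Absolutely continuous functions\<close>

text \<open>The obstacle is k = 0: the change of variables divides by 2ik, so bounds are uniform
  only on Re k \<ge> d with d > 0. The argument therefore runs for Re z \<ge> c with d = sqrt c, and
  the half-axis is exhausted by letting c decrease to 0. The densities found for different c are
  never compared, since only null sets are tested. Passing from Im k > 0 to real k is harmless
  because the Volterra equations are posed from infinity: the only exponential is e^{2ik(t - x)}
  with t \<ge> x, of modulus at most 1. Continuity in x and k jointly is what lets the limit
  \<epsilon> to 0 be taken under the integral in the inversion formula. The coefficients are merely
  integrable, so the equations hold only almost everywhere: solutions are obtained by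
  differentiating integrals almost everywhere, and each conservation law is derived from the
  fundamental theorem of calculus for absolutely continuous functions. Extending the coefficients by
  0 to the left of 0 turns limits at the endpoint 0 into plain values.\<close>

text \<open>The definition quantifies over families indexed by an initial segment of
  \<open>nat\<close>. The gauge argument indexes intervals by the elements of a tagged division, and
  continuity uses a one-element family, so the index type is freed by composing with an
  enumeration.\<close>

lemma absolutely_continuous_on_sum:
  assumes "absolutely_continuous_on S f" "0 < e"
  shows "\<exists>d>0. \<forall>(I::'i set) l r. finite I \<longrightarrow> (\<forall>i\<in>I. l i \<le> r i \<and> {l i..r i} \<subseteq> S) \<longrightarrow>
       disjoint_family_on (\<lambda>i. {l i<..<r i}) I \<longrightarrow> (\<Sum>i\<in>I. r i - l i) < d \<longrightarrow>
       (\<Sum>i\<in>I. norm (f (r i) - f (l i))) < e"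
proof -
  obtain d where "d > 0" and d: "\<forall>(n::nat) a b. (\<forall>i<n. a i \<le> b i \<and> {a i..b i} \<subseteq> S) \<longrightarrow>
        disjoint_family_on (\<lambda>i. {a i<..<b i}) {..<n} \<longrightarrow> (\<Sum>i<n. b i - a i) < d \<longrightarrow>
        (\<Sum>i<n. norm (f (b i) - f (a i))) < e"
    using assms(1)[unfolded absolutely_continuous_on_def, THEN spec, THEN mp, OF assms(2)]
    by (elim exE conjE)
  show ?thesis
  proof (intro exI[of _ d] conjI allI impI)
    show "d > 0" by fact
    fix I :: "'i set" and l r
    assume I: "finite I" and sub: "\<forall>i\<in>I. l i \<le> r i \<and> {l i..r i} \<subseteq> S"
      and dis: "disjoint_family_on (\<lambda>i. {l i<..<r i}) I" and lt: "(\<Sum>i\<in>I. r i - l i) < d"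
    obtain h where h: "bij_betw h {..<card I} I"
      using ex_bij_betw_nat_finite[OF I] by (auto simp: atLeast0LessThan)
    have hI: "h i \<in> I" if "i < card I" for i
      using h that by (auto simp: bij_betw_def)
    have "(\<Sum>i<card I. norm (f (r (h i)) - f (l (h i)))) < e"
    proof (rule d[THEN spec, THEN spec, THEN spec, THEN mp, THEN mp, THEN mp])
      show "\<forall>i<card I. l (h i) \<le> r (h i) \<and> {l (h i)..r (h i)} \<subseteq> S"
        using hI sub by blast
      show "disjoint_family_on (\<lambda>i. {l (h i)<..<r (h i)}) {..<card I}"
        unfolding disjoint_family_on_def
      proof (intro ballI impI)
        fix i j assume "i \<in> {..<card I}" "j \<in> {..<card I}" "i \<noteq> j"
        then have "h i \<in> I" "h j \<in> I" "h i \<noteq> h j"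
          using hI h by (auto simp: bij_betw_def inj_on_def)
        then show "{l (h i)<..<r (h i)} \<inter> {l (h j)<..<r (h j)} = {}"
          using dis unfolding disjoint_family_on_def by blast
      qed
      show "(\<Sum>i<card I. r (h i) - l (h i)) < d"
        using lt by (subst sum.reindex_bij_betw[OF h])
    qed
    then show "(\<Sum>i\<in>I. norm (f (r i) - f (l i))) < e"
      by (subst (asm) sum.reindex_bij_betw[OF h])
  qed
qed

lemma absolutely_continuous_on_subset:
  "absolutely_continuous_on S f \<Longrightarrow> T \<subseteq> S \<Longrightarrow> absolutely_continuous_on T f"
  unfolding absolutely_continuous_on_def by (meson order_trans)

text \<open>Closure properties reduce to estimates on increments: if those of \<open>g\<close> are
  at most \<open>K\<close> times those of \<open>f\<close>, the same families of short intervals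
  serve for both.\<close>

lemma absolutely_continuous_on_dominated:
  assumes f: "absolutely_continuous_on S f"
    and K: "K \<ge> 0" "\<And>x y. {x..y} \<subseteq> S \<Longrightarrow> x \<le> y \<Longrightarrow> norm (g y - g x) \<le> K * norm (f y - f x)"
  shows "absolutely_continuous_on S g"
  unfolding absolutely_continuous_on_def
proof (intro allI impI)
  fix e :: real assume "e > 0"
  \<comment> \<open>Dividing by K + 1 instead of K covers K = 0 and keeps the final inequality
    strict.\<close>
  then have e: "e / (K + 1) > 0" using K by simp
  obtain d where d: "d > 0" "\<forall>(I::nat set) l r. finite I \<longrightarrow> (\<forall>i\<in>I. l i \<le> r i \<and> {l i..r i} \<subseteq> S) \<longrightarrow>
       disjoint_family_on (\<lambda>i. {l i<..<r i}) I \<longrightarrow> (\<Sum>i\<in>I. r i - l i) < d \<longrightarrow>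
       (\<Sum>i\<in>I. norm (f (r i) - f (l i))) < e / (K + 1)"
    using absolutely_continuous_on_sum[OF f e] by blast
  show "\<exists>d>0. \<forall>(n::nat) a b. (\<forall>i<n. a i \<le> b i \<and> {a i..b i} \<subseteq> S) \<longrightarrow>
        disjoint_family_on (\<lambda>i. {a i<..<b i}) {..<n} \<longrightarrow> (\<Sum>i<n. b i - a i) < d \<longrightarrow>
        (\<Sum>i<n. norm (g (b i) - g (a i))) < e"
  proof (intro exI[of _ d] conjI allI impI d(1))
    fix n :: nat and a b
    assume h: "\<forall>i<n. a i \<le> b i \<and> {a i..b i} \<subseteq> S" "disjoint_family_on (\<lambda>i. {a i<..<b i}) {..<n}"
      "(\<Sum>i<n. b i - a i) < d"
    have "(\<Sum>i<n. norm (g (b i) - g (a i))) \<le> (\<Sum>i<n. K * norm (f (b i) - f (a i)))"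
      using h(1) K(2) by (intro sum_mono) auto
    also have "\<dots> = K * (\<Sum>i<n. norm (f (b i) - f (a i)))" by (simp add: sum_distrib_left)
    also have "\<dots> \<le> K * (e / (K + 1))"
      using d(2)[rule_format, of "{..<n}" a b] h K by (intro mult_left_mono) auto
    also have "\<dots> < e" using K \<open>e > 0\<close> by (simp add: field_simps)
    finally show "(\<Sum>i<n. norm (g (b i) - g (a i))) < e" .
  qed
qed

lemma absolutely_continuous_on_dominated2:
  assumes f: "absolutely_continuous_on S f" and g: "absolutely_continuous_on S g"
    and K: "K \<ge> 0" "\<And>x y. {x..y} \<subseteq> S \<Longrightarrow> x \<le> y \<Longrightarrow>
      norm (h y - h x) \<le> K * (norm (f y - f x) + norm (g y - g x))"
  shows "absolutely_continuous_on S h"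
  unfolding absolutely_continuous_on_def
proof (intro allI impI)
  fix e :: real assume "e > 0"
  then have e: "e / (2 * (K + 1)) > 0" using K by simp
  obtain d1 where d1: "d1 > 0" "\<forall>(I::nat set) l r. finite I \<longrightarrow> (\<forall>i\<in>I. l i \<le> r i \<and> {l i..r i} \<subseteq> S) \<longrightarrow>
       disjoint_family_on (\<lambda>i. {l i<..<r i}) I \<longrightarrow> (\<Sum>i\<in>I. r i - l i) < d1 \<longrightarrow>
       (\<Sum>i\<in>I. norm (f (r i) - f (l i))) < e / (2 * (K + 1))"
    using absolutely_continuous_on_sum[OF f e] by blast
  obtain d2 where d2: "d2 > 0" "\<forall>(I::nat set) l r. finite I \<longrightarrow> (\<forall>i\<in>I. l i \<le> r i \<and> {l i..r i} \<subseteq> S) \<longrightarrow>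
       disjoint_family_on (\<lambda>i. {l i<..<r i}) I \<longrightarrow> (\<Sum>i\<in>I. r i - l i) < d2 \<longrightarrow>
       (\<Sum>i\<in>I. norm (g (r i) - g (l i))) < e / (2 * (K + 1))"
    using absolutely_continuous_on_sum[OF g e] by blast
  show "\<exists>d>0. \<forall>(n::nat) a b. (\<forall>i<n. a i \<le> b i \<and> {a i..b i} \<subseteq> S) \<longrightarrow>
        disjoint_family_on (\<lambda>i. {a i<..<b i}) {..<n} \<longrightarrow> (\<Sum>i<n. b i - a i) < d \<longrightarrow>
        (\<Sum>i<n. norm (h (b i) - h (a i))) < e"
  proof (intro exI[of _ "min d1 d2"] conjI allI impI)
    show "0 < min d1 d2" using d1 d2 by simp
    fix n :: nat and a b
    assume h: "\<forall>i<n. a i \<le> b i \<and> {a i..b i} \<subseteq> S" "disjoint_family_on (\<lambda>i. {a i<..<b i}) {..<n}"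
      "(\<Sum>i<n. b i - a i) < min d1 d2"
    have "(\<Sum>i<n. norm (h (b i) - h (a i)))
        \<le> (\<Sum>i<n. K * (norm (f (b i) - f (a i)) + norm (g (b i) - g (a i))))"
      using h(1) K(2) by (intro sum_mono) auto
    also have "\<dots> = K * ((\<Sum>i<n. norm (f (b i) - f (a i))) + (\<Sum>i<n. norm (g (b i) - g (a i))))"
      by (simp only: sum_distrib_left sum.distrib[symmetric])
    also have "\<dots> \<le> K * (e / (2 * (K + 1)) + e / (2 * (K + 1)))"
      using d1(2)[rule_format, of "{..<n}" a b] d2(2)[rule_format, of "{..<n}" a b] h K by (intro mult_left_mono add_mono) auto
    also have "\<dots> < e" using K(1) \<open>e > 0\<close> by (simp add: divide_simps)
    finally show "(\<Sum>i<n. norm (h (b i) - h (a i))) < e" .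
  qed
qed

lemma absolutely_continuous_on_imp_continuous_on:
  assumes "absolutely_continuous_on {a..b} f"
  shows "continuous_on {a..b} f"
  unfolding continuous_on_iff
proof (intro ballI allI impI)
  fix x e :: real assume x: "x \<in> {a..b}" and "e > 0"
  obtain d where "d > 0" and d: "\<forall>(I::unit set) l r. finite I \<longrightarrow> (\<forall>i\<in>I. l i \<le> r i \<and> {l i..r i} \<subseteq> {a..b}) \<longrightarrow>
       disjoint_family_on (\<lambda>i. {l i<..<r i}) I \<longrightarrow> (\<Sum>i\<in>I. r i - l i) < d \<longrightarrow>
       (\<Sum>i\<in>I. norm (f (r i) - f (l i))) < e"
    using absolutely_continuous_on_sum[OF assms \<open>e > 0\<close>] by blast
  \<comment> \<open>A family consisting of a single interval, its end points sorted by
    \<open>min\<close> and \<open>max\<close>.\<close>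
  have "dist (f y) (f x) < e" if y: "y \<in> {a..b}" "dist y x < d" for y
    using d[rule_format, of "{()}" "\<lambda>_. min x y" "\<lambda>_. max x y"] x y
    by (cases "x \<le> y") (auto simp: disjoint_family_on_def dist_norm norm_minus_commute)
  with \<open>d > 0\<close> show "\<exists>d>0. \<forall>y\<in>{a..b}. dist y x < d \<longrightarrow> dist (f y) (f x) < e" by blast
qed

lemma absolutely_continuous_on_lipschitz:
  assumes "K \<ge> 0" "\<And>x y. {x..y} \<subseteq> S \<Longrightarrow> x \<le> y \<Longrightarrow> norm (f y - f x) \<le> K * (y - x)"
  shows "absolutely_continuous_on S f"
  unfolding absolutely_continuous_on_def
proof (intro allI impI)
  fix e :: real assume "e > 0"
  show "\<exists>d>0. \<forall>(n::nat) a b. (\<forall>i<n. a i \<le> b i \<and> {a i..b i} \<subseteq> S) \<longrightarrow>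
        disjoint_family_on (\<lambda>i. {a i<..<b i}) {..<n} \<longrightarrow> (\<Sum>i<n. b i - a i) < d \<longrightarrow>
        (\<Sum>i<n. norm (f (b i) - f (a i))) < e"
  proof (intro exI[of _ "e / (K + 1)"] conjI allI impI)
    show "0 < e / (K + 1)" using \<open>e > 0\<close> assms by simp
    fix n :: nat and a b
    assume h: "\<forall>i<n. a i \<le> b i \<and> {a i..b i} \<subseteq> S" "disjoint_family_on (\<lambda>i. {a i<..<b i}) {..<n}"
      "(\<Sum>i<n. b i - a i) < e / (K + 1)"
    have "(\<Sum>i<n. norm (f (b i) - f (a i))) \<le> (\<Sum>i<n. K * (b i - a i))"
      using h(1) assms(2) by (intro sum_mono) auto
    also have "\<dots> = K * (\<Sum>i<n. b i - a i)" by (simp add: sum_distrib_left)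
    also have "\<dots> \<le> K * (e / (K + 1))" using h(3) assms by (intro mult_left_mono) auto
    also have "\<dots> < e" using assms \<open>e > 0\<close> by (simp add: field_simps)
    finally show "(\<Sum>i<n. norm (f (b i) - f (a i))) < e" .
  qed
qed

lemma absolutely_continuous_on_const: "absolutely_continuous_on S (\<lambda>_. c)"
  by (rule absolutely_continuous_on_lipschitz[of 0]) auto

lemma absolutely_continuous_on_add:
  assumes "absolutely_continuous_on S f" "absolutely_continuous_on S g"
  shows "absolutely_continuous_on S (\<lambda>x. f x + g x)"
proof (rule absolutely_continuous_on_dominated2[OF assms, of 1])
  show "norm (f y + g y - (f x + g x)) \<le> 1 * (norm (f y - f x) + norm (g y - g x))" for x y
    using norm_triangle_ineq[of "f y - f x" "g y - g x"] by (simp add: algebra_simps)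
qed simp

lemma absolutely_continuous_on_diff:
  assumes "absolutely_continuous_on S f" "absolutely_continuous_on S g"
  shows "absolutely_continuous_on S (\<lambda>x. f x - g x)"
proof (rule absolutely_continuous_on_dominated2[OF assms, of 1])
  show "norm (f y - g y - (f x - g x)) \<le> 1 * (norm (f y - f x) + norm (g y - g x))" for x y
    using norm_triangle_ineq4[of "f y - f x" "g y - g x"] by (simp add: algebra_simps)
qed simp

lemma absolutely_continuous_on_cnj:
  "absolutely_continuous_on S f \<Longrightarrow> absolutely_continuous_on S (\<lambda>x. cnj (f x))"
  by (rule absolutely_continuous_on_dominated[of S f 1])
    (auto simp: complex_mod_cnj simp flip: complex_cnj_diff)

text \<open>The increment of a product is (f y - f x) g y + f x (g y - g x). The free factors are
  bounded because the set is a compact interval.\<close>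

lemma absolutely_continuous_on_mult:
  assumes f: "absolutely_continuous_on {a..b} f" and g: "absolutely_continuous_on {a..b} g"
  shows "absolutely_continuous_on {a..b} (\<lambda>x. f x * g x)"
proof -
  have "compact (f ` {a..b})" "compact (g ` {a..b})"
    using f g absolutely_continuous_on_imp_continuous_on compact_continuous_image compact_Icc by blast+
  then have "bounded (f ` {a..b})" "bounded (g ` {a..b})" by (auto intro: compact_imp_bounded)
  then obtain M N where M: "\<And>x. x \<in> {a..b} \<Longrightarrow> norm (f x) \<le> M" "M > 0"
    and N: "\<And>x. x \<in> {a..b} \<Longrightarrow> norm (g x) \<le> N" "N > 0"
    unfolding bounded_pos by (metis imageI)
  show ?thesis
  proof (rule absolutely_continuous_on_dominated2[OF f g, of "M + N"])
    fix x y assume "{x..y} \<subseteq> {a..b}" "x \<le> y"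
    then have x: "x \<in> {a..b}" and y: "y \<in> {a..b}" by auto
    have "f y * g y - f x * g x = (f y - f x) * g y + f x * (g y - g x)" by (simp add: algebra_simps)
    then have "norm (f y * g y - f x * g x) \<le> norm ((f y - f x) * g y) + norm (f x * (g y - g x))"
      by (metis norm_triangle_ineq)
    also have "\<dots> \<le> norm (f y - f x) * N + M * norm (g y - g x)"
      unfolding norm_mult using M N x y by (intro add_mono mult_mono) auto
    also have "\<dots> \<le> (M + N) * (norm (f y - f x) + norm (g y - g x))"
      using M(2) N(2) by (simp add: algebra_simps)
    finally show "norm (f y * g y - f x * g x) \<le> (M + N) * (norm (f y - f x) + norm (g y - g x))" .
  qed (use M N in auto)
qed

lemma absolutely_continuous_on_inverse:
  assumes f: "absolutely_continuous_on {a..b} f" and nz: "\<And>x. x \<in> {a..b} \<Longrightarrow> f x \<noteq> 0"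
  shows "absolutely_continuous_on {a..b} (\<lambda>x. inverse (f x))"
proof -
  have "continuous_on {a..b} (\<lambda>x. inverse (f x))"
    using f nz by (intro continuous_intros absolutely_continuous_on_imp_continuous_on) auto
  then have "compact ((\<lambda>x. inverse (f x)) ` {a..b})"
    using compact_continuous_image compact_Icc by blast
  then have "bounded ((\<lambda>x. inverse (f x)) ` {a..b})" by (rule compact_imp_bounded)
  then obtain M where M: "\<And>x. x \<in> {a..b} \<Longrightarrow> norm (inverse (f x)) \<le> M" "M > 0"
    unfolding bounded_pos by (metis imageI)
  show ?thesis
  proof (rule absolutely_continuous_on_dominated[OF f, of "M * M"])
    show "norm (inverse (f y) - inverse (f x)) \<le> M * M * norm (f y - f x)"
      if "{x..y} \<subseteq> {a..b}" "x \<le> y" for x y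
    proof -
      have x: "x \<in> {a..b}" and y: "y \<in> {a..b}" using that by auto
      have "inverse (f y) - inverse (f x) = inverse (f y) * inverse (f x) * (f x - f y)"
        using nz x y by (simp add: field_simps)
      then have "norm (inverse (f y) - inverse (f x))
          = norm (inverse (f y)) * norm (inverse (f x)) * norm (f y - f x)"
        by (metis norm_mult norm_minus_commute)
      also have "\<dots> \<le> M * M * norm (f y - f x)"
        using M x y by (intro mult_mono) auto
      finally show ?thesis .
    qed
  qed (use M in auto)
qed

section \<open>The fundamental theorem of calculus: integrating derivatives and differentiating
  integrals almost everywhere\<close>

lemma negligible_open_cover:
  assumes "negligible (N :: real set)" "d > 0"
  obtains G where "open G" "N \<subseteq> G" "G \<in> lmeasurable" "measure lebesgue G < d"
proof -
  obtain T where T: "open T" "N \<subseteq> T" "(T - N) \<in> lmeasurable" "emeasure lebesgue (T - N) < ennreal d"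
    using sets_lebesgue_outer_open[of N d] assms negligible_imp_sets by blast
  have N: "N \<in> null_sets lebesgue" using assms by (simp add: negligible_iff_null_sets)
  have TS: "T \<in> sets lebesgue" using T(1) by auto
  have "emeasure lebesgue T = emeasure lebesgue (T - N)"
    using N TS by (simp add: emeasure_Diff_null_set)
  then have e: "emeasure lebesgue T < ennreal d" using T by simp
  then have "T \<in> lmeasurable" using TS by (intro fmeasurableI) (auto intro: less_trans)
  moreover have "measure lebesgue T < d"
    using e assms(2) \<open>T \<in> lmeasurable\<close> by (simp add: emeasure_eq_measure2 ennreal_less_iff)
  ultimately show ?thesis using that T by blast
qed

text \<open>Divisions speak of sets, absolute continuity of end points. Each cell is a compact
  interval, recovered from its \<open>Inf\<close> and \<open>Sup\<close>; this is the dictionary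
  between the two.\<close>

lemma tagged_interval:
  assumes "(x, K) \<in> p" "p tagged_partial_division_of {a..b::real}"
  shows "Inf K \<le> x" "x \<le> Sup K" "{Inf K..Sup K} = K" "K \<subseteq> {a..b}"
    "measure lborel K = Sup K - Inf K"
proof -
  obtain u v where "K = cbox u v" using tagged_partial_division_ofD(4)[OF assms(2,1)] by blast
  with tagged_partial_division_ofD(2,3)[OF assms(2,1)]
  show "Inf K \<le> x" "x \<le> Sup K" "{Inf K..Sup K} = K" "K \<subseteq> {a..b}"
    "measure lborel K = Sup K - Inf K" by auto
qed

lemma tagged_disjoint_interiors:
  assumes "p tagged_partial_division_of {a..b::real}"
  shows "disjoint_family_on (\<lambda>(x, K). {Inf K<..<Sup K}) p"
  unfolding disjoint_family_on_def
proof (intro ballI impI)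
  fix m n assume mn: "m \<in> p" "n \<in> p" "m \<noteq> n"
  obtain x K y L where eq: "m = (x, K)" "n = (y, L)" by (metis surj_pair)
  have "interior K \<inter> interior L = {}"
    using mn eq by (intro tagged_partial_division_ofD(5)[OF assms]) auto
  moreover have "{Inf K..Sup K} = K"
    using mn(1)[unfolded eq] assms by (rule tagged_interval)
  moreover have "{Inf L..Sup L} = L"
    using mn(2)[unfolded eq] assms by (rule tagged_interval)
  ultimately have "interior {Inf K..Sup K} \<inter> interior {Inf L..Sup L} = {}" by metis
  then show "(case m of (x, K) \<Rightarrow> {Inf K<..<Sup K}) \<inter> (case n of (x, K) \<Rightarrow> {Inf K<..<Sup K}) = {}"
    by (simp add: eq)
qed

text \<open>Adjacent cells may share end points, so only their interiors are disjoint. Lengths do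
  not change on passing to the interiors, and measure is additive there.\<close>

lemma sum_lengths_le_measure:
  assumes "finite I" "disjoint_family_on (\<lambda>i. {l i<..<r i}) I" "G \<in> lmeasurable"
    and "\<And>i. i \<in> I \<Longrightarrow> l i \<le> r i \<and> {l i..r i} \<subseteq> G"
  shows "(\<Sum>i\<in>I. r i - l i) \<le> measure lebesgue G"
proof -
  have "(\<Sum>i\<in>I. r i - l i) = (\<Sum>i\<in>I. measure lebesgue {l i<..<r i})"
    using assms(4) by (intro sum.cong) auto
  also have "\<dots> = measure lebesgue (\<Union>i\<in>I. {l i<..<r i})"
    using assms by (intro measure_finite_Union[symmetric]) auto
  also have "\<dots> \<le> measure lebesgue G"
  proof (intro measure_mono_fmeasurable)
    show "(\<Union>i\<in>I. {l i<..<r i}) \<subseteq> G"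
      using assms(4) greaterThanLessThan_subseteq_atLeastAtMost_iff by blast
  qed (use assms in auto)
  finally show ?thesis .
qed

text \<open>
  The gauge is the derivative gauge at points of differentiability and the gauge given by an open
  set of small measure on the exceptional null set.
\<close>

lemma has_integral_absolutely_continuous_on:
  fixes f :: "real \<Rightarrow> complex"
  assumes ac: "absolutely_continuous_on {a..b} f" and ab: "a \<le> b" and N: "negligible N"
    and g: "\<And>x. x \<in> {a<..<b} - N \<Longrightarrow> (f has_vector_derivative g x) (at x)"
  shows "(g has_integral f b - f a) {a..b}"
proof -
  \<comment> \<open>The derivative is assumed only inside the interval, so the end points join the
    exceptional set.\<close>
  define N' where "N' = N \<union> {a, b}"
  have N': "negligible N'" unfolding N'_def using N by (simp add: negligible_Un)
  \<comment> \<open>With value 0 on the exceptional set, cells tagged there leave only the increment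
    of f, which absolute continuity controls.\<close>
  define g0 where "g0 x = (if x \<in> N' then 0 else g x)" for x
  have "(g0 has_integral f b - f a) {a..b}"
    unfolding has_integral_real
  proof (intro allI impI)
    fix e :: real assume "e > 0"
    \<comment> \<open>Chosen so that e' times the length of the interval is at most e / 2; the
      summand 1 guards against a = b.\<close>
    define e' where "e' = e / (2 * (b - a + 1))"
    have e': "e' > 0" using \<open>e > 0\<close> ab unfolding e'_def by simp
    obtain d where d: "d > 0" "\<forall>(I::(real \<times> real set) set) l r. finite I \<longrightarrow> (\<forall>i\<in>I. l i \<le> r i \<and> {l i..r i} \<subseteq> {a..b}) \<longrightarrow>
       disjoint_family_on (\<lambda>i. {l i<..<r i}) I \<longrightarrow> (\<Sum>i\<in>I. r i - l i) < d \<longrightarrow>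
       (\<Sum>i\<in>I. norm (f (r i) - f (l i))) < e / 2"
      using absolutely_continuous_on_sum[OF ac half_gt_zero[OF \<open>e > 0\<close>]] by blast
    obtain G where G: "open G" "N' \<subseteq> G" "G \<in> lmeasurable" "measure lebesgue G < d"
      using negligible_open_cover[OF N' d(1)] .
    have "\<exists>r>0. \<forall>y. \<bar>y - x\<bar> < r \<longrightarrow> norm (f y - f x - (y - x) *\<^sub>R g x) \<le> e' * \<bar>y - x\<bar>"
      if "x \<in> {a..b} - N'" for x
    proof -
      have "(f has_vector_derivative g x) (at x)"
        using that by (intro g) (auto simp: N'_def less_le)
      then show ?thesis
        using e' unfolding has_vector_derivative_def has_derivative_at_alt by auto
    qed
    then obtain \<rho> where \<rho>: "\<And>x. x \<in> {a..b} - N' \<Longrightarrow> \<rho> x > 0 \<and>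
        (\<forall>y. \<bar>y - x\<bar> < \<rho> x \<longrightarrow> norm (f y - f x - (y - x) *\<^sub>R g x) \<le> e' * \<bar>y - x\<bar>)"
      by metis
    define \<gamma> where "\<gamma> x = (if x \<in> N' then G else if x \<in> {a..b} then ball x (\<rho> x) else ball x 1)" for x
    have "gauge \<gamma>"
      unfolding gauge_def \<gamma>_def using G(1,2) \<rho> by auto
    moreover have "norm ((\<Sum>(x, K)\<in>p. measure lborel K *\<^sub>R g0 x) - (f b - f a)) < e"
      if p: "p tagged_division_of {a..b}" and fine: "\<gamma> fine p" for p
    proof -
      have pp: "p tagged_partial_division_of {a..b}" and fp: "finite p"
        using p by (auto simp: tagged_division_of_def tagged_partial_division_of_def)
      have tag: "fst i \<in> {Inf (snd i)..Sup (snd i)}" "{Inf (snd i)..Sup (snd i)} \<subseteq> {a..b}"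
          "{Inf (snd i)..Sup (snd i)} \<subseteq> \<gamma> (fst i)" "measure lborel (snd i) = Sup (snd i) - Inf (snd i)"
        if "i \<in> p" for i
      proof -
        obtain x K where i: "i = (x, K)" by (metis surj_pair)
        from that i have "(x, K) \<in> p" by simp
        from tagged_interval[OF this pp] fineD[OF fine this]
        show "fst i \<in> {Inf (snd i)..Sup (snd i)}" "{Inf (snd i)..Sup (snd i)} \<subseteq> {a..b}"
          "{Inf (snd i)..Sup (snd i)} \<subseteq> \<gamma> (fst i)" "measure lborel (snd i) = Sup (snd i) - Inf (snd i)"
          unfolding i by (simp_all) (metis atLeastAtMost_iff)
      qed
      have disj: "disjoint_family_on (\<lambda>i. {Inf (snd i)<..<Sup (snd i)}) p"
        using tagged_disjoint_interiors[OF pp] by (simp add: case_prod_unfold)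
      define T where "T i = measure lborel (snd i) *\<^sub>R g0 (fst i) - (f (Sup (snd i)) - f (Inf (snd i)))" for i
      define q where "q = {i \<in> p. fst i \<in> N'}"
      have q: "finite q" "q \<subseteq> p" using fp by (auto simp: q_def)
      have fba: "(\<Sum>i\<in>p. f (Sup (snd i)) - f (Inf (snd i))) = f b - f a"
        using additive_tagged_division_1[OF ab p, of f] by (simp add: case_prod_beta)
      have "(\<Sum>(x, K)\<in>p. measure lborel K *\<^sub>R g0 x) - (f b - f a) = (\<Sum>i\<in>p. T i)"
        unfolding T_def fba[symmetric] by (simp add: sum_subtractf case_prod_unfold)
      also have "norm \<dots> \<le> (\<Sum>i\<in>p. norm (T i))" by (rule norm_sum)
      also have "\<dots> = (\<Sum>i\<in>p - q. norm (T i)) + (\<Sum>i\<in>q. norm (T i))"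
        using fp q by (simp add: sum.subset_diff)
      also have "(\<Sum>i\<in>q. norm (T i)) < e / 2"
      proof -
        have "(\<Sum>i\<in>q. Sup (snd i) - Inf (snd i)) \<le> measure lebesgue G"
        proof (rule sum_lengths_le_measure[OF q(1) _ G(3)])
          show "disjoint_family_on (\<lambda>i. {Inf (snd i)<..<Sup (snd i)}) q"
            using disj q(2) by (rule disjoint_family_on_mono[rotated])
          show "Inf (snd i) \<le> Sup (snd i) \<and> {Inf (snd i)..Sup (snd i)} \<subseteq> G" if "i \<in> q" for i
            using tag[of i] that by (auto simp: q_def \<gamma>_def)
        qed
        also note G(4)
        finally have len: "(\<Sum>i\<in>q. Sup (snd i) - Inf (snd i)) < d" .
        have "(\<Sum>i\<in>q. norm (f (Sup (snd i)) - f (Inf (snd i)))) < e / 2"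
        proof (rule d(2)[rule_format, of q "\<lambda>i. Inf (snd i)" "\<lambda>i. Sup (snd i)"])
          show "disjoint_family_on (\<lambda>i. {Inf (snd i)<..<Sup (snd i)}) q"
            using disj q(2) by (rule disjoint_family_on_mono[rotated])
          show "Inf (snd i) \<le> Sup (snd i) \<and> {Inf (snd i)..Sup (snd i)} \<subseteq> {a..b}" if "i \<in> q" for i
            using tag(1,2)[of i] that q(2) by auto
        qed (fact q(1) len)+
        moreover have "(\<Sum>i\<in>q. norm (T i)) = (\<Sum>i\<in>q. norm (f (Sup (snd i)) - f (Inf (snd i))))"
          by (rule sum.cong) (auto simp: T_def q_def g0_def norm_minus_commute)
        ultimately show ?thesis by simp
      qed
      also have "(\<Sum>i\<in>p - q. norm (T i)) \<le> e / 2"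
      proof -
        have "norm (T i) \<le> e' * measure lborel (snd i)" if "i \<in> p - q" for i
        proof -
          let ?x = "fst i" and ?u = "Inf (snd i)" and ?v = "Sup (snd i)"
          have i: "i \<in> p" "?x \<notin> N'" using that by (auto simp: q_def)
          have x: "?x \<in> {a..b} - N'" using tag[OF i(1)] i(2) by auto
          have "{?u..?v} \<subseteq> ball ?x (\<rho> ?x)"
            using tag(3)[OF i(1)] x by (auto simp: \<gamma>_def)
          moreover have "?u \<in> {?u..?v}" "?v \<in> {?u..?v}" using tag(1)[OF i(1)] by auto
          ultimately have "?u \<in> ball ?x (\<rho> ?x)" "?v \<in> ball ?x (\<rho> ?x)" by blast+
          then have uv: "\<bar>?u - ?x\<bar> < \<rho> ?x" "\<bar>?v - ?x\<bar> < \<rho> ?x"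
            by (auto simp: dist_real_def)
          \<comment> \<open>The increment over a cell is split at its tag. The tag lies between the
            end points, so the two error bounds add up to e' times the length of the cell.\<close>
          have "T i = (f ?u - f ?x - (?u - ?x) *\<^sub>R g ?x) - (f ?v - f ?x - (?v - ?x) *\<^sub>R g ?x)"
            using i(2) by (simp add: T_def g0_def tag(4)[OF i(1)] algebra_simps)
          also have "norm \<dots> \<le> e' * \<bar>?u - ?x\<bar> + e' * \<bar>?v - ?x\<bar>"
            using \<rho>[OF x] uv by (intro order_trans[OF norm_triangle_ineq4 add_mono]) blast+
          also have "\<dots> = e' * measure lborel (snd i)"
            using tag(1)[OF i(1)] by (simp add: tag(4)[OF i(1)] algebra_simps)
          finally show ?thesis .
        qed
        then have "(\<Sum>i\<in>p - q. norm (T i)) \<le> (\<Sum>i\<in>p - q. e' * measure lborel (snd i))"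
          by (rule sum_mono)
        also have "\<dots> \<le> (\<Sum>i\<in>p. e' * measure lborel (snd i))"
          using fp e' by (intro sum_mono2) auto
        also have "\<dots> = e' * (b - a)"
          using additive_content_tagged_division[of p a b] p ab
          by (simp add: sum_distrib_left[symmetric] case_prod_beta)
        also have "\<dots> \<le> e / 2" unfolding e'_def using ab \<open>e > 0\<close> by (simp add: divide_simps)
        finally show ?thesis .
      qed
      finally show ?thesis by simp
    qed
    ultimately show "\<exists>\<gamma>. gauge \<gamma> \<and> (\<forall>p. p tagged_division_of {a..b} \<and> \<gamma> fine p \<longrightarrow>
        norm ((\<Sum>(x, K)\<in>p. measure lborel K *\<^sub>R g0 x) - (f b - f a)) < e)"
      by (intro exI[of _ \<gamma>]) simp
  qed
  then show ?thesis
    by (rule has_integral_spike[OF N', rotated]) (auto simp: g0_def)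
qed

text \<open>
  Where the difference quotients fail to converge, arbitrarily short intervals violate the estimate
  of Henstock's lemma; a disjoint Vitali subfamily of these has arbitrarily small total length.
\<close>

lemma indefinite_integral_has_vector_derivative_AE:
  fixes g :: "real \<Rightarrow> 'a::euclidean_space"
  assumes g: "g integrable_on {a..b}"
  shows "negligible {x \<in> {a<..<b}. \<not> ((\<lambda>x. integral {a..x} g) has_vector_derivative g x) (at x)}"
proof -
  define F where "F x = integral {a..x} g" for x
  \<comment> \<open>\<open>E k\<close> will collect the points where accuracy 1 / (k + 1) fails at
    arbitrarily small scales. A point at which g x is not the derivative lies in some
    \<open>E k\<close>, so it suffices that these countably many sets are null.\<close>
  define bad where "bad k x y \<longleftrightarrow> norm (F y - F x - (y - x) *\<^sub>R g x) > \<bar>y - x\<bar> / real (Suc k)" for k x y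
  define E where "E k = {x \<in> {a<..<b}. \<forall>d>0. \<exists>y\<in>{a..b}. 0 < \<bar>y - x\<bar> \<and> \<bar>y - x\<bar> < d \<and> bad k x y}" for k
  have "negligible (E k)" for k
    unfolding negligible_outer_le
  proof (intro allI impI)
    fix e :: real assume "e > 0"
    \<comment> \<open>Each selected interval has an error of at least its length divided by k + 1,
      so the Henstock bound e / (k + 1) limits the total length to e.\<close>
    then have e': "e / real (Suc k) > 0" by simp
    have "g integrable_on cbox a b" using g by simp
    from Henstock_lemma[OF this e'] obtain \<gamma> where \<gamma>: "gauge \<gamma>"
      "\<And>p. p tagged_partial_division_of (cbox a b) \<Longrightarrow> \<gamma> fine p \<Longrightarrow>
        (\<Sum>(x, K)\<in>p. norm (measure lborel K *\<^sub>R g x - integral K g)) < e / real (Suc k)"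
      by blast
    define S where "S i = {min (fst i) (snd i)..max (fst i) (snd i)}" for i :: "real \<times> real"
    define K where "K = {i. fst i \<in> E k \<and> snd i \<in> {a..b} \<and> fst i \<noteq> snd i \<and> S i \<subseteq> \<gamma> (fst i) \<and> bad k (fst i) (snd i)}"
    define c where "c i = (fst i + snd i) / 2" for i :: "real \<times> real"
    define r where "r i = \<bar>fst i - snd i\<bar> / 2" for i :: "real \<times> real"
    have S: "cball (c i) (r i) = S i" for i
      by (auto simp: S_def c_def r_def cball_eq_atLeastAtMost field_simps abs_if min_def max_def)
    obtain C where C: "countable C" "C \<subseteq> K" "pairwise (\<lambda>i j. disjnt (cball (c i) (r i)) (cball (c j) (r j))) C"
      "negligible (E k - (\<Union>i\<in>C. cball (c i) (r i)))"
    proof (rule Vitali_covering_theorem_cballs[of K r "E k" c])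
      show "0 < r i" if "i \<in> K" for i using that by (auto simp: K_def r_def)
      fix x d :: real assume x: "x \<in> E k" and "d > 0"
      obtain \<delta> where \<delta>: "\<delta> > 0" "ball x \<delta> \<subseteq> \<gamma> x"
        using \<gamma>(1) unfolding gauge_def by (meson openE)
      obtain y where y: "y \<in> {a..b}" "0 < \<bar>y - x\<bar>" "\<bar>y - x\<bar> < min \<delta> d" "bad k x y"
      proof -
        have "\<forall>d>0. \<exists>y\<in>{a..b}. 0 < \<bar>y - x\<bar> \<and> \<bar>y - x\<bar> < d \<and> bad k x y" using x by (simp add: E_def)
        from this[rule_format, of "min \<delta> d"] show ?thesis using \<open>d > 0\<close> \<delta>(1) that by auto
      qed
      have "S (x, y) \<subseteq> ball x \<delta>" using y(3) by (auto simp: S_def dist_real_def)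
      with y x \<delta> have "(x, y) \<in> K" by (auto simp: K_def)
      moreover have "x \<in> cball (c (x, y)) (r (x, y))" unfolding S by (simp add: S_def)
      moreover have "r (x, y) < d" using y \<open>d > 0\<close> by (simp add: r_def abs_minus_commute[of x])
      ultimately show "\<exists>i. i \<in> K \<and> x \<in> cball (c i) (r i) \<and> r i < d" by blast
    qed blast
    note C = C[unfolded S]
    \<comment> \<open>Only finite subfamilies form partial divisions. The bound does not depend on
      the subfamily, so it passes to the countable union.\<close>
    have bound: "measure lebesgue (\<Union>i\<in>D. S i) \<le> e" if D: "D \<subseteq> C" "finite D" for D
    proof -
      have DK: "D \<subseteq> K" using D C by blast
      define p where "p = (\<lambda>i. (fst i, S i)) ` D"
      have meas: "measure lborel (S i) = \<bar>snd i - fst i\<bar>" for i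
        by (auto simp: S_def min_def max_def)
      have disj: "disjnt (S i) (S j)" if "i \<in> D" "j \<in> D" "i \<noteq> j" for i j
        using C(3) that D unfolding pairwise_def by blast
      have ne: "fst i \<in> S i" for i by (simp add: S_def)
      have inj: "inj_on (\<lambda>i. (fst i, S i)) D"
      proof (rule inj_onI)
        fix i j assume "i \<in> D" "j \<in> D" "(fst i, S i) = (fst j, S j)"
        then show "i = j" using disj[of i j] ne[of i] by (auto simp: disjnt_def)
      qed
      have Sab: "S i \<subseteq> {a..b}" if "i \<in> K" for i
        using that by (auto simp: K_def E_def S_def)
      have "p tagged_partial_division_of (cbox a b)"
        unfolding tagged_partial_division_of_def
      proof (intro conjI allI impI)
        show "finite p" using D by (simp add: p_def)
        fix x L assume xL: "(x, L) \<in> p"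
        then obtain i where i: "i \<in> D" "x = fst i" "L = S i" by (auto simp: p_def)
        show "x \<in> L" using ne i by simp
        show "L \<subseteq> cbox a b" using Sab[of i] i DK by auto
        show "\<exists>a b. L = cbox a b" unfolding i S_def by (metis box_real(2))
      next
        fix x1 K1 x2 K2 assume "(x1, K1) \<in> p \<and> (x2, K2) \<in> p \<and> (x1, K1) \<noteq> (x2, K2)"
        then obtain i j where "i \<in> D" "j \<in> D" "K1 = S i" "K2 = S j" "i \<noteq> j" by (auto simp: p_def)
        then have "K1 \<inter> K2 = {}" using disj[of i j] by (simp add: disjnt_def)
        then show "interior K1 \<inter> interior K2 = {}" using interior_subset by blast
      qed
      moreover have "\<gamma> fine p"
        using DK by (auto simp: fine_def p_def K_def)
      ultimately have "(\<Sum>(x, K)\<in>p. norm (measure lborel K *\<^sub>R g x - integral K g)) < e / real (Suc k)"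
        by (rule \<gamma>(2))
      also have "(\<Sum>(x, K)\<in>p. norm (measure lborel K *\<^sub>R g x - integral K g))
          = (\<Sum>i\<in>D. norm (measure lborel (S i) *\<^sub>R g (fst i) - integral (S i) g))"
        unfolding p_def using inj by (simp add: sum.reindex)
      finally have 1: "(\<Sum>i\<in>D. norm (measure lborel (S i) *\<^sub>R g (fst i) - integral (S i) g)) < e / real (Suc k)" .
      have "measure lborel (S i) / real (Suc k) \<le> norm (measure lborel (S i) *\<^sub>R g (fst i) - integral (S i) g)"
        if "i \<in> D" for i
      proof -
        obtain x y where i: "i = (x, y)" by (cases i)
        have xy: "a \<le> x" "x \<le> b" "a \<le> y" "y \<le> b" "x \<noteq> y" "bad k x y"
          using that DK i by (auto simp: K_def E_def)
        have diff: "F v - F u = integral {u..v} g" if "a \<le> u" "u \<le> v" "v \<le> b" for u v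
        proof -
          have "integral {a..u} g + integral {u..v} g = integral {a..v} g"
            using that g by (intro Henstock_Kurzweil_Integration.integral_combine)
              (auto intro: integrable_subinterval_real)
          then show ?thesis by (simp add: F_def algebra_simps)
        qed
        have "norm (F y - F x - (y - x) *\<^sub>R g x) = norm (measure lborel (S i) *\<^sub>R g (fst i) - integral (S i) g)"
        proof (cases "x \<le> y")
          case True
          then show ?thesis using diff[of x y] xy
            by (simp add: meas i norm_minus_commute) (simp add: S_def)
        next
          case False
          then have "F y - F x - (y - x) *\<^sub>R g x = measure lborel (S i) *\<^sub>R g (fst i) - integral (S i) g"
            using diff[of y x] xy by (simp add: meas i) (simp add: S_def algebra_simps)
          then show ?thesis by simp
        qed
        then show ?thesis using xy(6) unfolding bad_def meas i by simp
      qed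
      then have "(\<Sum>i\<in>D. measure lborel (S i) / real (Suc k)) < e / real (Suc k)"
        by (intro le_less_trans[OF sum_mono 1]) auto
      then have "(\<Sum>i\<in>D. measure lborel (S i)) < e"
        by (simp add: sum_divide_distrib[symmetric] divide_less_cancel)
      moreover have "measure lebesgue (\<Union>i\<in>D. S i) \<le> (\<Sum>i\<in>D. measure lebesgue (S i))"
        using D by (intro measure_UNION_le) (auto simp: S_def)
      moreover have "measure lebesgue (S i) = measure lborel (S i)" for i
        by (simp add: S_def)
      ultimately show ?thesis by simp
    qed
    have meas: "S i \<in> lmeasurable" for i by (simp add: S_def)
    define T where "T = (\<Union>i\<in>C. S i)"
    have T: "T \<in> lmeasurable" "measure lebesgue T \<le> e"
      unfolding T_def
      by (rule fmeasurable_UN_bound[OF C(1)] measure_UN_bound[OF C(1)]; use bound meas \<open>e > 0\<close> in auto)+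
    show "\<exists>T. E k \<subseteq> T \<and> T \<in> lmeasurable \<and> measure lebesgue T \<le> e"
    proof (intro exI[of _ "(E k - T) \<union> T"] conjI)
      have neg: "negligible (E k - T)" using C(4) by (simp add: T_def)
      then have lm: "E k - T \<in> lmeasurable" by (rule negligible_imp_measurable)
      show "(E k - T) \<union> T \<in> lmeasurable" using lm T by blast
      have "measure lebesgue ((E k - T) \<union> T) \<le> measure lebesgue (E k - T) + measure lebesgue T"
        using lm T by (intro measure_Un_le) auto
      then show "measure lebesgue ((E k - T) \<union> T) \<le> e"
        using T(2) negligible_imp_measure0[OF neg] by simp
    qed blast
  qed
  then have "negligible (\<Union>k. E k)" by (intro negligible_countable_Union) auto
  moreover have "{x \<in> {a<..<b}. \<not> (F has_vector_derivative g x) (at x)} \<subseteq> (\<Union>k. E k)"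
  proof clarsimp
    fix x assume x: "a < x" "x < b" and nd: "\<not> (F has_vector_derivative g x) (at x)"
    show "\<exists>k. x \<in> E k"
    proof (rule ccontr)
      assume no: "\<nexists>k. x \<in> E k"
      have "\<exists>d>0. \<forall>y. norm (y - x) < d \<longrightarrow> norm (F y - F x - (y - x) *\<^sub>R g x) \<le> e * norm (y - x)" if "e > 0" for e
      proof -
        obtain k where k: "1 / real (Suc k) < e" using \<open>e > 0\<close> nat_approx_posE by blast
        from no have "x \<notin> E k" by blast
        with x obtain d where d: "d > 0" "\<forall>y\<in>{a..b}. \<not> (0 < \<bar>y - x\<bar> \<and> \<bar>y - x\<bar> < d \<and> bad k x y)"
          unfolding E_def by auto
        show ?thesis
        proof (intro exI[of _ "min d (min (x - a) (b - x))"] conjI allI impI)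
          show "0 < min d (min (x - a) (b - x))" using d x by simp
          fix y assume y: "norm (y - x) < min d (min (x - a) (b - x))"
          show "norm (F y - F x - (y - x) *\<^sub>R g x) \<le> e * norm (y - x)"
          proof (cases "y = x")
            case False
            then have "0 < \<bar>y - x\<bar>" "\<bar>y - x\<bar> < d" "y \<in> {a..b}" using y by (auto simp: abs_less_iff)
            then have "\<not> bad k x y" using d(2) by blast
            then have "norm (F y - F x - (y - x) *\<^sub>R g x) \<le> 1 / real (Suc k) * \<bar>y - x\<bar>"
              by (simp add: bad_def)
            also have "\<dots> \<le> e * \<bar>y - x\<bar>" using k by (intro mult_right_mono) auto
            finally show ?thesis by simp
          qed simp
        qed
      qed
      then have "(F has_vector_derivative g x) (at x)"
        unfolding has_vector_derivative_def has_derivative_at_alt by (auto intro: bounded_linear_scaleR_left)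
      with nd show False by simp
    qed
  qed
  ultimately show ?thesis unfolding F_def by (rule negligible_subset)
qed

subsection \<open>Tail integrals\<close>

text \<open>Tool for conserved quantities: it serves the weight identity, the Wronskian and the
  quotient of two solutions, whose derivatives are known only almost everywhere.\<close>

lemma absolutely_continuous_on_deriv_0:
  assumes "absolutely_continuous_on {a..b} f" "a \<le> b" "negligible N"
    and "\<And>x. x \<in> {a<..<b} - N \<Longrightarrow> (f has_vector_derivative 0) (at x)"
  shows "f b = f a"
proof -
  have "((\<lambda>_. 0) has_integral f b - f a) {a..b}"
    using assms by (rule has_integral_absolutely_continuous_on)
  then show ?thesis by (metis has_integral_0 has_integral_unique right_minus_eq)
qed

lemma negligible_not_AE: "AE t in lebesgue. P t \<Longrightarrow> negligible {t. \<not> P t}"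
  unfolding eventually_ae_filter_negligible by (metis negligible_subset)

text \<open>Integration starts at infinity because solutions are normalised there. The measure is
  \<open>lebesgue\<close> since the coefficients are only Lebesgue measurable.\<close>

definition tail_integral :: "(real \<Rightarrow> 'a) \<Rightarrow> real \<Rightarrow> 'a::{banach, second_countable_topology}" where
  "tail_integral f x = (LINT t:{x..}|lebesgue. f t)"

lemma set_integrable_lebesgue:
  fixes f :: "real \<Rightarrow> 'a::{banach, second_countable_topology}"
  assumes "integrable lebesgue f" "S \<in> sets lebesgue"
  shows "set_integrable lebesgue S f"
  unfolding set_integrable_def using assms by (rule integrable_mult_indicator[rotated])

lemma tail_integral_diff:
  fixes f :: "real \<Rightarrow> 'a::euclidean_space"
  assumes f: "integrable lebesgue f" and xy: "x \<le> y"
  shows "tail_integral f x - tail_integral f y = integral {x..y} f"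
proof -
  have *: "set_integrable lebesgue S f" if "S \<in> sets lebesgue" for S
    using f that by (rule set_integrable_lebesgue)
  have "integral ({x..y} \<union> {y..}) f = integral {x..y} f + integral {y..} f"
  proof (rule integral_Un)
    show "f integrable_on {x..y}" "f integrable_on {y..}"
      using * by (auto intro!: set_lebesgue_integral_eq_integral(1))
    have "{x..y} \<inter> {y..} = {y}" using xy by auto
    then show "negligible ({x..y} \<inter> {y..})" by simp
  qed
  moreover have "{x..y} \<union> {y..} = {x..}" using xy by auto
  moreover have "tail_integral f z = integral {z..} f" for z
    unfolding tail_integral_def using * by (auto intro!: set_lebesgue_integral_eq_integral(2))
  ultimately show ?thesis by simp
qed

text \<open>The bound is required only for t \<ge> x: the factor e^{2ik(t - x)} of the later
  integrals has modulus at most 1 on that side, but may be large on the other.\<close>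

lemma set_integrable_tail_bound:
  fixes f :: "real \<Rightarrow> 'a::{banach, second_countable_topology}"
  assumes f: "f \<in> borel_measurable lebesgue" and g: "integrable lebesgue g"
    and le: "\<And>t. t \<ge> x \<Longrightarrow> norm (f t) \<le> g t"
  shows "set_integrable lebesgue {x..} f"
  unfolding set_integrable_def
proof (rule Bochner_Integration.integrable_bound)
  show "integrable lebesgue (\<lambda>t. indicator {x..} t *\<^sub>R g t)"
    using set_integrable_lebesgue[OF g, of "{x..}"] by (simp add: set_integrable_def)
  show "(\<lambda>t. indicator {x..} t *\<^sub>R f t) \<in> borel_measurable lebesgue"
    using f by (intro borel_measurable_scaleR borel_measurable_indicator) auto
  have "norm (indicator {x..} t *\<^sub>R f t) \<le> norm (indicator {x..} t *\<^sub>R g t)" for t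
    using le[of t] by (auto simp: indicator_def)
  then show "AE t in lebesgue. norm (indicator {x..} t *\<^sub>R f t) \<le> norm (indicator {x..} t *\<^sub>R g t)"
    by simp
qed

lemma tail_integral_norm_le:
  fixes f :: "real \<Rightarrow> 'a::{banach, second_countable_topology}"
  assumes "f \<in> borel_measurable lebesgue" "integrable lebesgue g" "\<And>t. t \<ge> x \<Longrightarrow> norm (f t) \<le> g t"
  shows "norm (tail_integral f x) \<le> tail_integral g x"
proof -
  have f: "set_integrable lebesgue {x..} f" using assms by (rule set_integrable_tail_bound)
  have "norm (tail_integral f x) \<le> (LINT t|lebesgue. norm (indicator {x..} t *\<^sub>R f t))"
    unfolding tail_integral_def set_lebesgue_integral_def by (rule integral_norm_bound)
  also have "\<dots> \<le> tail_integral g x"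
    unfolding tail_integral_def set_lebesgue_integral_def
  proof (rule integral_mono)
    show "integrable lebesgue (\<lambda>t. norm (indicator {x..} t *\<^sub>R f t))"
      using f unfolding set_integrable_def by (rule integrable_norm)
    show "integrable lebesgue (\<lambda>t. indicator {x..} t *\<^sub>R g t)"
      using set_integrable_lebesgue[OF assms(2), of "{x..}"] by (auto simp: set_integrable_def)
  qed (use assms(3) in \<open>auto simp: indicator_def\<close>)
  finally show ?thesis .
qed

lemma tail_integral_nonneg: "(\<And>t. f t \<ge> (0::real)) \<Longrightarrow> tail_integral f x \<ge> 0"
  unfolding tail_integral_def set_lebesgue_integral_def by (intro integral_nonneg_AE) (auto simp: indicator_def)

lemma tail_integral_le_total:
  fixes f :: "real \<Rightarrow> real"
  assumes "integrable lebesgue f" "\<And>t. f t \<ge> 0"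
  shows "tail_integral f x \<le> (LINT t|lebesgue. f t)"
  unfolding tail_integral_def set_lebesgue_integral_def
  using set_integrable_lebesgue[OF assms(1), of "{x..}"] assms
  by (intro integral_mono) (auto simp: set_integrable_def indicator_def)

lemma tail_integral_tendsto_0:
  fixes f :: "real \<Rightarrow> 'a::{banach, second_countable_topology}"
  assumes f: "integrable lebesgue f"
  shows "(tail_integral f \<longlongrightarrow> 0) at_top"
proof -
  have "((\<lambda>x. LINT t|lebesgue. indicator {x..} t *\<^sub>R f t) \<longlongrightarrow> (LINT t|(lebesgue :: real measure). (0::'a))) at_top"
  proof (rule integral_dominated_convergence_at_top[where w = "\<lambda>t. norm (f t)"])
    show "(\<lambda>t. indicator {x..} t *\<^sub>R f t) \<in> borel_measurable lebesgue" for x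
      using set_integrable_lebesgue[OF f, of "{x..}"]
      unfolding set_integrable_def by (intro borel_measurable_integrable) auto
    have "((\<lambda>x. indicator {x..} t *\<^sub>R f t) \<longlongrightarrow> 0) at_top" for t
      by (rule tendsto_eventually) (auto intro!: eventually_at_top_dense[THEN iffD2] exI[of _ t])
    then show "AE t in lebesgue. ((\<lambda>x. indicator {x..} t *\<^sub>R f t) \<longlongrightarrow> 0) at_top" by simp
  qed (use f in \<open>auto simp: indicator_def\<close>)
  then show ?thesis by (simp add: tail_integral_def[abs_def] set_lebesgue_integral_def)
qed

text \<open>Differentiability is local, so the line is exhausted by the intervals (-n, n); on each
  of them the tail integral is a constant minus an indefinite integral.\<close>

lemma tail_integral_has_vector_derivative_AE:
  fixes f :: "real \<Rightarrow> 'a::euclidean_space"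
  assumes f: "integrable lebesgue f"
  shows "AE x in lebesgue. (tail_integral f has_vector_derivative - f x) (at x)"
proof -
  define N where "N n = {x \<in> {- real n<..<real n}.
     \<not> ((\<lambda>x. integral {- real n..x} f) has_vector_derivative f x) (at x)}" for n
  have "negligible (N n)" for n
    unfolding N_def
  proof (rule indefinite_integral_has_vector_derivative_AE)
    show "f integrable_on {- real n..real n}"
      using set_integrable_lebesgue[OF f, of "{- real n..real n}"]
      by (auto intro: set_lebesgue_integral_eq_integral(1))
  qed
  then have "(\<Union>n. N n) \<in> null_sets lebesgue"
    by (simp flip: negligible_iff_null_sets add: negligible_Union_nat)
  moreover have "{x. \<not> (tail_integral f has_vector_derivative - f x) (at x)} \<subseteq> (\<Union>n. N n)"
  proof (rule subsetI, rule ccontr)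
    fix x assume x: "x \<in> {x. \<not> (tail_integral f has_vector_derivative - f x) (at x)}" "x \<notin> (\<Union>n. N n)"
    obtain n :: nat where n: "\<bar>x\<bar> < real n" using reals_Archimedean2 by blast
    with x(2) have "((\<lambda>x. integral {- real n..x} f) has_vector_derivative f x) (at x)"
      by (force simp: N_def)
    then have "((\<lambda>x. tail_integral f (- real n) - integral {- real n..x} f) has_vector_derivative - f x) (at x)"
      by (auto intro!: derivative_eq_intros)
    then have "(tail_integral f has_vector_derivative - f x) (at x)"
    proof (rule has_vector_derivative_transform_within_open[of _ _ _ "{- real n<..}"])
      show "x \<in> {- real n<..}" using n by auto
      show "tail_integral f (- real n) - integral {- real n..y} f = tail_integral f y" if "y \<in> {- real n<..}" for y
        using tail_integral_diff[OF f, of "- real n" y] that by (simp add: algebra_simps)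
    qed simp
    with x(1) show False by simp
  qed
  ultimately show ?thesis by (intro AE_I'[of "\<Union>n. N n"]) auto
qed

text \<open>The norm of f is truncated at a level m. The excess \<open>w m\<close> has integral
  below e / 2 for large m by dominated convergence, and the truncated part contributes at most m
  times the total length. Nothing depends on position, so the set \<open>S\<close> is
  arbitrary.\<close>

lemma absolutely_continuous_on_tail:
  assumes f: "integrable lebesgue f"
  shows "absolutely_continuous_on S (tail_integral f)"
  unfolding absolutely_continuous_on_def
proof (intro allI impI)
  fix e :: real assume "e > 0"
  define w where "w m t = norm (f t) - min (norm (f t)) (real m)" for m t
  have nf: "integrable lebesgue (\<lambda>t. norm (f t))" using f by simp
  have wint: "integrable lebesgue (w m)" for m
    using f unfolding w_def
    by (intro Bochner_Integration.integrable_bound[OF nf]) (auto simp: min_def)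
  have "(\<lambda>m. LINT t|lebesgue. w m t) \<longlonglongrightarrow> (LINT t|(lebesgue :: real measure). (0::real))"
  proof (rule integral_dominated_convergence[where w = "\<lambda>t. norm (f t)"])
    have "(\<lambda>m. w m t) \<longlonglongrightarrow> 0" for t
    proof (rule tendsto_eventually)
      obtain m :: nat where "norm (f t) \<le> real m" using real_arch_simple by blast
      then show "eventually (\<lambda>m. w m t = 0) sequentially"
        unfolding eventually_sequentially w_def
        by (intro exI[of _ m]) (auto simp: min_def)
    qed
    then show "AE t in lebesgue. (\<lambda>m. w m t) \<longlonglongrightarrow> 0" by simp
    show "w m \<in> borel_measurable lebesgue" for m using wint by (rule borel_measurable_integrable)
    show "AE t in lebesgue. norm (w m t) \<le> norm (f t)" for m
      by (auto simp: w_def min_def)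
  qed (use nf in auto)
  then have "eventually (\<lambda>m. (LINT t|lebesgue. w m t) < e / 2) sequentially"
    using \<open>e > 0\<close> by (intro order_tendstoD(2)[of _ 0]) auto
  then obtain m where m: "(LINT t|lebesgue. w m t) < e / 2"
    unfolding eventually_sequentially by blast
  show "\<exists>d>0. \<forall>(n::nat) a b. (\<forall>i<n. a i \<le> b i \<and> {a i..b i} \<subseteq> S) \<longrightarrow>
        disjoint_family_on (\<lambda>i. {a i<..<b i}) {..<n} \<longrightarrow> (\<Sum>i<n. b i - a i) < d \<longrightarrow>
        (\<Sum>i<n. norm (tail_integral f (b i) - tail_integral f (a i))) < e"
  proof (intro exI[of _ "e / (2 * (real m + 1))"] conjI allI impI)
    show "0 < e / (2 * (real m + 1))" using \<open>e > 0\<close> by simp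
    fix n :: nat and a b :: "nat \<Rightarrow> real"
    assume ab: "\<forall>i<n. a i \<le> b i \<and> {a i..b i} \<subseteq> S"
      and dis: "disjoint_family_on (\<lambda>i. {a i<..<b i}) {..<n}"
      and len: "(\<Sum>i<n. b i - a i) < e / (2 * (real m + 1))"
    have wi: "integrable lebesgue (\<lambda>t. indicator {a i<..<b i} t * w m t)" for i
      using integrable_mult_indicator[OF _ wint, of "{a i<..<b i}" m] by simp
    have ci: "integrable lebesgue (\<lambda>t. indicator {a i<..<b i} t * real m)" for i
      by (intro integrable_mult_left integrable_real_indicator; cases "a i \<le> b i"; simp)
    have "norm (tail_integral f (b i) - tail_integral f (a i)) \<le> (LINT t|lebesgue. indicator {a i<..<b i} t * w m t) + real m * (b i - a i)"
      if i: "i < n" for i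
    proof -
      have le: "a i \<le> b i" using ab i by auto
      have fi: "set_integrable lebesgue {a i..b i} f" "set_integrable lebesgue {a i<..<b i} f"
        by (intro set_integrable_lebesgue f; simp)+
      have "tail_integral f (a i) - tail_integral f (b i) = integral {a i<..<b i} f"
        by (simp add: tail_integral_diff[OF f le] integral_open_interval_real)
      also have "\<dots> = (LINT t:{a i<..<b i}|lebesgue. f t)"
        using set_lebesgue_integral_eq_integral(2)[OF fi(2)] by simp
      finally have "norm (tail_integral f (b i) - tail_integral f (a i)) = norm (LINT t:{a i<..<b i}|lebesgue. f t)"
        by (metis norm_minus_commute)
      also have "\<dots> \<le> (LINT t|lebesgue. norm (indicator {a i<..<b i} t *\<^sub>R f t))"
        unfolding set_lebesgue_integral_def by (rule integral_norm_bound)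
      also have "\<dots> \<le> (LINT t|lebesgue. indicator {a i<..<b i} t * w m t + indicator {a i<..<b i} t * real m)"
      proof (rule integral_mono)
        show "integrable lebesgue (\<lambda>t. norm (indicator {a i<..<b i} t *\<^sub>R f t))"
          using fi(2) unfolding set_integrable_def by (rule integrable_norm)
        show "integrable lebesgue (\<lambda>t. indicator {a i<..<b i} t * w m t + indicator {a i<..<b i} t * real m)"
          using wi ci by (rule Bochner_Integration.integrable_add)
      qed (auto simp: indicator_def w_def)
      also have "\<dots> = (LINT t|lebesgue. indicator {a i<..<b i} t * w m t) + real m * (b i - a i)"
        using wi ci le by (simp add: Bochner_Integration.integral_add)
      finally show ?thesis .
    qed
    then have "(\<Sum>i<n. norm (tail_integral f (b i) - tail_integral f (a i)))
        \<le> (\<Sum>i<n. (LINT t|lebesgue. indicator {a i<..<b i} t * w m t) + real m * (b i - a i))"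
      by (intro sum_mono) auto
    also have "\<dots> = (\<Sum>i<n. LINT t|lebesgue. indicator {a i<..<b i} t * w m t) + real m * (\<Sum>i<n. b i - a i)"
      by (simp add: sum.distrib sum_distrib_left)
    also have "(\<Sum>i<n. LINT t|lebesgue. indicator {a i<..<b i} t * w m t)
        = (LINT t|lebesgue. (\<Sum>i<n. indicator {a i<..<b i} t * w m t))"
      by (rule Bochner_Integration.integral_sum[symmetric]) (rule wi)
    also have "\<dots> \<le> (LINT t|lebesgue. w m t)"
    proof (rule integral_mono)
      show "integrable lebesgue (\<lambda>t. \<Sum>i<n. indicator {a i<..<b i} t * w m t)"
        by (intro Bochner_Integration.integrable_sum wi)
      fix t
      \<comment> \<open>Disjointness enters here: at most one indicator is nonzero at t, so no
        excess is counted twice.\<close>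
      have "(\<Sum>i<n. indicator {a i<..<b i} t * w m t) = indicator (\<Union>i<n. {a i<..<b i}) t * w m t"
        by (simp only: indicator_UN_disjoint[OF finite_lessThan dis] sum_distrib_right)
      also have "\<dots> \<le> w m t" by (simp add: indicator_def w_def)
      finally show "(\<Sum>i<n. indicator {a i<..<b i} t * w m t) \<le> w m t" .
    qed (rule wint)
    also note m
    also have "real m * (\<Sum>i<n. b i - a i) \<le> real m * (e / (2 * (real m + 1)))"
      using len by (intro mult_left_mono) auto
    also have "\<dots> \<le> e / 2" using \<open>e > 0\<close> by (simp add: divide_simps)
    finally show "(\<Sum>i<n. norm (tail_integral f (b i) - tail_integral f (a i))) < e" by simp
  qed
qed

lemma continuous_on_tail:
  fixes f :: "real \<Rightarrow> 'a::euclidean_space"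
  assumes f: "integrable lebesgue f"
  shows "continuous_on UNIV (tail_integral f)"
proof -
  have "isCont (tail_integral f) x" for x
  proof -
    have "f integrable_on {x - 1..x + 1}"
      using set_integrable_lebesgue[OF f, of "{x - 1..x + 1}"]
      by (auto intro: set_lebesgue_integral_eq_integral(1))
    then have "continuous_on {x - 1..x + 1} (\<lambda>y. integral {x - 1..y} f)"
      by (rule indefinite_integral_continuous_1)
    then have "continuous_on {x - 1<..<x + 1} (\<lambda>y. tail_integral f (x - 1) - integral {x - 1..y} f)"
      by (intro continuous_intros) (auto elim: continuous_on_subset)
    then have "continuous_on {x - 1<..<x + 1} (tail_integral f)"
    proof (rule continuous_on_eq)
      show "tail_integral f (x - 1) - integral {x - 1..y} f = tail_integral f y" if "y \<in> {x - 1<..<x + 1}" for y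
        using tail_integral_diff[OF f, of "x - 1" y] that by (simp add: algebra_simps)
    qed
    then show ?thesis
      by (simp add: continuous_on_eq_continuous_at)
  qed
  then show ?thesis by (simp add: continuous_on_eq_continuous_at)
qed

text \<open>\<open>absolutely_continuous_on\<close> is stated for complex-valued functions; this
  carries real tail integrals over to it.\<close>

lemma tail_integral_of_real:
  "integrable lebesgue f \<Longrightarrow> tail_integral (\<lambda>t. complex_of_real (f t)) x = of_real (tail_integral f x)"
  unfolding tail_integral_def set_lebesgue_integral_def
  by (simp flip: of_real_mult add: scaleR_conv_of_real)

text \<open>For E = exp (l * tail_integral h) one has E' = -l h E almost everywhere, so l times the
  tail integral of h E is E minus its limit at infinity, and that limit is positive. This is the
  estimate by which an exponential weight turns a Volterra operator into a contraction.\<close>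

lemma tail_integral_exp_tail_le:
  fixes h :: "real \<Rightarrow> real"
  assumes h: "integrable lebesgue h" "\<And>t. h t \<ge> 0" and "l > 0"
  shows "integrable lebesgue (\<lambda>t. h t * exp (l * tail_integral h t))"
    and "l * tail_integral (\<lambda>t. h t * exp (l * tail_integral h t)) x \<le> exp (l * tail_integral h x)"
proof -
  define M where "M = exp (l * (LINT t|lebesgue. h t))"
  define E where "E t = exp (l * tail_integral h t)" for t
  have E: "0 < E t" "E t \<le> M" for t
    using tail_integral_le_total[OF h] \<open>l > 0\<close> by (simp_all add: E_def M_def)
  have "continuous_on UNIV E"
    unfolding E_def by (intro continuous_intros continuous_on_tail h)
  then have "E \<in> borel_measurable borel" by (rule borel_measurable_continuous_onI)
  then have Em: "E \<in> borel_measurable lebesgue" by (simp add: measurable_completion)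
  show int: "integrable lebesgue (\<lambda>t. h t * exp (l * tail_integral h t))"
  proof (rule Bochner_Integration.integrable_bound[where f = "\<lambda>t. M * h t"])
    show "integrable lebesgue (\<lambda>t. M * h t)" using h by simp
    show "(\<lambda>t. h t * exp (l * tail_integral h t)) \<in> borel_measurable lebesgue"
      using h Em by (auto simp: E_def[symmetric] intro!: borel_measurable_times)
    have "norm (h t * E t) \<le> norm (M * h t)" for t
    proof -
      have "h t * E t \<le> h t * M" using E(2)[of t] h(2)[of t] by (rule mult_left_mono)
      then show ?thesis using E[of t] h(2)[of t] by (simp add: abs_mult mult.commute)
    qed
    then show "AE t in lebesgue. norm (h t * exp (l * tail_integral h t)) \<le> norm (M * h t)"
      by (simp add: E_def)
  qed
  \<comment> \<open>The difference of l times the tail integral and E is absolutely continuous with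
    derivative 0 almost everywhere, hence constant. Its values at x and y are compared and the term
    in E y is dropped by sign; y is sent to infinity at the end.\<close>
  have key: "l * tail_integral (\<lambda>t. h t * E t) x \<le> E x + l * tail_integral (\<lambda>t. h t * E t) y" if xy: "x \<le> y" for y
  proof -
    let ?hc = "\<lambda>t. complex_of_real (h t)"
    have hc: "integrable lebesgue ?hc" using h by simp
    have hE: "integrable lebesgue (\<lambda>t. complex_of_real (h t * E t))"
      using int unfolding E_def by (simp only: complex_of_real_integrable_eq)
    define G where "G t = tail_integral (\<lambda>t. complex_of_real (h t * E t)) t * of_real l - of_real (E t)" for t
    have "absolutely_continuous_on {x..y} (\<lambda>t. complex_of_real (E t))"
    proof (rule absolutely_continuous_on_dominated[OF absolutely_continuous_on_tail[OF hc], of "l * M"])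
      show "0 \<le> l * M" using \<open>l > 0\<close> by (simp add: M_def)
      fix u v
      \<comment> \<open>On the range of the exponent, exp is Lipschitz with constant M because exp b
        - exp a \<le> exp b (b - a). This carries absolute continuity from the tail integral of h to
        E.\<close>
      have lip: "\<bar>exp p - exp q\<bar> \<le> M * \<bar>p - q\<bar>" if "exp p \<le> M" "exp q \<le> M" for p q :: real
      proof -
        have *: "exp b - exp a \<le> M * (b - a)" if "a \<le> b" "exp b \<le> M" for a b :: real
        proof -
          have "1 + (a - b) \<le> exp (a - b)" by (rule exp_ge_add_one_self)
          then have "exp b * (1 + (a - b)) \<le> exp b * exp (a - b)" by (intro mult_left_mono) auto
          then have "exp b - exp a \<le> exp b * (b - a)" by (simp add: exp_diff algebra_simps)
          also have "\<dots> \<le> M * (b - a)" using that by (intro mult_right_mono) auto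
          finally show ?thesis .
        qed
        show ?thesis using *[of p q] *[of q p] that by (cases "p \<le> q") (auto simp: abs_if)
      qed
      have "\<bar>E v - E u\<bar> \<le> M * \<bar>l * tail_integral h v - l * tail_integral h u\<bar>"
        using E unfolding E_def by (intro lip) auto
      also have "\<dots> = l * M * \<bar>tail_integral h v - tail_integral h u\<bar>"
        using \<open>l > 0\<close> by (simp add: right_diff_distrib[symmetric] abs_mult)
      finally show "norm (complex_of_real (E v) - complex_of_real (E u)) \<le> l * M * norm (tail_integral ?hc v - tail_integral ?hc u)"
        by (simp add: tail_integral_of_real[OF h(1)] flip: of_real_diff)
    qed
    then have acG: "absolutely_continuous_on {x..y} G"
      unfolding G_def
      by (intro absolutely_continuous_on_diff absolutely_continuous_on_mult absolutely_continuous_on_tail[OF hE] absolutely_continuous_on_const)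
    define N where "N = {t. \<not> (tail_integral h has_vector_derivative - h t) (at t) \<or>
       \<not> (tail_integral (\<lambda>t. complex_of_real (h t * E t)) has_vector_derivative - of_real (h t * E t)) (at t)}"
    have "AE t in lebesgue. t \<notin> N"
      using tail_integral_has_vector_derivative_AE[OF h(1)] tail_integral_has_vector_derivative_AE[OF hE]
      by eventually_elim (simp add: N_def)
    from negligible_not_AE[OF this] have "negligible N" by simp
    have "G y = G x"
    proof (rule absolutely_continuous_on_deriv_0[OF acG xy \<open>negligible N\<close>])
      fix t assume "t \<in> {x<..<y} - N"
      then have d: "(tail_integral h has_real_derivative - h t) (at t)"
          "(tail_integral (\<lambda>t. complex_of_real (h t * E t)) has_vector_derivative - of_real (h t * E t)) (at t)"
        by (auto simp: N_def has_real_derivative_iff_has_vector_derivative)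
      have "(E has_real_derivative E t * (l * - h t)) (at t)"
        unfolding E_def by (auto intro!: derivative_eq_intros d(1))
      then have dE: "((\<lambda>t. complex_of_real (E t)) has_vector_derivative of_real (E t * (l * - h t))) (at t)"
        by (intro has_vector_derivative_of_real) (simp add: has_real_derivative_iff_has_vector_derivative)
      have "(G has_vector_derivative - of_real (h t * E t) * of_real l - of_real (E t * (l * - h t))) (at t)"
        unfolding G_def
        by (intro has_vector_derivative_diff has_vector_derivative_mult_left d(2) dE)
      then show "(G has_vector_derivative 0) (at t)"
        by (rule has_vector_derivative_eq_rhs) simp
    qed
    moreover have "tail_integral (\<lambda>t. complex_of_real (h t * E t)) z = of_real (tail_integral (\<lambda>t. h t * E t) z)" for z
      using int unfolding E_def by (rule tail_integral_of_real)
    ultimately have "complex_of_real (tail_integral (\<lambda>t. h t * E t) x * l - E x) = of_real (tail_integral (\<lambda>t. h t * E t) y * l - E y)"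
      unfolding G_def by simp
    then have "l * tail_integral (\<lambda>t. h t * E t) x - E x = l * tail_integral (\<lambda>t. h t * E t) y - E y"
      by (simp only: of_real_eq_iff mult.commute)
    then show ?thesis using E(1)[of y] by simp
  qed
  have "((\<lambda>y. E x + l * tail_integral (\<lambda>t. h t * E t) y) \<longlongrightarrow> E x + l * 0) at_top"
    using int by (intro tendsto_intros tail_integral_tendsto_0) (simp add: E_def)
  moreover have "eventually (\<lambda>y. l * tail_integral (\<lambda>t. h t * E t) x \<le> E x + l * tail_integral (\<lambda>t. h t * E t) y) at_top"
    using key by (auto intro!: eventually_at_top_linorderI[of x])
  ultimately have "l * tail_integral (\<lambda>t. h t * E t) x \<le> E x + l * 0"
    by (intro tendsto_lowerbound) auto
  then show "l * tail_integral (\<lambda>t. h t * exp (l * tail_integral h t)) x \<le> exp (l * tail_integral h x)" by (simp add: E_def)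
qed

subsection \<open>Jost solutions\<close>

text \<open>Dominated convergence along sequences. The condition Re c \<le> 0 bounds the exponential
  by 1 for t \<ge> x, so g dominates uniformly in both parameters; the boundary case Re c = 0, which
  corresponds to real k, is included.\<close>

lemma continuous_on_parametric_tail_integral:
  fixes \<phi> :: "real \<Rightarrow> complex \<Rightarrow> complex" and c :: "complex \<Rightarrow> complex"
  assumes g: "integrable lebesgue g" "\<And>t \<kappa>. norm (\<phi> t \<kappa>) \<le> g t"
    and \<phi>: "\<And>t. continuous_on UNIV (\<phi> t)" "\<And>\<kappa>. (\<lambda>t. \<phi> t \<kappa>) \<in> borel_measurable lebesgue"
    and c: "continuous_on UNIV c" "\<And>\<kappa>. Re (c \<kappa>) \<le> 0"
  shows "continuous_on UNIV (\<lambda>p. tail_integral (\<lambda>t. exp (c (snd p) * of_real (t - fst p)) * \<phi> t (snd p)) (fst p))"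
  unfolding continuous_on_sequentially comp_def
proof (intro allI impI ballI, elim conjE)
  fix X :: "nat \<Rightarrow> real \<times> complex" and p assume X: "X \<longlonglongrightarrow> p"
  have f: "(\<lambda>n. fst (X n)) \<longlonglongrightarrow> fst p" and s: "(\<lambda>n. snd (X n)) \<longlonglongrightarrow> snd p"
    using X by (auto intro: tendsto_fst tendsto_snd)
  let ?F = "\<lambda>p t. indicator {fst p..} t *\<^sub>R (exp (c (snd p) * of_real (t - fst p)) * \<phi> t (snd p))"
  have meas: "?F p \<in> borel_measurable lebesgue" for p
  proof -
    have "continuous_on UNIV (\<lambda>t. exp (c (snd p) * of_real (t - fst p)))" by (intro continuous_intros)
    then have "(\<lambda>t. exp (c (snd p) * of_real (t - fst p))) \<in> borel_measurable lebesgue"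
      by (intro measurable_completion) (simp add: borel_measurable_continuous_onI)
    then show ?thesis
      using \<phi>(2) by (intro borel_measurable_scaleR borel_measurable_times borel_measurable_indicator) auto
  qed
  have "(\<lambda>n. LINT t|lebesgue. ?F (X n) t) \<longlonglongrightarrow> (LINT t|lebesgue. ?F p t)"
  proof (rule integral_dominated_convergence[OF meas meas g(1)])
    \<comment> \<open>As a function of x, the indicator of [x, \<infinity>) at t jumps only at x =
      t, so the integrands converge off a single point.\<close>
    have "AE t in lebesgue. t \<noteq> fst p"
      by (rule AE_I'[of "{fst p}"]) (auto simp flip: negligible_iff_null_sets)
    then show "AE t in lebesgue. (\<lambda>n. ?F (X n) t) \<longlonglongrightarrow> ?F p t"
    proof eventually_elim
      fix t assume t: "t \<noteq> fst p"
      have "(\<lambda>n. indicator {fst (X n)..} t :: real) \<longlonglongrightarrow> indicator {fst p..} t"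
      proof (cases "t < fst p")
        case True
        then have "eventually (\<lambda>n. t < fst (X n)) sequentially" using f by (intro order_tendstoD(1)) auto
        then show ?thesis
          using True by (intro tendsto_eventually) (auto elim!: eventually_mono)
      next
        case False
        with t have "t > fst p" by simp
        then have "eventually (\<lambda>n. t > fst (X n)) sequentially" using f by (intro order_tendstoD(2)) auto
        then show ?thesis
          using \<open>t > fst p\<close> by (intro tendsto_eventually) (auto elim!: eventually_mono)
      qed
      moreover have "(\<lambda>n. c (snd (X n))) \<longlonglongrightarrow> c (snd p)" "(\<lambda>n. \<phi> t (snd (X n))) \<longlonglongrightarrow> \<phi> t (snd p)"
        using s c(1) \<phi>(1)[of t] by (auto intro: continuous_on_tendsto_compose)
      ultimately show "(\<lambda>n. ?F (X n) t) \<longlonglongrightarrow> ?F p t"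
        using f by (intro tendsto_scaleR tendsto_mult tendsto_exp tendsto_of_real tendsto_diff tendsto_const)
    qed
    have "norm (?F p t) \<le> g t" for p t
    proof (cases "t \<ge> fst p")
      case True
      have "Re (c (snd p)) * (t - fst p) \<le> 0"
        using c(2) True by (intro mult_nonpos_nonneg) auto
      then have "norm (exp (c (snd p) * of_real (t - fst p))) \<le> 1" by (simp add: norm_exp_eq_Re)
      then have "norm (exp (c (snd p) * of_real (t - fst p))) * norm (\<phi> t (snd p)) \<le> 1 * g t"
        using g(2) by (intro mult_mono) auto
      then show ?thesis using True by (simp add: norm_mult)
    next
      case False
      then show ?thesis using order_trans[OF norm_ge_zero g(2)] by simp
    qed
    then show "AE t in lebesgue. norm (?F (X n) t) \<le> g t" for n by simp
  qed
  then show "(\<lambda>n. tail_integral (\<lambda>t. exp (c (snd (X n)) * of_real (t - fst (X n))) * \<phi> t (snd (X n))) (fst (X n)))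
      \<longlonglongrightarrow> tail_integral (\<lambda>t. exp (c (snd p) * of_real (t - fst p)) * \<phi> t (snd p)) (fst p)"
    by (simp add: tail_integral_def set_lebesgue_integral_def)
qed

lemma continuous_imp_lebesgue_measurable:
  fixes f :: "real \<Rightarrow> 'b::{second_countable_topology, topological_space}"
  shows "continuous_on UNIV f \<Longrightarrow> f \<in> borel_measurable lebesgue"
  by (intro measurable_completion) (simp add: borel_measurable_continuous_onI)

text \<open>Here s stands for \<sigma> and w for \<tau> - \<sigma>^2, both cut off to 0 on the
  negative axis so that solutions are defined and continuous across x = 0. The number d is a lower
  bound for Re k and keeps 1 / k bounded.\<close>

locale short_range =
  fixes s w :: "real \<Rightarrow> real" and d :: real
  assumes s: "integrable lebesgue s" and w: "integrable lebesgue w" and d: "d > 0"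
    and s_0: "\<And>t. t \<le> 0 \<Longrightarrow> s t = 0" and w_0: "\<And>t. t \<le> 0 \<Longrightarrow> w t = 0"
begin

text \<open>Up to a factor 2 this dominates both perturbation terms \<open>rQ\<close> and
  \<open>rP\<close>, uniformly for Re k \<ge> d, because the modulus of 1 / (2ik) is at most 1 /
  (2d).\<close>

definition h :: "real \<Rightarrow> real" where "h t = \<bar>s t\<bar> + \<bar>w t\<bar> / (2 * d)"

text \<open>
  The map \<open>kk\<close> is a retraction onto the region $\Re k \ge d$, $\Im k \ge 0$; it makes all functions of
  the spectral parameter total.
\<close>

definition kk :: "complex \<Rightarrow> complex" where "kk \<kappa> = Complex (max d (Re \<kappa>)) (max 0 (Im \<kappa>))"

text \<open>
  With $Q = e^{-ikx}(v + iku)$ and $P = e^{-ikx}(v - iku)$, the system $u' = su + v$,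
  $v' = -sv + (w - k^2)u$ becomes $Q' = r_Q(Q, P)$, $P' = -2ikP + r_P(Q, P)$.
\<close>

definition rQ :: "complex \<Rightarrow> real \<Rightarrow> complex \<Rightarrow> complex \<Rightarrow> complex" where
  "rQ k t a b = of_real (w t) / (2 * \<i> * k) * (a - b) - of_real (s t) * b"

definition rP :: "complex \<Rightarrow> real \<Rightarrow> complex \<Rightarrow> complex \<Rightarrow> complex" where
  "rP k t a b = of_real (w t) / (2 * \<i> * k) * (a - b) - of_real (s t) * a"

text \<open>The constant 8 is dictated by the contraction. The kernels are bounded by 2 h, and 8
  times the tail integral of h E is at most E, so each of the two components costs at most E / 4.
  After division by E the pair has Lipschitz constant 1 / 2.\<close>

definition E :: "real \<Rightarrow> real" where "E t = exp (8 * tail_integral h t)"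

lemma h: "integrable lebesgue h" "h t \<ge> 0"
  using s w d by (auto simp: h_def[abs_def])

lemma h_E: "integrable lebesgue (\<lambda>t. h t * E t)" "8 * tail_integral (\<lambda>t. h t * E t) x \<le> E x"
  using tail_integral_exp_tail_le[OF h, of 8] by (simp_all add: E_def)

lemma E_ge_1: "E t \<ge> 1"
  using tail_integral_nonneg[of h t] h(2) by (simp add: E_def)

lemma E_bounded: "E t \<le> exp (8 * (LINT t|lebesgue. h t))"
  using tail_integral_le_total[OF h] by (simp add: E_def)

lemma continuous_on_E: "continuous_on UNIV E"
  unfolding E_def by (intro continuous_intros continuous_on_tail h)

lemma Re_kk: "Re (kk \<kappa>) \<ge> d" and Im_kk: "Im (kk \<kappa>) \<ge> 0"
  by (simp_all add: kk_def)

lemma kk_id: "Re k \<ge> d \<Longrightarrow> Im k \<ge> 0 \<Longrightarrow> kk k = k"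
  by (simp add: kk_def complex_eq_iff)

lemma kk_nz: "kk \<kappa> \<noteq> 0"
  using Re_kk[of \<kappa>] d by (auto simp: complex_eq_iff)

lemma continuous_on_kk: "continuous_on A kk"
  unfolding kk_def Complex_eq by (intro continuous_intros)

lemma rQ_diff: "rQ k t a b - rQ k t a' b' = rQ k t (a - a') (b - b')"
  and rP_diff: "rP k t a b - rP k t a' b' = rP k t (a - a') (b - b')"
  by (simp_all add: rQ_def rP_def algebra_simps add_divide_distrib diff_divide_distrib)

lemma rQ_scaleR: "rQ k t (c *\<^sub>R a) (c *\<^sub>R b) = c *\<^sub>R rQ k t a b"
  and rP_scaleR: "rP k t (c *\<^sub>R a) (c *\<^sub>R b) = c *\<^sub>R rP k t a b"
  by (simp_all add: rQ_def rP_def scaleR_conv_of_real algebra_simps)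

lemma
  assumes "Re k \<ge> d"
  shows norm_rQ: "norm (rQ k t a b) \<le> 2 * h t * norm (a, b)"
    and norm_rP: "norm (rP k t a b) \<le> 2 * h t * norm (a, b)"
proof -
  let ?N = "norm (a, b)"
  have a: "norm a \<le> ?N" and b: "norm b \<le> ?N" using norm_fst_le norm_snd_le by blast+
  have "d \<le> norm k" using assms complex_Re_le_cmod[of k] by linarith
  then have 1: "\<bar>w t\<bar> / (2 * norm k) \<le> \<bar>w t\<bar> / (2 * d)" using d by (intro divide_left_mono) (auto intro!: mult_pos_pos)
  have "norm (a - b) \<le> 2 * ?N" using norm_triangle_ineq4[of a b] a b by linarith
  then have 2: "norm (of_real (w t) / (2 * \<i> * k) * (a - b)) \<le> \<bar>w t\<bar> / (2 * d) * (2 * ?N)"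
    unfolding norm_mult norm_divide using 1 d by (intro mult_mono) (auto simp: norm_mult)
  \<comment> \<open>The factor 2 is wasteful; it matches the one arising from a - b, so that both
    terms combine into 2 h.\<close>
  have 3: "norm (of_real (s t) * c) \<le> 2 * \<bar>s t\<bar> * ?N" if "norm c \<le> ?N" for c :: complex
  proof -
    have "norm (of_real (s t) * c) \<le> \<bar>s t\<bar> * ?N"
      unfolding norm_mult using that by (auto intro: mult_left_mono)
    also have "\<dots> \<le> 2 * (\<bar>s t\<bar> * ?N)" by simp
    finally show ?thesis by simp
  qed
  show "norm (rQ k t a b) \<le> 2 * h t * ?N"
    unfolding rQ_def h_def using 2 3[OF b]
    by (intro order_trans[OF norm_triangle_ineq4]) (simp add: algebra_simps)
  show "norm (rP k t a b) \<le> 2 * h t * ?N"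
    unfolding rP_def h_def using 2 3[OF a]
    by (intro order_trans[OF norm_triangle_ineq4]) (simp add: algebra_simps)
qed

lemma
  assumes "\<And>t. continuous_on UNIV (f t)" "\<And>t. continuous_on UNIV (g t)"
  shows continuous_on_rQ: "continuous_on UNIV (\<lambda>\<kappa>. rQ (kk \<kappa>) t (f t \<kappa>) (g t \<kappa>))"
    and continuous_on_rP: "continuous_on UNIV (\<lambda>\<kappa>. rP (kk \<kappa>) t (f t \<kappa>) (g t \<kappa>))"
  unfolding rQ_def rP_def by (intro continuous_intros continuous_on_kk assms; simp add: kk_nz)+

lemma
  assumes f: "continuous_on UNIV f" and g: "continuous_on UNIV g"
  shows measurable_rQ: "(\<lambda>t. rQ k t (f t) (g t)) \<in> borel_measurable lebesgue"
    and measurable_rP: "(\<lambda>t. rP k t (f t) (g t)) \<in> borel_measurable lebesgue"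
proof -
  have [measurable]: "f \<in> borel_measurable lebesgue" "g \<in> borel_measurable lebesgue"
    using f g by (auto intro: continuous_imp_lebesgue_measurable)
  have [measurable]: "s \<in> borel_measurable lebesgue" "w \<in> borel_measurable lebesgue"
    using s w by auto
  show "(\<lambda>t. rQ k t (f t) (g t)) \<in> borel_measurable lebesgue"
    "(\<lambda>t. rP k t (f t) (g t)) \<in> borel_measurable lebesgue"
    unfolding rQ_def rP_def by measurable
qed

text \<open>
  The trivial exponential in \<open>iQ\<close> is kept so that both integrals have the shape of
  \<open>continuous_on_parametric_tail_integral\<close>.
\<close>

definition iQ :: "(real \<times> complex \<Rightarrow> complex \<times> complex) \<Rightarrow> real \<times> complex \<Rightarrow> complex" where
  "iQ G p = tail_integral (\<lambda>t. exp (0 * of_real (t - fst p)) *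
      (E t *\<^sub>R rQ (kk (snd p)) t (fst (G (t, snd p))) (snd (G (t, snd p))))) (fst p)"

definition iP :: "(real \<times> complex \<Rightarrow> complex \<times> complex) \<Rightarrow> real \<times> complex \<Rightarrow> complex" where
  "iP G p = tail_integral (\<lambda>t. exp (2 * \<i> * kk (snd p) * of_real (t - fst p)) *
      (E t *\<^sub>R rP (kk (snd p)) t (fst (G (t, snd p))) (snd (G (t, snd p))))) (fst p)"

section \<open>Bounds and continuity of the two integral operators\<close>

context
  fixes G :: "real \<times> complex \<Rightarrow> complex \<times> complex" and B :: real
  assumes G: "continuous_on UNIV G" "\<And>p. norm (G p) \<le> B"
begin

lemma G_cont:
  "continuous_on UNIV (\<lambda>t. fst (G (t, \<kappa>)))" "continuous_on UNIV (\<lambda>t. snd (G (t, \<kappa>)))"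
  "continuous_on UNIV (\<lambda>\<kappa>. fst (G (t, \<kappa>)))" "continuous_on UNIV (\<lambda>\<kappa>. snd (G (t, \<kappa>)))"
  by (intro continuous_intros continuous_on_compose2[OF G(1)]; simp)+

lemma kernel_bound:
  "norm (E t *\<^sub>R rQ (kk \<kappa>) t (fst (G (t, \<kappa>))) (snd (G (t, \<kappa>)))) \<le> 2 * B * (h t * E t)"
  "norm (E t *\<^sub>R rP (kk \<kappa>) t (fst (G (t, \<kappa>))) (snd (G (t, \<kappa>)))) \<le> 2 * B * (h t * E t)"
proof -
  have *: "norm (E t *\<^sub>R z) \<le> 2 * B * (h t * E t)" if "norm z \<le> 2 * h t * norm (G (t, \<kappa>))" for z :: complex
  proof -
    have "norm (E t *\<^sub>R z) \<le> E t * (2 * h t * norm (G (t, \<kappa>)))"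
      using that E_ge_1[of t] by (auto intro: mult_left_mono)
    also have "\<dots> \<le> E t * (2 * h t * B)"
      using G(2) E_ge_1[of t] h(2)[of t] by (intro mult_left_mono) auto
    finally show ?thesis by (simp add: algebra_simps)
  qed
  show "norm (E t *\<^sub>R rQ (kk \<kappa>) t (fst (G (t, \<kappa>))) (snd (G (t, \<kappa>)))) \<le> 2 * B * (h t * E t)"
    "norm (E t *\<^sub>R rP (kk \<kappa>) t (fst (G (t, \<kappa>))) (snd (G (t, \<kappa>)))) \<le> 2 * B * (h t * E t)"
    using norm_rQ[OF Re_kk, of \<kappa> t "fst (G (t, \<kappa>))" "snd (G (t, \<kappa>))"]
      norm_rP[OF Re_kk, of \<kappa> t "fst (G (t, \<kappa>))" "snd (G (t, \<kappa>))"]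
    by (intro *; simp)+
qed

lemma kernel_measurable:
  "(\<lambda>t. E t *\<^sub>R rQ (kk \<kappa>) t (fst (G (t, \<kappa>))) (snd (G (t, \<kappa>)))) \<in> borel_measurable lebesgue"
  "(\<lambda>t. E t *\<^sub>R rP (kk \<kappa>) t (fst (G (t, \<kappa>))) (snd (G (t, \<kappa>)))) \<in> borel_measurable lebesgue"
  by (intro borel_measurable_scaleR measurable_rQ measurable_rP G_cont
      continuous_imp_lebesgue_measurable[OF continuous_on_E])+

lemma bound_integrable: "integrable lebesgue (\<lambda>t. 2 * B * (h t * E t))"
  using h_E(1) by simp

lemma continuous_on_iQ: "continuous_on UNIV (iQ G)"
  unfolding iQ_def
  by (rule continuous_on_parametric_tail_integral[OF bound_integrable kernel_bound(1) _ kernel_measurable(1)])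
    (intro continuous_intros continuous_on_rQ G_cont | simp)+

lemma continuous_on_iP: "continuous_on UNIV (iP G)"
  unfolding iP_def
  by (rule continuous_on_parametric_tail_integral[OF bound_integrable kernel_bound(2) _ kernel_measurable(2)])
    (intro continuous_intros continuous_on_rP continuous_on_kk G_cont | simp add: Im_kk)+

lemma exp_kk_le_1: "t \<ge> x \<Longrightarrow> norm (exp (2 * \<i> * kk \<kappa> * of_real (t - x))) \<le> 1"
  using Im_kk[of \<kappa>] by (simp add: norm_exp_eq_Re)

lemma iP_kernel_bound:
  assumes "t \<ge> x"
  shows "norm (exp (2 * \<i> * kk \<kappa> * of_real (t - x)) *
    (E t *\<^sub>R rP (kk \<kappa>) t (fst (G (t, \<kappa>))) (snd (G (t, \<kappa>))))) \<le> 2 * B * (h t * E t)"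
  using mult_mono[OF exp_kk_le_1[OF assms, of \<kappa>] kernel_bound(2)[of t \<kappa>]] by (simp add: norm_mult mult.left_commute)

lemma iP_kernel_measurable:
  "(\<lambda>t. exp (2 * \<i> * kk \<kappa> * of_real (t - x)) *
    (E t *\<^sub>R rP (kk \<kappa>) t (fst (G (t, \<kappa>))) (snd (G (t, \<kappa>))))) \<in> borel_measurable lebesgue"
  by (intro borel_measurable_times kernel_measurable continuous_imp_lebesgue_measurable continuous_intros)

lemma iQ_iP_integrable:
  "set_integrable lebesgue {x..} (\<lambda>t. E t *\<^sub>R rQ (kk \<kappa>) t (fst (G (t, \<kappa>))) (snd (G (t, \<kappa>))))"
  "set_integrable lebesgue {x..} (\<lambda>t. exp (2 * \<i> * kk \<kappa> * of_real (t - x)) *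
    (E t *\<^sub>R rP (kk \<kappa>) t (fst (G (t, \<kappa>))) (snd (G (t, \<kappa>)))))"
  by (rule set_integrable_tail_bound[OF _ bound_integrable]; intro kernel_measurable iP_kernel_measurable kernel_bound iP_kernel_bound)+

lemma norm_iQ_iP: "4 * norm (iQ G p) \<le> B * E (fst p)" "4 * norm (iP G p) \<le> B * E (fst p)"
proof -
  have B: "B \<ge> 0" using G(2) norm_ge_zero order_trans by blast
  have *: "4 * z \<le> B * E (fst p)" if "z \<le> tail_integral (\<lambda>t. 2 * B * (h t * E t)) (fst p)" for z
  proof -
    have "tail_integral (\<lambda>t. 2 * B * (h t * E t)) (fst p) = 2 * B * tail_integral (\<lambda>t. h t * E t) (fst p)"
      unfolding tail_integral_def by (simp add: set_integral_mult_right)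
    with that have "4 * z \<le> B * (8 * tail_integral (\<lambda>t. h t * E t) (fst p))" by simp
    also have "\<dots> \<le> B * E (fst p)" using B h_E(2) by (intro mult_left_mono)
    finally show ?thesis .
  qed
  show "4 * norm (iQ G p) \<le> B * E (fst p)"
    unfolding iQ_def using kernel_measurable(1) kernel_bound(1)
    by (intro * tail_integral_norm_le bound_integrable) auto
  show "4 * norm (iP G p) \<le> B * E (fst p)"
    unfolding iP_def
    by (intro * tail_integral_norm_le bound_integrable iP_kernel_measurable iP_kernel_bound)
qed

end

lemma iQ_iP_diff:
  assumes "continuous_on UNIV G" "\<And>p. norm (G p) \<le> B" "continuous_on UNIV G'" "\<And>p. norm (G' p) \<le> B'"
  shows "iQ G p - iQ G' p = iQ (\<lambda>p. G p - G' p) p" "iP G p - iP G' p = iP (\<lambda>p. G p - G' p) p"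
  using iQ_iP_integrable[OF assms(1,2), of "fst p" "snd p"] iQ_iP_integrable[OF assms(3,4), of "fst p" "snd p"]
  by (simp_all add: iQ_def iP_def tail_integral_def set_integral_diff(2)[symmetric]
      right_diff_distrib[symmetric] scaleR_diff_right[symmetric] rQ_diff rP_diff)

text \<open>The unknown is G = (Q, P) / E, so that the plain sup norm of G is the weighted norm of
  (Q, P). The constant 1 encodes the normalisation at infinity, where Q tends to 1 and P to
  0.\<close>

definition Phi :: "(real \<times> complex \<Rightarrow> complex \<times> complex) \<Rightarrow> real \<times> complex \<Rightarrow> complex \<times> complex" where
  "Phi G p = (1 / E (fst p)) *\<^sub>R (1 - iQ G p, - iP G p)"

lemma continuous_on_Phi:
  assumes "continuous_on UNIV G" "\<And>p. norm (G p) \<le> B"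
  shows "continuous_on UNIV (Phi G)"
proof -
  have "E t \<noteq> 0" for t using E_ge_1[of t] by simp
  then show ?thesis
    unfolding Phi_def
    by (intro continuous_intros continuous_on_iQ[OF assms] continuous_on_iP[OF assms]
        continuous_on_compose2[OF continuous_on_E]) auto
qed

text \<open>The map is affine in G, so the difference is its linear part applied to G - G'. Each
  component is at most D E / 4, the pair at most D E / 2, and the prefactor removes E.\<close>

lemma norm_Phi_diff:
  assumes "continuous_on UNIV G" "\<And>p. norm (G p) \<le> B" "continuous_on UNIV G'" "\<And>p. norm (G' p) \<le> B'"
    and D: "\<And>p. norm (G p - G' p) \<le> D"
  shows "norm (Phi G p - Phi G' p) \<le> D / 2"
proof -
  have E: "E (fst p) > 0" using E_ge_1[of "fst p"] by simp
  have c: "continuous_on UNIV (\<lambda>p. G p - G' p)" using assms by (intro continuous_intros)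
  have "Phi G p - Phi G' p = (1 / E (fst p)) *\<^sub>R (- (iQ G p - iQ G' p), - (iP G p - iP G' p))"
    by (simp add: Phi_def scaleR_diff_right[symmetric])
  also have "\<dots> = (1 / E (fst p)) *\<^sub>R (- iQ (\<lambda>p. G p - G' p) p, - iP (\<lambda>p. G p - G' p) p)"
    by (simp only: iQ_iP_diff[OF assms(1-4)])
  also have "norm \<dots> \<le> (1 / E (fst p)) * (norm (iQ (\<lambda>p. G p - G' p) p) + norm (iP (\<lambda>p. G p - G' p) p))"
    using E norm_Pair_le[of "- iQ (\<lambda>p. G p - G' p) p" "- iP (\<lambda>p. G p - G' p) p"]
    unfolding norm_scaleR by (intro mult_mono) auto
  also have "\<dots> \<le> (1 / E (fst p)) * (D * E (fst p) / 2)"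
    using norm_iQ_iP[OF c D, of p] E by (intro mult_left_mono) auto
  also have "\<dots> = D / 2" using E by simp
  finally show ?thesis .
qed

lemma norm_Phi:
  assumes "continuous_on UNIV G" "\<And>p. norm (G p) \<le> B"
  shows "norm (Phi G p) \<le> 1 + B / 2"
proof -
  have E: "E (fst p) \<ge> 1" by (rule E_ge_1)
  have "iQ (\<lambda>_. 0) p = 0" "iP (\<lambda>_. 0) p = 0"
    by (simp_all add: iQ_def iP_def rQ_def rP_def tail_integral_def)
  then have "norm (Phi (\<lambda>_. 0) p) \<le> 1" using E by (simp add: Phi_def norm_Pair)
  moreover have "norm (Phi G p - Phi (\<lambda>_. 0) p) \<le> B / 2"
    by (rule norm_Phi_diff[OF assms, of _ 0]) (use assms in auto)
  ultimately show ?thesis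
    using norm_triangle_sub[of "Phi G p" "Phi (\<lambda>_. 0) p"] by linarith
qed

lemma Phi_fixed_point: "\<exists>G :: (real \<times> complex) \<Rightarrow>\<^sub>C (complex \<times> complex). \<forall>p. Phi (apply_bcontfun G) p = apply_bcontfun G p"
proof -
  have in_b: "Phi (apply_bcontfun G) \<in> bcontfun" for G :: "(real \<times> complex) \<Rightarrow>\<^sub>C (complex \<times> complex)"
    by (intro bcontfun_normI[of _ "1 + norm G / 2"] norm_Phi continuous_on_Phi[OF _ norm_bounded]
        continuous_on_apply_bcontfun norm_bounded)
  define \<Psi> where "\<Psi> G = Bcontfun (Phi (apply_bcontfun G))" for G :: "(real \<times> complex) \<Rightarrow>\<^sub>C (complex \<times> complex)"
  have \<Psi>: "apply_bcontfun (\<Psi> G) = Phi (apply_bcontfun G)" for G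
    unfolding \<Psi>_def using in_b by (rule Bcontfun_inverse)
  have "\<exists>!G. \<Psi> G = G"
  proof (rule banach_fix_type[of "1/2"])
    show "\<forall>G G'. dist (\<Psi> G) (\<Psi> G') \<le> 1 / 2 * dist G G'"
    proof (intro allI dist_bound)
      fix G G' :: "(real \<times> complex) \<Rightarrow>\<^sub>C (complex \<times> complex)" and p
      have "norm (Phi (apply_bcontfun G) p - Phi (apply_bcontfun G') p) \<le> dist G G' / 2"
        by (intro norm_Phi_diff[of _ "norm G" _ "norm G'"] continuous_on_apply_bcontfun norm_bounded)
          (simp flip: dist_norm add: dist_bounded)
      then show "dist (apply_bcontfun (\<Psi> G) p) (apply_bcontfun (\<Psi> G') p) \<le> 1 / 2 * dist G G'"
        by (simp add: \<Psi> dist_norm)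
    qed
  qed auto
  then obtain G where "\<Psi> G = G" by blast
  then show ?thesis by (metis \<Psi>)
qed

text \<open>Multiplying the fixed point by E undoes the weight. As E is bounded, so are the
  solutions, uniformly in x and \<kappa>; this later yields a decay constant that does not depend on
  k.\<close>

lemma jost_solution_exists:
  "\<exists>Q P C. continuous_on UNIV (\<lambda>p. Q (fst p) (snd p)) \<and> continuous_on UNIV (\<lambda>p. P (fst p) (snd p)) \<and>
    (\<forall>x \<kappa>. norm (Q x \<kappa>, P x \<kappa>) \<le> C \<and>
      Q x \<kappa> = 1 - tail_integral (\<lambda>t. rQ (kk \<kappa>) t (Q t \<kappa>) (P t \<kappa>)) x \<and>
      P x \<kappa> = - tail_integral (\<lambda>t. exp (2 * \<i> * kk \<kappa> * of_real (t - x)) * rP (kk \<kappa>) t (Q t \<kappa>) (P t \<kappa>)) x)"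
proof -
  obtain G :: "(real \<times> complex) \<Rightarrow>\<^sub>C (complex \<times> complex)" where G: "\<And>p. Phi (apply_bcontfun G) p = apply_bcontfun G p"
    using Phi_fixed_point by blast
  define Q where "Q x \<kappa> = E x *\<^sub>R fst (apply_bcontfun G (x, \<kappa>))" for x \<kappa>
  define P where "P x \<kappa> = E x *\<^sub>R snd (apply_bcontfun G (x, \<kappa>))" for x \<kappa>
  have EG: "E x *\<^sub>R apply_bcontfun G (x, \<kappa>) = (1 - iQ G (x, \<kappa>), - iP G (x, \<kappa>))" for x \<kappa>
  proof -
    have "apply_bcontfun G (x, \<kappa>) = (1 / E x) *\<^sub>R (1 - iQ G (x, \<kappa>), - iP G (x, \<kappa>))"
      by (rule G[of "(x, \<kappa>)", unfolded Phi_def fst_conv, symmetric])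
    then have "E x *\<^sub>R apply_bcontfun G (x, \<kappa>) = (E x * (1 / E x)) *\<^sub>R (1 - iQ G (x, \<kappa>), - iP G (x, \<kappa>))"
      by (simp only: scaleR_scaleR)
    then show ?thesis using E_ge_1[of x] by simp
  qed
  have eq: "Q x \<kappa> = 1 - iQ G (x, \<kappa>)" "P x \<kappa> = - iP G (x, \<kappa>)" for x \<kappa>
    unfolding Q_def P_def fst_scaleR[symmetric] snd_scaleR[symmetric] EG by simp_all
  have "norm (Q x \<kappa>, P x \<kappa>) \<le> exp (8 * (LINT t|lebesgue. h t)) * norm G" for x \<kappa>
  proof -
    have "(Q x \<kappa>, P x \<kappa>) = E x *\<^sub>R apply_bcontfun G (x, \<kappa>)" by (simp add: Q_def P_def prod_eq_iff)
    also have "norm \<dots> \<le> exp (8 * (LINT t|lebesgue. h t)) * norm G"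
      using E_bounded[of x] E_ge_1[of x] norm_bounded[of G "(x, \<kappa>)"] by (auto intro: mult_mono)
    finally show ?thesis .
  qed
  moreover have "continuous_on UNIV (\<lambda>p. Q (fst p) (snd p))" "continuous_on UNIV (\<lambda>p. P (fst p) (snd p))"
    unfolding Q_def P_def
    by (intro continuous_intros continuous_on_compose2[OF continuous_on_E]; simp)+
  moreover have "Q x \<kappa> = 1 - tail_integral (\<lambda>t. rQ (kk \<kappa>) t (Q t \<kappa>) (P t \<kappa>)) x" for x \<kappa>
    unfolding eq(1)[of x \<kappa>] iQ_def by (simp add: Q_def P_def rQ_scaleR)
  moreover have "P x \<kappa> = - tail_integral (\<lambda>t. exp (2 * \<i> * kk \<kappa> * of_real (t - x)) * rP (kk \<kappa>) t (Q t \<kappa>) (P t \<kappa>)) x" for x \<kappa>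
    unfolding eq(2)[of x \<kappa>] iP_def by (simp add: Q_def P_def rP_scaleR)
  ultimately show ?thesis by blast
qed

end

section \<open>From the integral equations to solutions of the first-order system\<close>

lemma absolutely_continuous_on_exp_mult:
  "absolutely_continuous_on {a..b} (\<lambda>x. exp (c * of_real x))"
proof -
  define M where "M = exp (norm c * (\<bar>a\<bar> + \<bar>b\<bar>)) * norm c"
  have M: "norm (exp (c * of_real x) * c) \<le> M" if "x \<in> {a..b}" for x
  proof -
    have "Re (c * of_real x) \<le> norm (c * of_real x)" by (rule complex_Re_le_cmod)
    also have "\<dots> \<le> norm c * (\<bar>a\<bar> + \<bar>b\<bar>)"
      unfolding norm_mult using that by (intro mult_left_mono) auto
    finally show ?thesis by (simp add: norm_mult norm_exp_eq_Re M_def mult_right_mono)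
  qed
  show ?thesis
  proof (rule absolutely_continuous_on_lipschitz)
    show "0 \<le> M" by (simp add: M_def)
    fix x y assume "{x..y} \<subseteq> {a..b}" "x \<le> y"
    then have xy: "x \<in> {a..b}" "y \<in> {a..b}" by auto
    have "norm (exp (c * of_real y) - exp (c * of_real x)) \<le> M * norm (y - x)"
    proof (rule differentiable_bound[OF convex_real_interval(5)])
      show "((\<lambda>x. exp (c * of_real x)) has_derivative (\<lambda>t. t *\<^sub>R (exp (c * of_real x) * c))) (at x within {a..b})" for x
        unfolding has_vector_derivative_def[symmetric]
        by (rule has_vector_derivative_at_within, rule has_vector_derivative_real_field)
          (auto intro!: derivative_eq_intros)
      show "onorm (\<lambda>t. t *\<^sub>R (exp (c * of_real x) * c)) \<le> M" if "x \<in> {a..b}" for x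
      proof (rule onorm_bound)
        show "norm (t *\<^sub>R (exp (c * of_real x) * c)) \<le> M * norm t" for t :: real
          unfolding norm_scaleR real_norm_def
          by (subst mult.commute) (rule mult_right_mono[OF M[OF that]], simp)
      qed (simp add: M_def)
    qed (use xy in auto)
    then show "norm (exp (c * of_real y) - exp (c * of_real x)) \<le> M * (y - x)" using \<open>x \<le> y\<close> by simp
  qed
qed

lemma exp_mult_has_vector_derivative:
  fixes c :: complex
  shows "((\<lambda>x. exp (c * of_real x)) has_vector_derivative exp (c * of_real x) * c) (at x)"
  by (rule has_vector_derivative_real_field) (auto intro!: derivative_eq_intros)

text \<open>The equation \<ell>u = zu for the pair (u, v), with v the quasi-derivative and w =
  \<tau> - \<sigma>^2. Keeping v as an explicit function avoids the choice hidden in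
  \<open>quasi_deriv\<close>.\<close>

definition solves_system ::
  "(real \<Rightarrow> real) \<Rightarrow> (real \<Rightarrow> real) \<Rightarrow> complex \<Rightarrow> (real \<Rightarrow> complex) \<Rightarrow> (real \<Rightarrow> complex) \<Rightarrow> bool" where
  "solves_system s w z u v \<longleftrightarrow> u \<in> AC_loc \<and> v \<in> AC_loc \<and>
     (AE x in lebesgue_on {0<..}.
        (u has_vector_derivative of_real (s x) * u x + v x) (at x) \<and>
        (v has_vector_derivative - of_real (s x) * v x + (of_real (w x) - z) * u x) (at x))"

context short_range
begin

context
  fixes k :: complex and Q P :: "real \<Rightarrow> complex" and C :: real
  assumes k: "d \<le> Re k" "0 \<le> Im k"
    and cont: "continuous_on UNIV Q" "continuous_on UNIV P"
    and bound: "\<And>x. norm (Q x, P x) \<le> C"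
    and Q: "\<And>x. Q x = 1 - tail_integral (\<lambda>t. rQ k t (Q t) (P t)) x"
    and P: "\<And>x. P x = - tail_integral (\<lambda>t. exp (2 * \<i> * k * of_real (t - x)) * rP k t (Q t) (P t)) x"
begin

private definition "fQ t = rQ k t (Q t) (P t)"
text \<open>The factor e^{-2ikx} is taken out of the integrand of P. What remains does not depend on
  x, so its tail integral can be differentiated.\<close>

private definition "fP t = exp (2 * \<i> * k * of_real t) * rP k t (Q t) (P t)"
private definition "u x = exp (\<i> * k * of_real x) * (Q x - P x) / (2 * \<i> * k)"
private definition "v x = exp (\<i> * k * of_real x) * (Q x + P x) / 2"

private lemma k_nz: "k \<noteq> 0"
  using k d by auto

private lemma bounds: "norm (fQ t) \<le> 2 * C * h t" "norm (fP t) \<le> 2 * C * h t"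
proof -
  have *: "2 * h t * norm (Q t, P t) \<le> 2 * C * h t"
    using mult_left_mono[OF bound[of t], of "2 * h t"] h(2)[of t] by (simp add: mult_ac)
  show "norm (fQ t) \<le> 2 * C * h t"
    unfolding fQ_def using norm_rQ[OF k(1), of t "Q t" "P t"] * by linarith
  show "norm (fP t) \<le> 2 * C * h t"
  proof (cases "t \<le> 0")
    \<comment> \<open>For negative t the exponential may be large; there the cut-off of the
      coefficients makes the kernel vanish.\<close>
    case True
    then have "fP t = 0" by (simp add: fP_def rP_def s_0 w_0)
    then show ?thesis using * h(2)[of t] order_trans[OF norm_ge_zero bound[of t]] by simp
  next
    case False
    then have "norm (exp (2 * \<i> * k * of_real t)) \<le> 1" using k by (simp add: norm_exp_eq_Re)
    then have "norm (fP t) \<le> 1 * norm (rP k t (Q t) (P t))"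
      unfolding fP_def norm_mult by (rule mult_right_mono) simp
    then show ?thesis using norm_rP[OF k(1), of t "Q t" "P t"] * by linarith
  qed
qed

private lemma integrable: "integrable lebesgue fQ" "integrable lebesgue fP"
proof -
  have int: "integrable lebesgue (\<lambda>t. 2 * C * h t)" using h(1) by simp
  have m: "fQ \<in> borel_measurable lebesgue" "fP \<in> borel_measurable lebesgue"
    unfolding fQ_def[abs_def] fP_def[abs_def]
    by (intro borel_measurable_times measurable_rQ measurable_rP cont
        continuous_imp_lebesgue_measurable continuous_intros)+
  show "integrable lebesgue fQ" "integrable lebesgue fP"
    by (rule Bochner_Integration.integrable_bound[OF int];
        use m bounds in \<open>auto intro: order_trans[OF _ abs_ge_self]\<close>)+
qed

private lemma Q_eq: "Q x = 1 - tail_integral fQ x"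
  unfolding fQ_def[abs_def] by (rule Q)

private lemma P_eq: "P x = - (exp (- (2 * \<i> * k) * of_real x) * tail_integral fP x)"
proof -
  have "exp (2 * \<i> * k * of_real (t - x)) * rP k t (Q t) (P t) = exp (- (2 * \<i> * k) * of_real x) * fP t" for t
    by (simp add: fP_def ring_distribs exp_add[symmetric] flip: mult.assoc)
  then have "P x = - tail_integral (\<lambda>t. exp (- (2 * \<i> * k) * of_real x) * fP t) x"
    by (subst P) simp
  then show ?thesis unfolding tail_integral_def by (simp only: set_integral_mult_right)
qed

text \<open>Estimated from the original integral, whose factor e^{2ik(t - x)} has modulus at most 1.
  In \<open>P_eq\<close> the prefactor e^{-2ikx} grows with x when Im k > 0, so decay at infinity
  cannot be read off there.\<close>

private lemma P_le: "norm (P x) \<le> 2 * C * tail_integral h x"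
proof -
  have "norm (P x) \<le> tail_integral (\<lambda>t. 2 * C * h t) x"
  proof (subst P, subst norm_minus_cancel, rule tail_integral_norm_le)
    show "(\<lambda>t. exp (2 * \<i> * k * of_real (t - x)) * rP k t (Q t) (P t)) \<in> borel_measurable lebesgue"
      by (intro borel_measurable_times measurable_rP cont
        continuous_imp_lebesgue_measurable continuous_intros)
    show "integrable lebesgue (\<lambda>t. 2 * C * h t)" using h(1) by simp
    fix t assume "t \<ge> x"
    then have "norm (exp (2 * \<i> * k * of_real (t - x))) \<le> 1" using k by (simp add: norm_exp_eq_Re)
    then have "norm (exp (2 * \<i> * k * of_real (t - x)) * rP k t (Q t) (P t)) \<le> 1 * norm (rP k t (Q t) (P t))"
      unfolding norm_mult by (rule mult_right_mono) simp
    also have "\<dots> \<le> 2 * h t * norm (Q t, P t)" using norm_rP[OF k(1)] by simp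
    also have "\<dots> \<le> 2 * h t * C" using bound[of t] h(2)[of t] by (intro mult_left_mono) auto
    finally show "norm (exp (2 * \<i> * k * of_real (t - x)) * rP k t (Q t) (P t)) \<le> 2 * C * h t"
      by (simp add: mult_ac)
  qed
  also have "\<dots> = 2 * C * tail_integral h x" unfolding tail_integral_def by (simp only: set_integral_mult_right)
  finally show ?thesis .
qed

private lemma limits: "(Q \<longlongrightarrow> 1) at_top" "(P \<longlongrightarrow> 0) at_top"
proof -
  have "((\<lambda>x. 1 - tail_integral fQ x) \<longlongrightarrow> 1 - 0) at_top"
    by (intro tendsto_intros tail_integral_tendsto_0 integrable)
  then show "(Q \<longlongrightarrow> 1) at_top" by (simp flip: Q_eq)
  have "((\<lambda>x. 2 * C * tail_integral h x) \<longlongrightarrow> 2 * C * 0) at_top"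
    by (intro tendsto_intros tail_integral_tendsto_0 h)
  then show "(P \<longlongrightarrow> 0) at_top"
    by (intro Lim_null_comparison[of P "\<lambda>x. 2 * C * tail_integral h x"]) (auto intro: P_le always_eventually)
qed

private lemma ac_QP: "absolutely_continuous_on {a..b} Q" "absolutely_continuous_on {a..b} P"
proof -
  have "absolutely_continuous_on {a..b} (\<lambda>x. 1 - tail_integral fQ x)"
    by (intro absolutely_continuous_on_diff absolutely_continuous_on_const absolutely_continuous_on_tail integrable)
  then show "absolutely_continuous_on {a..b} Q" by (simp flip: Q_eq)
  have "absolutely_continuous_on {a..b} (\<lambda>x. 0 - exp (- (2 * \<i> * k) * of_real x) * tail_integral fP x)"
    by (intro absolutely_continuous_on_diff absolutely_continuous_on_mult absolutely_continuous_on_const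
        absolutely_continuous_on_tail integrable absolutely_continuous_on_exp_mult)
  moreover have "P = (\<lambda>x. 0 - exp (- (2 * \<i> * k) * of_real x) * tail_integral fP x)"
    by (rule ext) (simp only: P_eq diff_0)
  ultimately show "absolutely_continuous_on {a..b} P" by simp
qed

private lemma ac_uv: "absolutely_continuous_on {a..b} u" "absolutely_continuous_on {a..b} v"
proof -
  have "absolutely_continuous_on {a..b} (\<lambda>x. exp (\<i> * k * of_real x) * (Q x - P x) * (1 / (2 * \<i> * k)))"
    "absolutely_continuous_on {a..b} (\<lambda>x. exp (\<i> * k * of_real x) * (Q x + P x) * (1 / 2))"
    by (intro absolutely_continuous_on_diff absolutely_continuous_on_add absolutely_continuous_on_mult
        absolutely_continuous_on_const absolutely_continuous_on_exp_mult ac_QP)+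
  then show "absolutely_continuous_on {a..b} u" "absolutely_continuous_on {a..b} v"
    unfolding u_def[abs_def] v_def[abs_def] by simp_all
qed

private lemma deriv_QP:
  "AE x in lebesgue. (Q has_vector_derivative fQ x) (at x) \<and>
     (P has_vector_derivative - (2 * \<i> * k) * P x + rP k x (Q x) (P x)) (at x)"
  using tail_integral_has_vector_derivative_AE[OF integrable(1)] tail_integral_has_vector_derivative_AE[OF integrable(2)]
proof eventually_elim
  fix x assume 1: "(tail_integral fQ has_vector_derivative - fQ x) (at x)"
    and 2: "(tail_integral fP has_vector_derivative - fP x) (at x)"
  have "((\<lambda>x. 1 - tail_integral fQ x) has_vector_derivative 0 - - fQ x) (at x)"
    by (intro has_vector_derivative_diff has_vector_derivative_const 1)
  then have "(Q has_vector_derivative fQ x) (at x)" by (simp flip: Q_eq)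
  moreover
  have "((\<lambda>x. - (exp (- (2 * \<i> * k) * of_real x) * tail_integral fP x)) has_vector_derivative
      - (exp (- (2 * \<i> * k) * of_real x) * - fP x
         + exp (- (2 * \<i> * k) * of_real x) * (- (2 * \<i> * k)) * tail_integral fP x)) (at x)"
    by (intro has_vector_derivative_minus has_vector_derivative_mult exp_mult_has_vector_derivative 2)
  then have "(P has_vector_derivative
      - (exp (- (2 * \<i> * k) * of_real x) * - fP x
         + exp (- (2 * \<i> * k) * of_real x) * (- (2 * \<i> * k)) * tail_integral fP x)) (at x)"
    unfolding P_eq[symmetric] .
  moreover have "- (exp (- (2 * \<i> * k) * of_real x) * - fP x
         + exp (- (2 * \<i> * k) * of_real x) * (- (2 * \<i> * k)) * tail_integral fP x)
      = - (2 * \<i> * k) * P x + rP k x (Q x) (P x)"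
  proof -
    have "exp (- (2 * \<i> * k) * of_real x) * fP x = rP k x (Q x) (P x)"
      unfolding fP_def mult.assoc[symmetric] exp_add[symmetric] by simp
    then show ?thesis by (subst P_eq) (simp add: algebra_simps)
  qed
  ultimately show "(Q has_vector_derivative fQ x) (at x) \<and>
     (P has_vector_derivative - (2 * \<i> * k) * P x + rP k x (Q x) (P x)) (at x)" by simp
qed

private lemma deriv_uv:
  "AE x in lebesgue.
     (u has_vector_derivative of_real (s x) * u x + v x) (at x) \<and>
     (v has_vector_derivative - of_real (s x) * v x + (of_real (w x) - k\<^sup>2) * u x) (at x)"
  using deriv_QP
proof eventually_elim
  fix x assume *: "(Q has_vector_derivative fQ x) (at x) \<and>
     (P has_vector_derivative - (2 * \<i> * k) * P x + rP k x (Q x) (P x)) (at x)"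
  let ?e = "exp (\<i> * k * of_real x)" and ?P' = "- (2 * \<i> * k) * P x + rP k x (Q x) (P x)"
  note Q' = *[THEN conjunct1] and P' = *[THEN conjunct2]
  have "(u has_vector_derivative (?e * (fQ x - ?P') + ?e * (\<i> * k) * (Q x - P x)) / (2 * \<i> * k)) (at x)"
    unfolding u_def[abs_def]
    by (intro has_vector_derivative_divide has_vector_derivative_mult has_vector_derivative_diff Q' P'
        exp_mult_has_vector_derivative)
  moreover have "(?e * (fQ x - ?P') + ?e * (\<i> * k) * (Q x - P x)) / (2 * \<i> * k) = of_real (s x) * u x + v x"
    using k_nz by (simp add: u_def v_def fQ_def rQ_def rP_def field_simps)
  moreover have "(v has_vector_derivative (?e * (fQ x + ?P') + ?e * (\<i> * k) * (Q x + P x)) / 2) (at x)"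
    unfolding v_def[abs_def]
    by (intro has_vector_derivative_divide has_vector_derivative_mult has_vector_derivative_add Q' P'
        exp_mult_has_vector_derivative)
  moreover have "(?e * (fQ x + ?P') + ?e * (\<i> * k) * (Q x + P x)) / 2
      = - of_real (s x) * v x + (of_real (w x) - k\<^sup>2) * u x"
  proof -
    have uv: "?e * Q x = v x + \<i> * k * u x" "?e * P x = v x - \<i> * k * u x"
      using k_nz by (simp_all add: u_def v_def field_simps)
    \<comment> \<open>The term common to both perturbations: it cancels in the equation for u',
      while in the one for v' the two copies add up and produce w u.\<close>
    define W where "W = of_real (w x) / (2 * \<i> * k) * (Q x - P x)"
    have f: "fQ x = W - of_real (s x) * P x" "?P' = - (2 * \<i> * k) * P x + (W - of_real (s x) * Q x)"
      by (simp_all add: fQ_def rQ_def rP_def W_def)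
    have "?e * W = of_real (w x) * u x" by (simp add: u_def W_def)
    then have a1: "?e * (fQ x + ?P') = 2 * (of_real (w x) * u x) - of_real (s x) * (?e * Q x + ?e * P x) - 2 * \<i> * k * (?e * P x)"
      unfolding f by (simp add: algebra_simps)
    have a2: "?e * (\<i> * k) * (Q x + P x) = \<i> * k * (?e * Q x + ?e * P x)"
      by (simp add: algebra_simps)
    show ?thesis unfolding a1 a2 unfolding uv by (simp add: algebra_simps power2_eq_square add_divide_distrib diff_divide_distrib)
  qed
  ultimately show "(u has_vector_derivative of_real (s x) * u x + v x) (at x) \<and>
     (v has_vector_derivative - of_real (s x) * v x + (of_real (w x) - k\<^sup>2) * u x) (at x)"
    by (simp only: simp_thms)
qed

text \<open>The derivative of conj(u) v is |v|^2 + (w - k^2) |u|^2; the terms with s cancel because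
  s is real. Its imaginary part is -2 Re k Im k |u|^2 \<le> 0.\<close>

private lemma Im_antimono:
  assumes "x \<le> y"
  shows "Im (cnj (u y) * v y) \<le> Im (cnj (u x) * v x)"
proof -
  let ?D' = "\<lambda>t. cnj (of_real (s t) * u t + v t) * v t + cnj (u t) * (- of_real (s t) * v t + (of_real (w t) - k\<^sup>2) * u t)"
  define N where "N = {x. \<not> ((u has_vector_derivative of_real (s x) * u x + v x) (at x) \<and>
     (v has_vector_derivative - of_real (s x) * v x + (of_real (w x) - k\<^sup>2) * u x) (at x))}"
  have "(?D' has_integral cnj (u y) * v y - cnj (u x) * v x) {x..y}"
  proof (rule has_integral_absolutely_continuous_on[OF _ assms])
    show "absolutely_continuous_on {x..y} (\<lambda>t. cnj (u t) * v t)"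
      by (intro absolutely_continuous_on_mult absolutely_continuous_on_cnj ac_uv)
    show "negligible N" unfolding N_def by (rule negligible_not_AE[OF deriv_uv])
    fix t assume "t \<in> {x<..<y} - N"
    then have t: "(u has_vector_derivative of_real (s t) * u t + v t) (at t)"
      "(v has_vector_derivative - of_real (s t) * v t + (of_real (w t) - k\<^sup>2) * u t) (at t)"
      by (auto simp: N_def)
    have "((\<lambda>t. cnj (u t) * v t) has_vector_derivative
       cnj (u t) * (- of_real (s t) * v t + (of_real (w t) - k\<^sup>2) * u t) + cnj (of_real (s t) * u t + v t) * v t) (at t)"
      by (intro has_vector_derivative_mult has_vector_derivative_cnj t)
    then show "((\<lambda>t. cnj (u t) * v t) has_vector_derivative ?D' t) (at t)"
      by (simp only: add.commute)
  qed
  from has_integral_linear[OF this bounded_linear_Im]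
  have hi: "((\<lambda>t. Im (?D' t)) has_integral Im (cnj (u y) * v y - cnj (u x) * v x)) {x..y}"
    by (simp only: comp_def)
  have le: "Im (?D' t) \<le> 0" for t
  proof -
    have "?D' t = of_real ((norm (v t))\<^sup>2) + (of_real (w t) - k\<^sup>2) * of_real ((norm (u t))\<^sup>2)"
      by (simp only: complex_norm_square complex_cnj_add complex_cnj_mult complex_cnj_complex_of_real) (simp add: algebra_simps)
    moreover have "Im (of_real a + (of_real b - k\<^sup>2) * of_real c) = - (2 * Re k * Im k) * c" for a b c :: real
      by (simp add: power2_eq_square algebra_simps)
    ultimately have "Im (?D' t) = - (2 * Re k * Im k) * (norm (u t))\<^sup>2" by (simp only:)
    then show ?thesis using k d by simp
  qed
  have "Im (cnj (u y) * v y - cnj (u x) * v x) \<le> 0"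
    by (rule has_integral_le[OF hi has_integral_0 le])
  then show ?thesis by simp
qed

text \<open>After division by |e^{ikx}|^2, conj(u) v has a limit at infinity with imaginary part Re
  k / (4 |k|^2) > 0. The exponential is divided out because it tends to 0 when Im k > 0.
  Monotonicity carries positivity from a large y back to x.\<close>

private lemma Im_pos: "Im (cnj (u x) * v x) > 0"
proof -
  let ?g = "\<lambda>y. Im (cnj ((Q y - P y) / (2 * \<i> * k)) * ((Q y + P y) / 2))"
  have "(?g \<longlongrightarrow> Im (cnj ((1 - 0) / (2 * \<i> * k)) * ((1 + 0) / 2))) at_top"
    using k_nz by (intro tendsto_intros limits) auto
  moreover have "Im (cnj ((1 - 0) / (2 * \<i> * k)) * ((1 + 0) / 2)) > 0"
  proof -
    have "cnj ((1 - 0) / (2 * \<i> * k)) * ((1 + 0) / 2) = \<i> * k / of_real (4 * (norm k)\<^sup>2)"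
      using k_nz by (simp add: complex_norm_square field_simps del: of_real_power)
    also have "Im \<dots> = Re k / (4 * (norm k)\<^sup>2)"
      by (simp only: Im_divide_of_real) simp
    also have "\<dots> > 0" using k d k_nz by simp
    finally show ?thesis .
  qed
  ultimately have "eventually (\<lambda>y. ?g y > 0) at_top" by (rule order_tendstoD(1))
  then have "eventually (\<lambda>y. ?g y > 0 \<and> y \<ge> x) at_top" using eventually_ge_at_top by (rule eventually_conj)
  then obtain y where y: "?g y > 0" "y \<ge> x" unfolding eventually_at_top_linorder by blast
  have "cnj (u y) * v y = of_real ((norm (exp (\<i> * k * of_real y)))\<^sup>2) * (cnj ((Q y - P y) / (2 * \<i> * k)) * ((Q y + P y) / 2))"
    by (simp only: complex_norm_square u_def v_def) simp
  then have "Im (cnj (u y) * v y) = (norm (exp (\<i> * k * of_real y)))\<^sup>2 * ?g y"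
    by (simp only: Im_complex_of_real Re_complex_of_real times_complex.sel mult_zero_left add_0_right)
  moreover have "(norm (exp (\<i> * k * of_real y)))\<^sup>2 * ?g y > 0" by (rule mult_pos_pos[OF _ y(1)]) simp
  ultimately have "Im (cnj (u y) * v y) > 0" by (rule ssubst)
  then show ?thesis using Im_antimono[OF y(2)] by (rule less_le_trans)
qed

private lemma decay: "norm (u x) \<le> C / d * exp (- Im k * x)" "norm (v x) \<le> C * exp (- Im k * x)"
proof -
  have e: "norm (exp (\<i> * k * of_real x)) = exp (- Im k * x)" by (simp add: norm_exp_eq_Re)
  have a: "norm (Q x) \<le> C" "norm (P x) \<le> C"
    by (rule order_trans[OF norm_fst_le bound] order_trans[OF norm_snd_le bound])+
  have "C \<ge> 0" using a(1) norm_ge_zero[of "Q x"] by linarith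
  have "d \<le> norm k" using k complex_Re_le_cmod[of k] by linarith
  have 1: "norm (Q x - P x) \<le> 2 * C" "norm (Q x + P x) \<le> 2 * C"
    using a norm_triangle_ineq4[of "Q x" "P x"] norm_triangle_ineq[of "Q x" "P x"] by linarith+
  have "norm (u x) = exp (- Im k * x) * (norm (Q x - P x) / (2 * norm k))"
    unfolding u_def norm_mult norm_divide e by (simp add: norm_mult)
  also have "\<dots> \<le> exp (- Im k * x) * (2 * C / (2 * d))"
    using 1 \<open>C \<ge> 0\<close> \<open>d \<le> norm k\<close> d by (intro mult_left_mono frac_le) auto
  finally show "norm (u x) \<le> C / d * exp (- Im k * x)" by (simp add: mult.commute)
  have "norm (v x) = exp (- Im k * x) * (norm (Q x + P x) / 2)"
    unfolding v_def norm_mult norm_divide e by simp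
  also have "\<dots> \<le> exp (- Im k * x) * C"
    using 1 by (intro mult_left_mono) auto
  finally show "norm (v x) \<le> C * exp (- Im k * x)" by (simp add: mult.commute)
qed

lemma jost_solution_properties:
  defines "U \<equiv> \<lambda>x. exp (\<i> * k * of_real x) * (Q x - P x) / (2 * \<i> * k)"
    and "V \<equiv> \<lambda>x. exp (\<i> * k * of_real x) * (Q x + P x) / 2"
  shows "solves_system s w (k\<^sup>2) U V" "Im (cnj (U x) * V x) > 0"
    "norm (U x) \<le> C / d * exp (- Im k * x)" "norm (V x) \<le> C * exp (- Im k * x)"
proof -
  have UV: "U = u" "V = v" unfolding U_def V_def by (auto simp: u_def v_def)
  show "solves_system s w (k\<^sup>2) U V"
    unfolding UV solves_system_def AC_loc_def
    using ac_uv deriv_uv by (auto simp: AE_restrict_space_iff)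
  show "Im (cnj (U x) * V x) > 0" "norm (U x) \<le> C / d * exp (- Im k * x)" "norm (V x) \<le> C * exp (- Im k * x)"
    unfolding UV by (rule Im_pos decay)+
qed

end

lemma jost_family:
  obtains U V :: "real \<Rightarrow> complex \<Rightarrow> complex" and C :: real where
    "continuous_on UNIV (\<lambda>p. U (fst p) (snd p))" "continuous_on UNIV (\<lambda>p. V (fst p) (snd p))"
    "\<And>k. d \<le> Re k \<Longrightarrow> 0 \<le> Im k \<Longrightarrow> solves_system s w (k\<^sup>2) (\<lambda>x. U x k) (\<lambda>x. V x k)"
    "\<And>x k. d \<le> Re k \<Longrightarrow> 0 \<le> Im k \<Longrightarrow> Im (cnj (U x k) * V x k) > 0"
    "\<And>x k. d \<le> Re k \<Longrightarrow> 0 \<le> Im k \<Longrightarrow> norm (U x k) \<le> C * exp (- Im k * x)"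
    "\<And>x k. d \<le> Re k \<Longrightarrow> 0 \<le> Im k \<Longrightarrow> norm (V x k) \<le> C * exp (- Im k * x)"
  using jost_solution_exists
proof (elim exE conjE)
  fix Q P :: "real \<Rightarrow> complex \<Rightarrow> complex" and C :: real
  assume cont: "continuous_on UNIV (\<lambda>p. Q (fst p) (snd p))" "continuous_on UNIV (\<lambda>p. P (fst p) (snd p))"
    and all: "\<forall>x \<kappa>. norm (Q x \<kappa>, P x \<kappa>) \<le> C \<and>
      Q x \<kappa> = 1 - tail_integral (\<lambda>t. rQ (kk \<kappa>) t (Q t \<kappa>) (P t \<kappa>)) x \<and>
      P x \<kappa> = - tail_integral (\<lambda>t. exp (2 * \<i> * kk \<kappa> * of_real (t - x)) * rP (kk \<kappa>) t (Q t \<kappa>) (P t \<kappa>)) x"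
  note QP = all[rule_format, THEN conjunct1] all[rule_format, THEN conjunct2, THEN conjunct1]
    all[rule_format, THEN conjunct2, THEN conjunct2]
  \<comment> \<open>With \<open>kk k\<close> in place of k the functions are continuous for all
    parameters; where Re k \<ge> d and Im k \<ge> 0 the two coincide.\<close>
  define U where "U x k = exp (\<i> * kk k * of_real x) * (Q x k - P x k) / (2 * \<i> * kk k)" for x k
  define V where "V x k = exp (\<i> * kk k * of_real x) * (Q x k + P x k) / 2" for x k
  have cx: "continuous_on UNIV (\<lambda>x. Q x k)" "continuous_on UNIV (\<lambda>x. P x k)" for k
  proof -
    have "continuous_on UNIV (\<lambda>x::real. (x, k))" by (intro continuous_intros)
    from continuous_on_compose2[OF cont(1) this] continuous_on_compose2[OF cont(2) this]
    show "continuous_on UNIV (\<lambda>x. Q x k)" "continuous_on UNIV (\<lambda>x. P x k)" by simp_all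
  qed
  have props: "solves_system s w (k\<^sup>2) (\<lambda>x. U x k) (\<lambda>x. V x k)" "Im (cnj (U x k) * V x k) > 0"
    "norm (U x k) \<le> C / d * exp (- Im k * x)" "norm (V x k) \<le> C * exp (- Im k * x)"
    if k: "d \<le> Re k" "0 \<le> Im k" for x k
    using jost_solution_properties[OF k cx[of k] QP(1)[of _ k] QP(2)[of _ k, unfolded kk_id[OF k]] QP(3)[of _ k, unfolded kk_id[OF k]]]
    unfolding U_def V_def kk_id[OF k] by this+
  show ?thesis
  proof (rule that[of U V "max (C / d) C"])
    show "continuous_on UNIV (\<lambda>p. U (fst p) (snd p))" "continuous_on UNIV (\<lambda>p. V (fst p) (snd p))"
      unfolding U_def V_def
      by (intro continuous_intros cont continuous_on_compose2[OF continuous_on_kk[of UNIV]]; simp add: kk_nz)+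
    show "norm (U x k) \<le> max (C / d) C * exp (- Im k * x)" "norm (V x k) \<le> max (C / d) C * exp (- Im k * x)"
      if "d \<le> Re k" "0 \<le> Im k" for x k
      by (rule order_trans[OF props(3)[OF that] mult_right_mono] order_trans[OF props(4)[OF that] mult_right_mono]; simp)+
  qed (fact props)+
qed

end

subsection \<open>Weyl solutions\<close>

lemma AC_loc_imp_continuous_on:
  assumes "f \<in> AC_loc"
  shows "continuous_on {0<..} f"
proof -
  have "isCont f x" if "x > 0" for x
  proof -
    have "absolutely_continuous_on {x / 2..x + 1} f" using assms that by (auto simp: AC_loc_def)
    then have "continuous_on {x / 2..x + 1} f" by (rule absolutely_continuous_on_imp_continuous_on)
    then show ?thesis using that by (intro continuous_on_interior) auto
  qed
  then show ?thesis by (simp add: continuous_on_eq_continuous_at)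
qed

lemma AC_loc_imp_absolutely_continuous_on:
  assumes "f \<in> AC_loc" "0 < a"
  shows "absolutely_continuous_on {a..b} f"
proof -
  have "absolutely_continuous_on {a..max b (a + 1)} f" using assms by (auto simp: AC_loc_def)
  then show ?thesis by (rule absolutely_continuous_on_subset) auto
qed

section \<open>Quasi-derivatives and the first-order system\<close>

lemma AE_lebesgue_on_negligible:
  assumes "AE x in lebesgue_on {0<..}. Q x"
  shows "\<exists>N. negligible N \<and> (\<forall>x::real. 0 < x \<longrightarrow> x \<notin> N \<longrightarrow> Q x)"
proof (intro exI conjI)
  have "AE x in lebesgue. 0 < x \<longrightarrow> Q x" using assms by (simp add: AE_restrict_space_iff)
  then show "negligible {x. \<not> (0 < x \<longrightarrow> Q x)}" by (rule negligible_not_AE)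
qed auto

text \<open>The set of positive points where f and g differ is open and null, hence empty.\<close>

lemma continuous_on_AE_eq:
  fixes f g :: "real \<Rightarrow> complex"
  assumes "continuous_on {0<..} f" "continuous_on {0<..} g" "AE x in lebesgue_on {0<..}. f x = g x" "0 < x"
  shows "f x = g x"
proof (rule ccontr)
  assume ne: "f x \<noteq> g x"
  let ?S = "{x \<in> {0<..}. f x - g x \<in> - {0}}"
  have "open ?S"
    using assms(1,2) by (intro continuous_open_preimage[unfolded vimage_def Int_def, simplified] continuous_intros) auto
  moreover obtain N where N: "negligible N" "\<And>x. 0 < x \<Longrightarrow> x \<notin> N \<Longrightarrow> f x = g x"
    using AE_lebesgue_on_negligible[OF assms(3)] by blast
  have "negligible ?S" by (rule negligible_subset[OF N(1)]) (use N(2) in auto)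
  ultimately have "?S = {}" using open_not_negligible by blast
  then show False using ne assms(4) by auto
qed

lemma is_quasi_deriv_unique:
  assumes "is_quasi_deriv \<sigma> u v1" "is_quasi_deriv \<sigma> u v2" "0 < x"
  shows "v1 x = v2 x"
proof (rule continuous_on_AE_eq[OF _ _ _ assms(3)])
  show "continuous_on {0<..} v1" "continuous_on {0<..} v2"
    using assms by (auto simp: is_quasi_deriv_def intro: AC_loc_imp_continuous_on)
  have "AE x in lebesgue_on {0<..}. \<exists>d. (u has_vector_derivative d) (at x) \<and> v1 x = d - of_real (\<sigma> x) * u x"
    "AE x in lebesgue_on {0<..}. \<exists>d. (u has_vector_derivative d) (at x) \<and> v2 x = d - of_real (\<sigma> x) * u x"
    using assms by (auto simp: is_quasi_deriv_def)
  then show "AE x in lebesgue_on {0<..}. v1 x = v2 x"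
    by eventually_elim (auto dest: vector_derivative_unique_at)
qed

lemma is_quasi_deriv_quasi_deriv:
  "is_quasi_deriv \<sigma> u v \<Longrightarrow> is_quasi_deriv \<sigma> u (quasi_deriv \<sigma> u)"
  unfolding quasi_deriv_def by (rule someI[of "is_quasi_deriv \<sigma> u"])

lemma has_vector_derivative_cong_pos:
  assumes "\<And>x. 0 < x \<Longrightarrow> f x = g x" "0 < x"
  shows "(f has_vector_derivative d) (at x) \<longleftrightarrow> (g has_vector_derivative d) (at x)"
proof -
  have *: "(g has_vector_derivative d) (at x)"
    if "(f has_vector_derivative d) (at x)" "\<And>x. 0 < x \<Longrightarrow> f x = g x" for f g :: "real \<Rightarrow> 'a::real_normed_vector"
    by (rule has_vector_derivative_transform_within_open[OF that(1), of "{0<..}"]) (use assms(2) that(2) in auto)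
  show ?thesis using *[of f g] *[of g f] assms(1) by auto
qed

text \<open>\<open>quasi_deriv\<close> is an arbitrary choice, but v is an admissible candidate, so
  uniqueness identifies the two on the half-line. As the half-line is open, their derivatives agree
  there as well.\<close>

lemma solves_system_imp_ell_eq:
  assumes sys: "solves_system \<sigma> w z u v" and w: "\<And>x. 0 < x \<Longrightarrow> w x = \<tau> x - (\<sigma> x)\<^sup>2"
  shows "ell_eq \<sigma> \<tau> u (\<lambda>x. z * u x)"
proof -
  have "is_quasi_deriv \<sigma> u v"
    unfolding is_quasi_deriv_def
  proof (intro conjI)
    have "AE x in lebesgue_on {0<..}. (u has_vector_derivative of_real (\<sigma> x) * u x + v x) (at x)"
      using sys unfolding solves_system_def by (auto elim: AE_mp)
    then show "AE x in lebesgue_on {0<..}. \<exists>d. (u has_vector_derivative d) (at x) \<and> v x = d - of_real (\<sigma> x) * u x"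
      by eventually_elim auto
  qed (use sys in \<open>auto simp: solves_system_def\<close>)
  then have q: "is_quasi_deriv \<sigma> u (quasi_deriv \<sigma> u)" by (rule is_quasi_deriv_quasi_deriv)
  have eq: "quasi_deriv \<sigma> u x = v x" if "0 < x" for x
    using is_quasi_deriv_unique[OF q \<open>is_quasi_deriv \<sigma> u v\<close> that] .
  have pos: "AE x in lebesgue_on {0<..}. (0::real) < x"
    by (rule AE_I2) (auto simp: space_restrict_space)
  have "AE x in lebesgue_on {0<..}. (v has_vector_derivative - of_real (\<sigma> x) * v x + (of_real (w x) - z) * u x) (at x)"
    using sys unfolding solves_system_def by (auto elim: AE_mp)
  with pos have "AE x in lebesgue_on {0<..}.
        \<exists>d. (quasi_deriv \<sigma> u has_vector_derivative d) (at x) \<and>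
            z * u x = - d - of_real (\<sigma> x) * quasi_deriv \<sigma> u x + of_real (\<tau> x - (\<sigma> x)\<^sup>2) * u x"
  proof eventually_elim
    fix x :: real assume x: "0 < x" "(v has_vector_derivative - of_real (\<sigma> x) * v x + (of_real (w x) - z) * u x) (at x)"
    then have "(quasi_deriv \<sigma> u has_vector_derivative - of_real (\<sigma> x) * v x + (of_real (w x) - z) * u x) (at x)"
      using has_vector_derivative_cong_pos[OF eq x(1)] by simp
    then show "\<exists>d. (quasi_deriv \<sigma> u has_vector_derivative d) (at x) \<and>
            z * u x = - d - of_real (\<sigma> x) * quasi_deriv \<sigma> u x + of_real (\<tau> x - (\<sigma> x)\<^sup>2) * u x"
    proof (intro exI conjI)
      have "\<tau> x = w x + (\<sigma> x)\<^sup>2" using w[OF x(1)] by simp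
      then show "z * u x = - (- of_real (\<sigma> x) * v x + (of_real (w x) - z) * u x)
          - of_real (\<sigma> x) * quasi_deriv \<sigma> u x + of_real (\<tau> x - (\<sigma> x)\<^sup>2) * u x"
        by (simp add: eq[OF x(1)] algebra_simps)
    qed
  qed
  then show ?thesis unfolding ell_eq_def quasi_domain_def using q by blast
qed

lemma ell_eq_imp_solves_system:
  assumes ell: "ell_eq \<sigma> \<tau> u (\<lambda>x. z * u x)" and w: "\<And>x. 0 < x \<Longrightarrow> w x = \<tau> x - (\<sigma> x)\<^sup>2"
  shows "solves_system \<sigma> w z u (quasi_deriv \<sigma> u)"
proof -
  from ell obtain v where "is_quasi_deriv \<sigma> u v" by (auto simp: ell_eq_def quasi_domain_def)
  then have q: "is_quasi_deriv \<sigma> u (quasi_deriv \<sigma> u)" by (rule is_quasi_deriv_quasi_deriv)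
  have pos: "AE x in lebesgue_on {0<..}. (0::real) < x"
    by (rule AE_I2) (auto simp: space_restrict_space)
  have "AE x in lebesgue_on {0<..}. \<exists>d. (u has_vector_derivative d) (at x) \<and> quasi_deriv \<sigma> u x = d - of_real (\<sigma> x) * u x"
    using q by (auto simp: is_quasi_deriv_def)
  moreover have "AE x in lebesgue_on {0<..}.
        \<exists>d. (quasi_deriv \<sigma> u has_vector_derivative d) (at x) \<and>
            z * u x = - d - of_real (\<sigma> x) * quasi_deriv \<sigma> u x + of_real (\<tau> x - (\<sigma> x)\<^sup>2) * u x"
    using ell by (auto simp: ell_eq_def)
  ultimately have "AE x in lebesgue_on {0<..}.
        (u has_vector_derivative of_real (\<sigma> x) * u x + quasi_deriv \<sigma> u x) (at x) \<and>
        (quasi_deriv \<sigma> u has_vector_derivative - of_real (\<sigma> x) * quasi_deriv \<sigma> u x + (of_real (w x) - z) * u x) (at x)"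
    using pos
  proof eventually_elim
    fix x :: real assume "0 < x"
      and "\<exists>d. (u has_vector_derivative d) (at x) \<and> quasi_deriv \<sigma> u x = d - of_real (\<sigma> x) * u x"
      and "\<exists>d. (quasi_deriv \<sigma> u has_vector_derivative d) (at x) \<and>
            z * u x = - d - of_real (\<sigma> x) * quasi_deriv \<sigma> u x + of_real (\<tau> x - (\<sigma> x)\<^sup>2) * u x"
    then obtain d1 d2 where 1: "(u has_vector_derivative d1) (at x)" "quasi_deriv \<sigma> u x = d1 - of_real (\<sigma> x) * u x"
      and 2: "(quasi_deriv \<sigma> u has_vector_derivative d2) (at x)"
        "z * u x = - d2 - of_real (\<sigma> x) * quasi_deriv \<sigma> u x + of_real (\<tau> x - (\<sigma> x)\<^sup>2) * u x" by blast
    have "d1 = of_real (\<sigma> x) * u x + quasi_deriv \<sigma> u x" using 1(2) by simp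
    moreover have "d2 = - of_real (\<sigma> x) * quasi_deriv \<sigma> u x + (of_real (w x) - z) * u x"
      using 2(2) unfolding w[OF \<open>0 < x\<close>] by (simp add: algebra_simps)
    ultimately show "(u has_vector_derivative of_real (\<sigma> x) * u x + quasi_deriv \<sigma> u x) (at x) \<and>
        (quasi_deriv \<sigma> u has_vector_derivative - of_real (\<sigma> x) * quasi_deriv \<sigma> u x + (of_real (w x) - z) * u x) (at x)"
      using 1(1) 2(1) by (simp only: simp_thms)
  qed
  then show ?thesis using q by (auto simp: solves_system_def is_quasi_deriv_def)
qed

lemma solves_system_negligible:
  assumes "solves_system s w z u v"
  shows "\<exists>N. negligible N \<and> (\<forall>x. 0 < x \<longrightarrow> x \<notin> N \<longrightarrow>
    (u has_vector_derivative of_real (s x) * u x + v x) (at x) \<and>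
    (v has_vector_derivative - of_real (s x) * v x + (of_real (w x) - z) * u x) (at x))"
  using assms unfolding solves_system_def by (intro AE_lebesgue_on_negligible) (elim conjE)

text \<open>The integral over [x, x + 1] is a difference of two tails and tends to 0, whereas the
  lower bound keeps it at least 1.\<close>

lemma not_integrable_bounded_below:
  assumes q: "integrable lebesgue (q :: real \<Rightarrow> real)" and ge: "\<And>x. x \<ge> X \<Longrightarrow> q x \<ge> 1"
  shows False
proof -
  have "((\<lambda>x. tail_integral q x - tail_integral q (x + 1)) \<longlongrightarrow> 0 - 0) at_top"
    by (intro tendsto_diff tail_integral_tendsto_0[OF q] filterlim_compose[OF tail_integral_tendsto_0[OF q]]
        filterlim_at_top_mono[OF filterlim_ident]) simp
  moreover have "eventually (\<lambda>x. tail_integral q x - tail_integral q (x + 1) \<ge> 1) at_top"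
    using eventually_ge_at_top[of X]
  proof eventually_elim
    fix x assume "X \<le> x"
    have "integral {x..x + 1} (\<lambda>_. 1::real) \<le> integral {x..x + 1} q"
    proof (rule integral_le)
      show "q integrable_on {x..x + 1}"
        using set_integrable_lebesgue[OF q, of "{x..x + 1}"] by (auto intro: set_lebesgue_integral_eq_integral(1))
    qed (use ge \<open>X \<le> x\<close> in auto)
    then show "1 \<le> tail_integral q x - tail_integral q (x + 1)" by (simp add: tail_integral_diff[OF q])
  qed
  ultimately have "1 \<le> (0 - 0 :: real)" by (intro tendsto_lowerbound) auto
  then show False by simp
qed

section \<open>Wronskians and uniqueness of the square integrable solution up to multiples\<close>

text \<open>The coefficient matrix of the system has trace 0, so the determinant of two solutions
  for the same z has derivative 0 almost everywhere.\<close>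

lemma wronskian_constant:
  assumes u: "solves_system s w z u v" and \<psi>: "solves_system s w z \<psi> \<psi>1" and "0 < a" "a \<le> b"
  shows "u b * \<psi>1 b - v b * \<psi> b = u a * \<psi>1 a - v a * \<psi> a"
proof -
  obtain N where N: "negligible N" "\<forall>x. 0 < x \<longrightarrow> x \<notin> N \<longrightarrow>
      (u has_vector_derivative of_real (s x) * u x + v x) (at x) \<and>
      (v has_vector_derivative - of_real (s x) * v x + (of_real (w x) - z) * u x) (at x)"
    using solves_system_negligible[OF u] by (elim exE conjE)
  obtain N' where N': "negligible N'" "\<forall>x. 0 < x \<longrightarrow> x \<notin> N' \<longrightarrow>
      (\<psi> has_vector_derivative of_real (s x) * \<psi> x + \<psi>1 x) (at x) \<and>
      (\<psi>1 has_vector_derivative - of_real (s x) * \<psi>1 x + (of_real (w x) - z) * \<psi> x) (at x)"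
    using solves_system_negligible[OF \<psi>] by (elim exE conjE)
  have ac: "u \<in> AC_loc" "v \<in> AC_loc" "\<psi> \<in> AC_loc" "\<psi>1 \<in> AC_loc"
    using u \<psi> by (auto simp: solves_system_def)
  show ?thesis
  proof (rule absolutely_continuous_on_deriv_0[OF _ assms(4)])
    show "absolutely_continuous_on {a..b} (\<lambda>x. u x * \<psi>1 x - v x * \<psi> x)"
      by (intro absolutely_continuous_on_diff absolutely_continuous_on_mult
          AC_loc_imp_absolutely_continuous_on[OF _ assms(3)] ac)
    show "negligible (N \<union> N')" using N(1) N'(1) by (rule negligible_Un)
    fix x assume x: "x \<in> {a<..<b} - (N \<union> N')"
    then have "0 < x" "x \<notin> N" "x \<notin> N'" using assms by auto
    note d = N(2)[rule_format, OF this(1,2)] N'(2)[rule_format, OF this(1,3)]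
    have "((\<lambda>x. u x * \<psi>1 x - v x * \<psi> x) has_vector_derivative
        (u x * (- of_real (s x) * \<psi>1 x + (of_real (w x) - z) * \<psi> x) + (of_real (s x) * u x + v x) * \<psi>1 x) -
        (v x * (of_real (s x) * \<psi> x + \<psi>1 x) + (- of_real (s x) * v x + (of_real (w x) - z) * u x) * \<psi> x)) (at x)"
      by (intro has_vector_derivative_diff has_vector_derivative_mult d[THEN conjunct1] d[THEN conjunct2])
    then show "((\<lambda>x. u x * \<psi>1 x - v x * \<psi> x) has_vector_derivative 0) (at x)"
      by (rule has_vector_derivative_eq_rhs) (simp add: algebra_simps)
  qed
qed

text \<open>
  If $W$ is the Wronskian of a square integrable $u$ and a decaying $\psi$, then
  $(u\psi)' = 2u\psi^{[1]} + 2su\psi - W$, so that $u\psi$ grows linearly unless $W = 0$.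
\<close>

lemma wronskian_eq_0:
  assumes u: "solves_system s w z u v" and \<psi>: "solves_system s w z \<psi> \<psi>1"
    and L2: "set_integrable lebesgue {0<..} (\<lambda>x. (norm (u x))\<^sup>2)"
      "set_integrable lebesgue {0<..} (\<lambda>x. (norm (\<psi> x))\<^sup>2)"
      "set_integrable lebesgue {0<..} (\<lambda>x. (norm (\<psi>1 x))\<^sup>2)"
      "set_integrable lebesgue {0<..} (\<lambda>x. (s x)\<^sup>2)"
    and M: "\<And>x. 0 < x \<Longrightarrow> norm (\<psi> x) \<le> M"
    and x: "0 < x"
  shows "u x * \<psi>1 x = v x * \<psi> x"
proof -
  define c where "c = u 1 * \<psi>1 1 - v 1 * \<psi> 1"
  have W: "u x * \<psi>1 x - v x * \<psi> x = c" if "0 < x" for x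
  proof (cases "x \<le> 1")
    case True
    then show ?thesis unfolding c_def by (rule wronskian_constant[OF u \<psi> that, symmetric])
  next
    case False
    then show ?thesis unfolding c_def by (intro wronskian_constant[OF u \<psi>]) auto
  qed
  have "M \<ge> 0" using M[of 1] norm_ge_zero[of "\<psi> 1"] by linarith
  define f where "f x = 2 * u x * \<psi>1 x + 2 * of_real (s x) * u x * \<psi> x" for x
  \<comment> \<open>Integrable majorant of the norm of f. Both products are split by 2pq \<le> p^2 +
    q^2, after the bounded factor \<psi> has been pulled out of the second; this is where s must be
    square integrable.\<close>
  define g where "g x = ((norm (u x))\<^sup>2 + (norm (\<psi>1 x))\<^sup>2) + M * ((s x)\<^sup>2 + (norm (u x))\<^sup>2)" for x
  have g_int: "set_integrable lebesgue {0<..} g"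
    unfolding g_def by (intro set_integral_add set_integrable_mult_right L2)
  have am: "2 * (p * q) \<le> p\<^sup>2 + q\<^sup>2" for p q :: real
    using zero_le_power2[of "p - q"] by (simp add: power2_eq_square algebra_simps)
  have f_le: "norm (f x) \<le> g x" if "0 < x" for x
  proof -
    have "norm (f x) \<le> 2 * (norm (u x) * norm (\<psi>1 x)) + norm (\<psi> x) * (2 * (\<bar>s x\<bar> * norm (u x)))"
      unfolding f_def by (rule order_trans[OF norm_triangle_ineq]) (simp add: norm_mult mult_ac)
    also have "norm (\<psi> x) * (2 * (\<bar>s x\<bar> * norm (u x))) \<le> M * ((s x)\<^sup>2 + (norm (u x))\<^sup>2)"
      using am[of "\<bar>s x\<bar>" "norm (u x)"] by (intro mult_mono M[OF that] \<open>M \<ge> 0\<close>) simp_all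
    also have "2 * (norm (u x) * norm (\<psi>1 x)) \<le> (norm (u x))\<^sup>2 + (norm (\<psi>1 x))\<^sup>2" by (rule am)
    finally show ?thesis by (simp add: g_def)
  qed
  have f_has: "(f has_integral u x * \<psi> x - u 1 * \<psi> 1 + of_real (x - 1) * c) {1..x}" if "1 \<le> x" for x
  proof -
    obtain N where N: "negligible N" "\<forall>x. 0 < x \<longrightarrow> x \<notin> N \<longrightarrow>
        (u has_vector_derivative of_real (s x) * u x + v x) (at x) \<and>
        (v has_vector_derivative - of_real (s x) * v x + (of_real (w x) - z) * u x) (at x)"
      using solves_system_negligible[OF u] by (elim exE conjE)
    obtain N' where N': "negligible N'" "\<forall>x. 0 < x \<longrightarrow> x \<notin> N' \<longrightarrow>
        (\<psi> has_vector_derivative of_real (s x) * \<psi> x + \<psi>1 x) (at x) \<and>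
        (\<psi>1 has_vector_derivative - of_real (s x) * \<psi>1 x + (of_real (w x) - z) * \<psi> x) (at x)"
      using solves_system_negligible[OF \<psi>] by (elim exE conjE)
    have "((\<lambda>x. f x - c) has_integral u x * \<psi> x - u 1 * \<psi> 1) {1..x}"
    proof (rule has_integral_absolutely_continuous_on[OF _ that])
      show "absolutely_continuous_on {1..x} (\<lambda>x. u x * \<psi> x)"
        using u \<psi> by (intro absolutely_continuous_on_mult AC_loc_imp_absolutely_continuous_on)
          (auto simp: solves_system_def)
      show "negligible (N \<union> N')" using N(1) N'(1) by (rule negligible_Un)
      fix t assume t: "t \<in> {1<..<x} - (N \<union> N')"
      then have "0 < t" "t \<notin> N" "t \<notin> N'" by auto
      note d = N(2)[rule_format, OF this(1,2)] N'(2)[rule_format, OF this(1,3)]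
      have "((\<lambda>x. u x * \<psi> x) has_vector_derivative
          (u t * (of_real (s t) * \<psi> t + \<psi>1 t) + (of_real (s t) * u t + v t) * \<psi> t)) (at t)"
        by (intro has_vector_derivative_mult d[THEN conjunct1])
      then show "((\<lambda>x. u x * \<psi> x) has_vector_derivative f t - c) (at t)"
        by (rule has_vector_derivative_eq_rhs) (simp add: f_def W[OF \<open>0 < t\<close>, symmetric] algebra_simps)
    qed
    from has_integral_add[OF this has_integral_const_real[of c 1 x]] that
    show ?thesis by (simp add: scaleR_conv_of_real)
  qed
  define K where "K = integral {0<..} g"
  have gI: "g integrable_on {0<..}" using g_int by (rule set_lebesgue_integral_eq_integral(1))
  have bound: "norm (u x * \<psi> x - u 1 * \<psi> 1 + of_real (x - 1) * c) \<le> K" if "1 \<le> x" for x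
  proof -
    have sub: "set_integrable lebesgue {1..x} g"
      by (rule set_integrable_subset[OF g_int]) auto
    have "norm (integral {1..x} f) \<le> integral {1..x} g"
      by (rule integral_norm_bound_integral[OF has_integral_integrable[OF f_has[OF that]]
            set_lebesgue_integral_eq_integral(1)[OF sub]]) (rule f_le, simp)
    also have "\<dots> \<le> K"
      unfolding K_def
      by (rule integral_subset_le[OF _ set_lebesgue_integral_eq_integral(1)[OF sub] gI])
        (use \<open>M \<ge> 0\<close> in \<open>auto simp: g_def\<close>)
    finally show ?thesis using integral_unique[OF f_has[OF that]] by simp
  qed
  have "c = 0"
  proof (rule ccontr)
    assume "c \<noteq> 0"
    \<comment> \<open>Beyond X the linear term (x - 1) c exceeds K + |u 1 \<psi> 1| by at least 1 in
      modulus, which forces |u \<psi>| \<ge> 1.\<close>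
    define X where "X = 1 + (K + norm (u 1 * \<psi> 1) + 1) / norm c"
    have "K \<ge> 0" using bound[of 1] by simp
    have X: "X \<ge> 1" using \<open>K \<ge> 0\<close> by (simp add: X_def)
    \<comment> \<open>The sum |u|^2 + |\<psi>|^2 is integrable and at least 2 |u \<psi>|, so it
      cannot stay above 1 on a half-line.\<close>
    define q where "q x = indicator {0<..} x *\<^sub>R ((norm (u x))\<^sup>2 + (norm (\<psi> x))\<^sup>2)" for x :: real
    show False
    proof (rule not_integrable_bounded_below[of q X])
      show "integrable lebesgue q"
        using set_integral_add(1)[OF L2(1,2)] unfolding set_integrable_def q_def .
      fix x assume x: "X \<le> x"
      have "K + norm (u 1 * \<psi> 1) + 1 = (X - 1) * norm c" using \<open>c \<noteq> 0\<close> by (simp add: X_def)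
      also have "\<dots> \<le> (x - 1) * norm c" using x by (intro mult_right_mono) auto
      also have "\<dots> = norm (of_real (x - 1) * c)"
      proof -
        have "x - 1 \<ge> 0" using x X by simp
        then show ?thesis by (simp only: norm_mult norm_of_real abs_of_nonneg)
      qed
      also have "\<dots> \<le> norm (u x * \<psi> x - u 1 * \<psi> 1 + of_real (x - 1) * c) + norm (u x * \<psi> x) + norm (u 1 * \<psi> 1)"
        using norm_triangle_ineq4[of "u x * \<psi> x - u 1 * \<psi> 1 + of_real (x - 1) * c" "u x * \<psi> x - u 1 * \<psi> 1"]
          norm_triangle_ineq4[of "u x * \<psi> x" "u 1 * \<psi> 1"] by simp
      finally have "1 \<le> norm (u x) * norm (\<psi> x)" using bound[of x] x X by (simp add: norm_mult)
      then show "1 \<le> q x" using am[of "norm (u x)" "norm (\<psi> x)"] x X by (simp add: q_def)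
    qed
  qed
  then show ?thesis using W[OF x] by simp
qed

text \<open>The derivative of u / \<psi> is (v \<psi> - u \<psi>1) / \<psi>^2, which vanishes by
  \<open>W\<close>. Jost solutions have no zeros because Im (conj(\<psi>) \<psi>1) > 0 for
  them.\<close>

lemma solution_proportional:
  assumes u: "solves_system s w z u v" and \<psi>: "solves_system s w z \<psi> \<psi>1"
    and W: "\<And>x. 0 < x \<Longrightarrow> u x * \<psi>1 x = v x * \<psi> x"
    and nz: "\<And>x. 0 < x \<Longrightarrow> \<psi> x \<noteq> 0"
  obtains C where "\<And>x. 0 < x \<Longrightarrow> u x = C * \<psi> x" "\<And>x. 0 < x \<Longrightarrow> v x = C * \<psi>1 x"
proof -
  obtain N where N: "negligible N" "\<forall>x. 0 < x \<longrightarrow> x \<notin> N \<longrightarrow>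
      (u has_vector_derivative of_real (s x) * u x + v x) (at x) \<and>
      (v has_vector_derivative - of_real (s x) * v x + (of_real (w x) - z) * u x) (at x)"
    using solves_system_negligible[OF u] by (elim exE conjE)
  obtain N' where N': "negligible N'" "\<forall>x. 0 < x \<longrightarrow> x \<notin> N' \<longrightarrow>
      (\<psi> has_vector_derivative of_real (s x) * \<psi> x + \<psi>1 x) (at x) \<and>
      (\<psi>1 has_vector_derivative - of_real (s x) * \<psi>1 x + (of_real (w x) - z) * \<psi> x) (at x)"
    using solves_system_negligible[OF \<psi>] by (elim exE conjE)
  have ac: "u \<in> AC_loc" "\<psi> \<in> AC_loc" using u \<psi> by (auto simp: solves_system_def)
  have const: "u b * inverse (\<psi> b) = u a * inverse (\<psi> a)" if ab: "0 < a" "a \<le> b" for a b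
  proof (rule absolutely_continuous_on_deriv_0[OF _ ab(2)])
    show "absolutely_continuous_on {a..b} (\<lambda>x. u x * inverse (\<psi> x))"
      using nz ab by (intro absolutely_continuous_on_mult absolutely_continuous_on_inverse
          AC_loc_imp_absolutely_continuous_on[OF _ ab(1)] ac) auto
    show "negligible (N \<union> N')" using N(1) N'(1) by (rule negligible_Un)
    fix x assume x: "x \<in> {a<..<b} - (N \<union> N')"
    then have x0: "0 < x" "x \<notin> N" "x \<notin> N'" using ab by auto
    note d = N(2)[rule_format, OF x0(1,2)] N'(2)[rule_format, OF x0(1,3)]
    have inv: "((\<lambda>x. inverse (\<psi> x)) has_vector_derivative
        (of_real (s x) * \<psi> x + \<psi>1 x) * - (inverse (\<psi> x) * inverse (\<psi> x))) (at x)"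
      using field_vector_diff_chain_at[OF d(2)[THEN conjunct1] DERIV_inverse[OF nz[OF x0(1)]]]
      by (simp add: comp_def numeral_2_eq_2)
    have "((\<lambda>x. u x * inverse (\<psi> x)) has_vector_derivative
        u x * ((of_real (s x) * \<psi> x + \<psi>1 x) * - (inverse (\<psi> x) * inverse (\<psi> x))) +
        (of_real (s x) * u x + v x) * inverse (\<psi> x)) (at x)"
      by (intro has_vector_derivative_mult inv d(1)[THEN conjunct1])
    moreover have "u x * ((of_real (s x) * \<psi> x + \<psi>1 x) * - (inverse (\<psi> x) * inverse (\<psi> x))) +
        (of_real (s x) * u x + v x) * inverse (\<psi> x) = 0"
    proof -
      have "u x * ((of_real (s x) * \<psi> x + \<psi>1 x) * - (inverse (\<psi> x) * inverse (\<psi> x))) +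
        (of_real (s x) * u x + v x) * inverse (\<psi> x) = (v x * \<psi> x - u x * \<psi>1 x) * (inverse (\<psi> x) * inverse (\<psi> x))"
        using nz[OF x0(1)] by (simp add: field_simps)
      then show ?thesis using W[OF x0(1)] by simp
    qed
    ultimately show "((\<lambda>x. u x * inverse (\<psi> x)) has_vector_derivative 0) (at x)"
      by (rule has_vector_derivative_eq_rhs)
  qed
  define C where "C = u 1 * inverse (\<psi> 1)"
  have uC: "u x = C * \<psi> x" if "0 < x" for x
  proof -
    have "u x * inverse (\<psi> x) = C"
    proof (cases "x \<le> 1")
      case True
      then show ?thesis unfolding C_def by (rule const[OF that, symmetric])
    next
      case False
      then show ?thesis unfolding C_def by (intro const) auto
    qed
    then show ?thesis using nz[OF that] by (auto simp: field_simps)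
  qed
  show ?thesis
  proof (rule that[of C])
    show "v x = C * \<psi>1 x" if "0 < x" for x
      using W[OF that] uC[OF that] nz[OF that] by simp
  qed (fact uC)
qed

lemma powr_2_eq: "0 \<le> x \<Longrightarrow> x powr 2 = (x::real)\<^sup>2"
  by (cases "x = 0") (auto simp: powr_numeral)

lemma set_integrable_half_line_iff:
  fixes f :: "real \<Rightarrow> 'a::{banach, second_countable_topology}"
  shows "set_integrable lebesgue {0<..} f \<longleftrightarrow> integrable (lebesgue_on {0<..}) f"
  by (simp add: set_integrable_def integrable_restrict_space)

lemma Lq_space_2_iff:
  "f \<in> Lq_space 2 \<longleftrightarrow> f \<in> borel_measurable (lebesgue_on {0<..}) \<and>
     set_integrable lebesgue {0<..} (\<lambda>x. (norm (f x))\<^sup>2)"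
  by (simp add: Lq_space_def powr_2_eq set_integrable_half_line_iff)

lemma set_integrable_exp_decay:
  assumes "(\<kappa>::real) > 0"
  shows "set_integrable lebesgue {0<..} (\<lambda>x. exp (- \<kappa> * x))"
proof -
  have "(\<lambda>x. exp (- \<kappa> * x)) absolutely_integrable_on {0..}"
    by (intro nonnegative_absolutely_integrable_1)
      (use has_integral_exp_minus_to_infinity[OF assms, of 0] in \<open>auto intro: has_integral_integrable\<close>)
  then show ?thesis by (rule set_integrable_subset) auto
qed

lemma decaying_in_Lq_space_2:
  assumes "continuous_on {0<..} f" "\<kappa> > 0" "\<And>x. 0 < x \<Longrightarrow> norm (f x) \<le> M * exp (- \<kappa> * x)"
  shows "f \<in> Lq_space 2"
  unfolding Lq_space_2_iff
proof
  show meas: "f \<in> borel_measurable (lebesgue_on {0<..})"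
    using assms(1) by (intro continuous_imp_measurable_on_sets_lebesgue) auto
  have "set_integrable lebesgue {0<..} (\<lambda>x. M\<^sup>2 * exp (- (2 * \<kappa>) * x))"
    using assms(2) by (intro set_integrable_mult_right set_integrable_exp_decay) auto
  then have int: "integrable (lebesgue_on {0<..}) (\<lambda>x. M\<^sup>2 * exp (- (2 * \<kappa>) * x))"
    by (simp only: set_integrable_half_line_iff)
  have "integrable (lebesgue_on {0<..}) (\<lambda>x. (norm (f x))\<^sup>2)"
  proof (rule Bochner_Integration.integrable_bound[OF int])
    show "(\<lambda>x. (norm (f x))\<^sup>2) \<in> borel_measurable (lebesgue_on {0<..})" using meas by measurable
    have "norm ((norm (f x))\<^sup>2) \<le> norm (M\<^sup>2 * exp (- (2 * \<kappa>) * x))" if "0 < x" for x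
    proof -
      have "(norm (f x))\<^sup>2 \<le> (M * exp (- \<kappa> * x))\<^sup>2" using assms(3)[OF that] by (rule power_mono) simp
      also have "\<dots> = M\<^sup>2 * exp (- (2 * \<kappa>) * x)"
        by (simp add: power_mult_distrib power2_eq_square exp_add[symmetric])
      finally show ?thesis by simp
    qed
    then show "AE x in lebesgue_on {0<..}. norm ((norm (f x))\<^sup>2) \<le> norm (M\<^sup>2 * exp (- (2 * \<kappa>) * x))"
      by (intro AE_I2) (auto simp: space_restrict_space)
  qed
  then show "set_integrable lebesgue {0<..} (\<lambda>x. (norm (f x))\<^sup>2)"
    by (simp only: set_integrable_half_line_iff)
qed

lemma value_at_0_eq:
  assumes "(g \<longlongrightarrow> l) (at_right 0)" "\<And>x. 0 < x \<Longrightarrow> f x = C * g x"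
  shows "value_at_0 f = C * l"
proof -
  have "((\<lambda>x. C * g x) \<longlongrightarrow> C * l) (at_right 0)" using assms(1) by (intro tendsto_intros)
  moreover have "eventually (\<lambda>x. C * g x = f x) (at_right 0)"
    using eventually_at_right_less[of "0::real"] by eventually_elim (simp add: assms(2))
  ultimately have "(f \<longlongrightarrow> C * l) (at_right 0)" by (rule Lim_transform_eventually)
  then show ?thesis unfolding value_at_0_def by (intro tendsto_Lim) auto
qed

text \<open>\<open>weyl_solution\<close> is some choice, and \<psi> shows that there is one to
  choose. The chosen solution has Wronskian 0 with the decaying \<psi>, so it is C \<psi> with C
  nonzero and its quasi-derivative is C \<psi>1; then C cancels in the quotient.\<close>

lemma m_function_eq:
  assumes sys: "solves_system \<sigma> w z \<psi> \<psi>1" and w: "\<And>x. 0 < x \<Longrightarrow> w x = \<tau> x - (\<sigma> x)\<^sup>2"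
    and \<sigma>: "set_integrable lebesgue {0<..} (\<lambda>x. (\<sigma> x)\<^sup>2)"
    and \<kappa>: "\<kappa> > 0" and decay: "\<And>x. 0 < x \<Longrightarrow> norm (\<psi> x) \<le> M * exp (- \<kappa> * x)"
      "\<And>x. 0 < x \<Longrightarrow> norm (\<psi>1 x) \<le> M * exp (- \<kappa> * x)"
    and nz: "\<And>x. 0 < x \<Longrightarrow> \<psi> x \<noteq> 0"
    and lim: "(\<psi> \<longlongrightarrow> p) (at_right 0)" "(\<psi>1 \<longlongrightarrow> q) (at_right 0)"
  shows "m_function \<sigma> \<tau> \<alpha> z = (of_real (cos \<alpha>) * q - of_real (sin \<alpha>) * p) /
      (of_real (sin \<alpha>) * q + of_real (cos \<alpha>) * p)"
proof -
  have cont: "continuous_on {0<..} \<psi>" "continuous_on {0<..} \<psi>1"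
    using sys by (auto simp: solves_system_def intro: AC_loc_imp_continuous_on)
  have L2: "\<psi> \<in> Lq_space 2" "\<psi>1 \<in> Lq_space 2"
    using decaying_in_Lq_space_2[OF cont(1) \<kappa> decay(1)] decaying_in_Lq_space_2[OF cont(2) \<kappa> decay(2)] by auto
  have "is_weyl_solution \<sigma> \<tau> z \<psi>"
    unfolding is_weyl_solution_def
    using L2(1) solves_system_imp_ell_eq[OF sys w] nz[of 1] by (auto intro: exI[of _ 1])
  then have weyl: "is_weyl_solution \<sigma> \<tau> z (weyl_solution \<sigma> \<tau> z)"
    unfolding weyl_solution_def by (rule someI[of "is_weyl_solution \<sigma> \<tau> z"])
  define \<phi> where "\<phi> = weyl_solution \<sigma> \<tau> z"
  have \<phi>: "\<phi> \<in> Lq_space 2" "ell_eq \<sigma> \<tau> \<phi> (\<lambda>x. z * \<phi> x)" "\<exists>x>0. \<phi> x \<noteq> 0"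
    using weyl by (auto simp: \<phi>_def is_weyl_solution_def)
  have sys': "solves_system \<sigma> w z \<phi> (quasi_deriv \<sigma> \<phi>)"
    by (rule ell_eq_imp_solves_system[OF \<phi>(2) w])
  have M: "norm (\<psi> x) \<le> M" if "0 < x" for x
  proof -
    have "M \<ge> 0" using order_trans[OF norm_ge_zero decay(1)[OF that]] by (simp add: zero_le_mult_iff)
    then have "M * exp (- \<kappa> * x) \<le> M * 1" using \<kappa> that by (intro mult_left_mono) auto
    then show ?thesis using decay(1)[OF that] by simp
  qed
  have W: "\<phi> x * \<psi>1 x = quasi_deriv \<sigma> \<phi> x * \<psi> x" if "0 < x" for x
    using \<phi>(1) L2 by (intro wronskian_eq_0[OF sys' sys _ _ _ \<sigma> M that]) (auto simp: Lq_space_2_iff)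
  obtain C where C: "\<And>x. 0 < x \<Longrightarrow> \<phi> x = C * \<psi> x" "\<And>x. 0 < x \<Longrightarrow> quasi_deriv \<sigma> \<phi> x = C * \<psi>1 x"
    using solution_proportional[OF sys' sys W nz] by blast
  have "C \<noteq> 0" using \<phi>(3) C(1) by auto
  have "value_at_0 \<phi> = C * p" "value_at_0 (quasi_deriv \<sigma> \<phi>) = C * q"
    using value_at_0_eq[OF lim(1) C(1)] value_at_0_eq[OF lim(2) C(2)] by auto
  then have "m_function \<sigma> \<tau> \<alpha> z = (of_real (cos \<alpha>) * (C * q) - of_real (sin \<alpha>) * (C * p)) /
      (of_real (sin \<alpha>) * (C * q) + of_real (cos \<alpha>) * (C * p))"
    by (simp add: m_function_def Let_def \<phi>_def)
  also have "\<dots> = (C * (of_real (cos \<alpha>) * q - of_real (sin \<alpha>) * p)) /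
      (C * (of_real (sin \<alpha>) * q + of_real (cos \<alpha>) * p))"
    by (simp add: algebra_simps)
  also have "\<dots> = (of_real (cos \<alpha>) * q - of_real (sin \<alpha>) * p) /
      (of_real (sin \<alpha>) * q + of_real (cos \<alpha>) * p)"
    using \<open>C \<noteq> 0\<close> by simp
  finally show ?thesis .
qed

section \<open>Boundary values of the m-function on the positive half-axis\<close>

lemma solves_system_cong:
  assumes "solves_system s w z u v" "\<And>x. 0 < x \<Longrightarrow> s x = \<sigma> x"
  shows "solves_system \<sigma> w z u v"
proof -
  have "AE x in lebesgue_on {0<..}. (0::real) < x"
    by (rule AE_I2) (auto simp: space_restrict_space)
  moreover have "AE x in lebesgue_on {0<..}.
        (u has_vector_derivative of_real (s x) * u x + v x) (at x) \<and>
        (v has_vector_derivative - of_real (s x) * v x + (of_real (w x) - z) * u x) (at x)"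
    using assms(1) by (auto simp: solves_system_def)
  ultimately have "AE x in lebesgue_on {0<..}.
        (u has_vector_derivative of_real (\<sigma> x) * u x + v x) (at x) \<and>
        (v has_vector_derivative - of_real (\<sigma> x) * v x + (of_real (w x) - z) * u x) (at x)"
    by eventually_elim (simp add: assms(2))
  then show ?thesis using assms(1) by (auto simp: solves_system_def)
qed

text \<open>Numerator and denominator arise from (q, p) by a rotation. It has determinant 1, so the
  imaginary part of the numerator times the conjugate denominator equals Im (conj(p) q). A vanishing
  denominator would make it 0.\<close>

lemma Im_moebius:
  assumes "Im (cnj p * q) > 0"
  shows "of_real (sin \<alpha>) * q + of_real (cos \<alpha>) * p \<noteq> 0"
    and "Im ((of_real (cos \<alpha>) * q - of_real (sin \<alpha>) * p) / (of_real (sin \<alpha>) * q + of_real (cos \<alpha>) * p)) > 0"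
proof -
  let ?n = "of_real (cos \<alpha>) * q - of_real (sin \<alpha>) * p" and ?d = "of_real (sin \<alpha>) * q + of_real (cos \<alpha>) * p"
  have "Im ((of_real x * q - of_real y * p) * cnj (of_real y * q + of_real x * p)) = (x\<^sup>2 + y\<^sup>2) * Im (cnj p * q)"
    for x y :: real
    by (simp add: algebra_simps power2_eq_square)
  from this[of "cos \<alpha>" "sin \<alpha>"] have *: "Im (?n * cnj ?d) > 0" using assms by simp
  show "?d \<noteq> 0"
  proof
    assume "?d = 0"
    with * show False by (simp only: complex_cnj_zero mult_zero_right zero_complex.sel less_irrefl)
  qed
  then show "Im (?n / ?d) > 0"
    using * by (subst complex_div_cnj) (simp only: Im_divide_of_real zero_less_divide_iff, simp)
qed

text \<open>Re (csqrt z) = sqrt ((|z| + Re z) / 2) \<ge> sqrt (Re z). Thus Re z \<ge> c supplies the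
  lower bound sqrt c for Re k that the Jost solutions require.\<close>

lemma csqrt_right_half_plane:
  assumes "c > 0" "c \<le> Re z" "0 \<le> Im z"
  shows "sqrt c \<le> Re (csqrt z)" "0 \<le> Im (csqrt z)"
proof -
  have "Re z \<le> cmod z" by (rule complex_Re_le_cmod)
  then show "sqrt c \<le> Re (csqrt z)" using assms by simp
  show "0 \<le> Im (csqrt z)" using assms \<open>Re z \<le> cmod z\<close> by (simp add: sgn_if)
qed

lemma Im_csqrt_pos:
  assumes "Im z > 0"
  shows "Im (csqrt z) > 0"
proof -
  have "\<bar>Re z\<bar>\<^sup>2 < (cmod z)\<^sup>2" using assms by (simp add: cmod_power2)
  then have "\<bar>Re z\<bar> < cmod z" by (rule power2_less_imp_less) simp
  then show ?thesis using assms by simp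
qed

text \<open>H extends Im m to the whole plane by clamping t at c and \<epsilon> at 0, so that its
  continuity needs no side conditions. The boundary value is H t 0. The comparison with Im m is made
  only for \<epsilon> > 0, where Im k > 0 makes the Jost solution square integrable.\<close>

lemma m_function_boundary_values:
  fixes \<sigma> \<tau> :: "real \<Rightarrow> real"
  assumes \<sigma>: "set_integrable lebesgue {0<..} \<sigma>" "set_integrable lebesgue {0<..} (\<lambda>x. (\<sigma> x)\<^sup>2)"
    and \<tau>: "set_integrable lebesgue {0<..} \<tau>" and c: "c > 0"
  obtains H :: "real \<Rightarrow> real \<Rightarrow> real" where
    "continuous_on UNIV (\<lambda>p. H (fst p) (snd p))"
    "\<And>t \<epsilon>. H t \<epsilon> \<ge> 0"
    "\<And>t \<epsilon>. c \<le> t \<Longrightarrow> 0 < \<epsilon> \<Longrightarrow> Im (m_function \<sigma> \<tau> \<alpha> (Complex t \<epsilon>)) = H t \<epsilon>"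
proof -
  define s where "s x = indicator {0<..} x *\<^sub>R \<sigma> x" for x
  define w where "w x = indicator {0<..} x *\<^sub>R (\<tau> x - (\<sigma> x)\<^sup>2)" for x
  interpret short_range s w "sqrt c"
  proof
    show "integrable lebesgue s" using \<sigma>(1) by (simp add: set_integrable_def s_def[abs_def])
    show "integrable lebesgue w" using set_integral_diff(1)[OF \<tau> \<sigma>(2)] by (simp add: set_integrable_def w_def[abs_def])
  qed (use c in \<open>auto simp: s_def w_def\<close>)
  have sx: "s x = \<sigma> x" and wx: "w x = \<tau> x - (\<sigma> x)\<^sup>2" if "0 < x" for x
    using that by (simp_all add: s_def w_def)
  show ?thesis
  proof (rule jost_family)
    fix U V :: "real \<Rightarrow> complex \<Rightarrow> complex" and C :: real
    assume cont: "continuous_on UNIV (\<lambda>p. U (fst p) (snd p))" "continuous_on UNIV (\<lambda>p. V (fst p) (snd p))"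
      and sys: "\<And>k. sqrt c \<le> Re k \<Longrightarrow> 0 \<le> Im k \<Longrightarrow> solves_system s w (k\<^sup>2) (\<lambda>x. U x k) (\<lambda>x. V x k)"
      and pos: "\<And>x k. sqrt c \<le> Re k \<Longrightarrow> 0 \<le> Im k \<Longrightarrow> Im (cnj (U x k) * V x k) > 0"
      and decay: "\<And>x k. sqrt c \<le> Re k \<Longrightarrow> 0 \<le> Im k \<Longrightarrow> norm (U x k) \<le> C * exp (- Im k * x)"
        "\<And>x k. sqrt c \<le> Re k \<Longrightarrow> 0 \<le> Im k \<Longrightarrow> norm (V x k) \<le> C * exp (- Im k * x)"
    define N where "N k = of_real (cos \<alpha>) * V 0 k - of_real (sin \<alpha>) * U 0 k" for k
    define D where "D k = of_real (sin \<alpha>) * V 0 k + of_real (cos \<alpha>) * U 0 k" for k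
    \<comment> \<open>Clamping keeps the argument at Re \<ge> c > 0, hence away from the branch cut
      of \<open>csqrt\<close>.\<close>
    define k where "k p = csqrt (Complex (max c (fst p)) (max 0 (snd p)))" for p
    have "c \<le> Re (Complex (max c a) (max 0 b))" "0 \<le> Im (Complex (max c a) (max 0 b))" for a b
      by (simp_all only: complex.sel max.cobounded1)
    then have k: "sqrt c \<le> Re (k p)" "0 \<le> Im (k p)" for p
      unfolding k_def using c by (blast intro: csqrt_right_half_plane)+
    have k_cont: "continuous_on UNIV k"
      unfolding k_def
    proof (rule continuous_on_compose2[OF continuous_on_csqrt])
      show "continuous_on UNIV (\<lambda>p. Complex (max c (fst p)) (max 0 (snd p)))"
        unfolding Complex_eq by (intro continuous_intros)
      show "range (\<lambda>p. Complex (max c (fst p)) (max 0 (snd p))) \<subseteq> - \<real>\<^sub>\<le>\<^sub>0"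
        using c by (auto simp: complex_nonpos_Reals_iff)
    qed
    have D_nz: "D (k p) \<noteq> 0" for p
      unfolding D_def by (rule Im_moebius(1)[OF pos[OF k]])
    have k0_cont: "continuous_on UNIV (\<lambda>p. (0::real, k p))"
      using k_cont by (intro continuous_intros)
    have U0: "continuous_on UNIV (\<lambda>p. U 0 (k p))" "continuous_on UNIV (\<lambda>p. V 0 (k p))"
      using continuous_on_compose2[OF cont(1) k0_cont] continuous_on_compose2[OF cont(2) k0_cont] by simp_all
    define H where "H t \<epsilon> = Im (N (k (t, \<epsilon>)) / D (k (t, \<epsilon>)))" for t \<epsilon>
    show thesis
    proof (rule that[of H])
      have "continuous_on UNIV (\<lambda>p. Im (N (k p) / D (k p)))"
        using D_nz unfolding N_def D_def by (intro continuous_intros U0) auto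
      then show "continuous_on UNIV (\<lambda>p. H (fst p) (snd p))" by (simp add: H_def)
      show "H t \<epsilon> \<ge> 0" for t \<epsilon>
        unfolding H_def N_def D_def by (rule less_imp_le[OF Im_moebius(2)[OF pos[OF k]]])
      fix t \<epsilon> :: real assume t: "c \<le> t" and \<epsilon>: "0 < \<epsilon>"
      let ?k = "k (t, \<epsilon>)"
      have kt: "?k = csqrt (Complex t \<epsilon>)" using t \<epsilon> by (simp add: k_def max_def)
      \<comment> \<open>Continuity across x = 0 identifies the limits from the right with the values
        at 0.\<close>
      have lim: "((\<lambda>x. U x ?k) \<longlongrightarrow> U 0 ?k) (at_right 0)" "((\<lambda>x. V x ?k) \<longlongrightarrow> V 0 ?k) (at_right 0)"
      proof -
        have "continuous_on UNIV (\<lambda>x::real. (x, ?k))" by (intro continuous_intros)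
        from continuous_on_compose2[OF cont(1) this] continuous_on_compose2[OF cont(2) this]
        have "continuous_on UNIV (\<lambda>x. U x ?k)" "continuous_on UNIV (\<lambda>x. V x ?k)" by simp_all
        then have "((\<lambda>x. U x ?k) \<longlongrightarrow> U 0 ?k) (at 0)" "((\<lambda>x. V x ?k) \<longlongrightarrow> V 0 ?k) (at 0)"
          by (auto simp: continuous_on_def)
        then show "((\<lambda>x. U x ?k) \<longlongrightarrow> U 0 ?k) (at_right 0)" "((\<lambda>x. V x ?k) \<longlongrightarrow> V 0 ?k) (at_right 0)"
          by (auto intro: tendsto_within_subset)
      qed
      have nz: "U x ?k \<noteq> 0" for x
        using pos[OF k(1)[of "(t, \<epsilon>)"] k(2)[of "(t, \<epsilon>)"], of x] by auto
      have "m_function \<sigma> \<tau> \<alpha> (?k\<^sup>2) = N ?k / D ?k"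
        unfolding N_def D_def
      proof (rule m_function_eq[OF solves_system_cong[OF sys[OF k] sx] wx \<sigma>(2) _ decay(1)[OF k] decay(2)[OF k] nz lim])
        show "0 < Im ?k" unfolding kt using \<epsilon> by (intro Im_csqrt_pos) simp
      qed
      then show "Im (m_function \<sigma> \<tau> \<alpha> (Complex t \<epsilon>)) = H t \<epsilon>" by (simp add: H_def kt)
    qed
  qed
qed

subsection \<open>The spectral measure\<close>

text \<open>Continuity of H up to \<epsilon> = 0 turns the inner limit into continuity of a
  parameter integral over a compact interval, and the outer limit into continuity of the indefinite
  integral of the boundary function.\<close>

lemma stieltjes_inversion_continuous:
  fixes H :: "real \<Rightarrow> real \<Rightarrow> real"
  assumes H: "continuous_on UNIV (\<lambda>p. H (fst p) (snd p))"
    and eq: "\<And>t \<epsilon>. c \<le> t \<Longrightarrow> 0 < \<epsilon> \<Longrightarrow> Im (m (Complex t \<epsilon>)) = H t \<epsilon>"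
    and ab: "c \<le> a" "a < b"
  shows "stieltjes_inversion m a b = 1 / pi * integral {a..b} (\<lambda>t. H t 0)"
proof -
  have H1: "continuous_on A (\<lambda>t. H t \<epsilon>)" for A \<epsilon>
    using continuous_on_compose2[OF H, of A "\<lambda>t. (t, \<epsilon>)"] by (simp add: continuous_on_Pair)
  have inner: "Lim (at_right 0) (\<lambda>\<epsilon>. 1 / pi * (LBINT t:{A..B}. Im (m (Complex t \<epsilon>))))
      = 1 / pi * integral {A..B} (\<lambda>t. H t 0)" if "c \<le> A" for A B
  proof (rule tendsto_Lim)
    have "continuous_on (UNIV \<times> cbox A B) (\<lambda>(\<epsilon>, t). H t \<epsilon>)"
      unfolding split_beta
      using continuous_on_compose2[OF H, of "UNIV \<times> cbox A B" "\<lambda>q. (snd q, fst q)"]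
      by (simp add: continuous_on_Pair continuous_on_fst continuous_on_snd continuous_on_id)
    then have "continuous_on UNIV (\<lambda>\<epsilon>. integral (cbox A B) (\<lambda>t. H t \<epsilon>))"
      by (rule integral_continuous_on_param)
    then have "((\<lambda>\<epsilon>. integral {A..B} (\<lambda>t. H t \<epsilon>)) \<longlongrightarrow> integral {A..B} (\<lambda>t. H t 0)) (at 0)"
      by (simp add: continuous_on_def)
    then have "((\<lambda>\<epsilon>. 1 / pi * integral {A..B} (\<lambda>t. H t \<epsilon>)) \<longlongrightarrow> 1 / pi * integral {A..B} (\<lambda>t. H t 0)) (at_right 0)"
      by (intro tendsto_mult tendsto_const) (auto intro: tendsto_within_subset)
    moreover have "eventually (\<lambda>\<epsilon>. 1 / pi * integral {A..B} (\<lambda>t. H t \<epsilon>)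
        = 1 / pi * (LBINT t:{A..B}. Im (m (Complex t \<epsilon>)))) (at_right 0)"
      using eventually_at_right_less[of "0::real"]
    proof eventually_elim
      fix \<epsilon> :: real assume "0 < \<epsilon>"
      have "(LBINT t:{A..B}. Im (m (Complex t \<epsilon>))) = (LBINT t:{A..B}. H t \<epsilon>)"
        unfolding set_lebesgue_integral_def
        by (intro Bochner_Integration.integral_cong refl)
          (use that \<open>0 < \<epsilon>\<close> in \<open>auto simp: indicator_def eq\<close>)
      also have "\<dots> = integral {A..B} (\<lambda>t. H t \<epsilon>)"
        by (intro set_borel_integral_eq_integral(2) borel_integrable_atLeastAtMost' H1)
      finally show "1 / pi * integral {A..B} (\<lambda>t. H t \<epsilon>)
        = 1 / pi * (LBINT t:{A..B}. Im (m (Complex t \<epsilon>)))" by simp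
    qed
    ultimately show "((\<lambda>\<epsilon>. 1 / pi * (LBINT t:{A..B}. Im (m (Complex t \<epsilon>)))) \<longlongrightarrow>
        1 / pi * integral {A..B} (\<lambda>t. H t 0)) (at_right 0)"
      by (rule Lim_transform_eventually)
  qed simp
  define J where "J x = integral {a..x} (\<lambda>t. H t 0)" for x
  have J: "integral {x..y} (\<lambda>t. H t 0) = J y - J x" if "a \<le> x" "x \<le> y" for x y
  proof -
    have "integral {a..x} (\<lambda>t. H t 0) + integral {x..y} (\<lambda>t. H t 0) = integral {a..y} (\<lambda>t. H t 0)"
      using that by (intro Henstock_Kurzweil_Integration.integral_combine integrable_continuous_real H1) auto
    then show ?thesis by (simp add: J_def)
  qed
  \<comment> \<open>One unit of room on the right keeps b + \<delta> in the interval for \<delta>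
    \<le> 1.\<close>
  have Jc: "continuous_on {a..b + 1} J"
    unfolding J_def by (intro indefinite_integral_continuous_1 integrable_continuous_real H1)
  have "continuous_on {0..1} (\<lambda>\<delta>. 1 / pi * (J (b + \<delta>) - J (a + \<delta>)))"
    using ab by (intro continuous_intros continuous_on_compose2[OF Jc]) auto
  then have "((\<lambda>\<delta>. 1 / pi * (J (b + \<delta>) - J (a + \<delta>))) \<longlongrightarrow> 1 / pi * (J (b + 0) - J (a + 0))) (at 0 within {0..1})"
    unfolding continuous_on_def by (rule bspec) simp
  then have "((\<lambda>\<delta>. 1 / pi * (J (b + \<delta>) - J (a + \<delta>))) \<longlongrightarrow> 1 / pi * (J b - J a)) (at_right 0)"
    by (simp add: at_within_Icc_at_right)
  moreover have "eventually (\<lambda>\<delta>. 1 / pi * (J (b + \<delta>) - J (a + \<delta>)) =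
      Lim (at_right 0) (\<lambda>\<epsilon>. 1 / pi * (LBINT t:{a + \<delta>..b + \<delta>}. Im (m (Complex t \<epsilon>))))) (at_right 0)"
    using eventually_at_right_less[of "0::real"]
  proof eventually_elim
    fix \<delta> :: real assume "0 < \<delta>"
    then have "c \<le> a + \<delta>" "a \<le> a + \<delta>" "a + \<delta> \<le> b + \<delta>" using ab by auto
    then show "1 / pi * (J (b + \<delta>) - J (a + \<delta>)) =
        Lim (at_right 0) (\<lambda>\<epsilon>. 1 / pi * (LBINT t:{a + \<delta>..b + \<delta>}. Im (m (Complex t \<epsilon>))))"
      by (simp only: inner J)
  qed
  ultimately have "((\<lambda>\<delta>. Lim (at_right 0) (\<lambda>\<epsilon>. 1 / pi * (LBINT t:{a + \<delta>..b + \<delta>}. Im (m (Complex t \<epsilon>))))) \<longlongrightarrow>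
      1 / pi * (J b - J a)) (at_right 0)"
    by (rule Lim_transform_eventually)
  then have "stieltjes_inversion m a b = 1 / pi * (J b - J a)"
    unfolding stieltjes_inversion_def by (intro tendsto_Lim) auto
  then show ?thesis using J[of a b] ab by simp
qed

text \<open>The spectral measure is indexed by pairs with a < b; admitting a \<ge> b adds only the
  empty set to the generator.\<close>

lemma sigma_sets_half_open: "sigma_sets UNIV ((\<lambda>(a, b). {a<..b}) ` {(a, b). a < b}) = sets (borel :: real measure)"
proof -
  have "sigma_sets UNIV (range (\<lambda>(a, b). {a<..b::real})) = sigma_sets UNIV ((\<lambda>(a, b). {a<..b}) ` {(a, b). a < b})"
  proof (rule sigma_sets_eqI)
    fix A assume "A \<in> range (\<lambda>(a, b). {a<..b::real})"
    then obtain a b where A: "A = {a<..b}" by auto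
    show "A \<in> sigma_sets UNIV ((\<lambda>(a, b). {a<..b}) ` {(a, b). a < b})"
    proof (cases "a < b")
      case True
      then show ?thesis unfolding A by (intro sigma_sets.Basic) auto
    next
      case False
      then have "A = {}" unfolding A by simp
      then show ?thesis by (simp add: sigma_sets.Empty)
    qed
  next
    fix A assume "A \<in> (\<lambda>(a, b). {a<..b::real}) ` {(a, b). a < b}"
    then show "A \<in> sigma_sets UNIV (range (\<lambda>(a, b). {a<..b::real}))" by (intro sigma_sets.Basic) auto
  qed
  then show ?thesis by (simp add: borel_sigma_sets_Ioc)
qed

lemma emeasure_density_Ioc:
  fixes g :: "real \<Rightarrow> real"
  assumes g: "continuous_on UNIV g" "\<And>x. g x \<ge> 0"
  shows "(\<integral>\<^sup>+x. ennreal (g x) * indicator {a<..b} x \<partial>lborel) = ennreal (integral {a..b} g)"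
proof -
  have "(\<integral>\<^sup>+x. ennreal (g x) * indicator {a<..b} x \<partial>lborel) = (\<integral>\<^sup>+x. ennreal (indicator {a..b} x *\<^sub>R g x) \<partial>lborel)"
  proof (rule nn_integral_cong_AE)
    have "AE x in lborel. x \<noteq> a" by (rule AE_lborel_singleton)
    then show "AE x in lborel. ennreal (g x) * indicator {a<..b} x = ennreal (indicator {a..b} x *\<^sub>R g x)"
      by eventually_elim (auto simp: indicator_def)
  qed
  also have int: "set_integrable lborel {a..b} g"
    by (intro borel_integrable_atLeastAtMost' continuous_on_subset[OF g(1)]) auto
  then have "(\<integral>\<^sup>+x. ennreal (indicator {a..b} x *\<^sub>R g x) \<partial>lborel) = ennreal (LBINT x:{a..b}. g x)"
    unfolding set_integrable_def set_lebesgue_integral_def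
    using g(2) by (intro nn_integral_eq_integral) (auto simp: indicator_def)
  also have "(LBINT x:{a..b}. g x) = integral {a..b} g"
    using int by (rule set_borel_integral_eq_integral(2))
  finally show ?thesis .
qed

text \<open>
  Only the case in which the half-open intervals determine a measure matters; otherwise the measure
  is \<open>0\<close>.
\<close>

lemma absolutely_continuous_extend_measure:
  fixes F :: "real \<Rightarrow> real \<Rightarrow> real"
  defines "N \<equiv> extend_measure UNIV {(a, b). a < b} (\<lambda>(a, b). {a<..b}) (\<lambda>(a, b). ennreal (F a b))"
  assumes F: "\<And>c. c > 0 \<Longrightarrow> \<exists>g. continuous_on UNIV g \<and> (\<forall>x. g x \<ge> 0) \<and>
     (\<forall>a b. c \<le> a \<longrightarrow> a < b \<longrightarrow> F a b = integral {a..b} g)"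
  shows "absolutely_continuous (restrict_space lborel {0<..}) (restrict_space N {0<..})"
proof -
  have sets_N: "sets N = sets borel"
    unfolding N_def by (subst sets_extend_measure) (auto simp: sigma_sets_half_open)
  have null: "emeasure N A = 0" if A: "A \<subseteq> {0<..}" "A \<in> null_sets lborel" for A
  proof (cases "\<exists>\<mu>'. (\<forall>i\<in>{(a, b). a < b}. \<mu>' ((\<lambda>(a, b). {a<..b}) i) = (\<lambda>(a, b). ennreal (F a b)) i) \<and>
      measure_space UNIV (sigma_sets UNIV ((\<lambda>(a, b). {a<..b}) ` {(a, b). a < b})) \<mu>'")
    case False
    then have "N = sigma UNIV ((\<lambda>(a, b). {a<..b}) ` {(a, b). a < b})"
      unfolding N_def extend_measure_def by (simp only: simp_thms if_False)
    then show ?thesis by (simp add: emeasure_sigma)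
  next
    case True
    then obtain \<mu>' where \<mu>': "\<And>i. i \<in> {(a, b). a < b} \<Longrightarrow> \<mu>' ((\<lambda>(a, b). {a<..b}) i) = (\<lambda>(a, b). ennreal (F a b)) i"
      and ms: "measure_space UNIV (sigma_sets UNIV ((\<lambda>(a, b). {a<..b}) ` {(a, b). a < b})) \<mu>'"
      by blast
    have N_Ioc: "emeasure N {a<..b} = ennreal (F a b)" if "a < b" for a b
    proof -
      have "emeasure N ((\<lambda>(a, b). {a<..b}) (a, b)) = (\<lambda>(a, b). ennreal (F a b)) (a, b)"
        by (rule emeasure_extend_measure[OF N_def[THEN meta_eq_to_obj_eq] \<mu>'])
          (use ms that in \<open>auto simp: measure_space_def sets_N sigma_sets_half_open\<close>)
      then show ?thesis by simp
    qed
    \<comment> \<open>The density g depends on c, so N is compared with it only on (c,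
      \<infinity>).\<close>
    have null: "emeasure N (A \<inter> {c<..}) = 0" if "c > 0" for c
    proof -
      obtain g where g: "continuous_on UNIV g" "\<And>x. g x \<ge> 0"
        and Fg: "\<And>a b. c \<le> a \<Longrightarrow> a < b \<Longrightarrow> F a b = integral {a..b} g"
        using F[OF \<open>c > 0\<close>] by blast
      have [measurable]: "g \<in> borel_measurable borel" using g(1) by (rule borel_measurable_continuous_onI)
      define M1 where "M1 = density lborel (\<lambda>x. ennreal (g x) * indicator {c<..} x)"
      define M2 where "M2 = density N (indicator {c<..})"
      have M1: "emeasure M1 X = (\<integral>\<^sup>+x. ennreal (g x) * indicator (X \<inter> {c<..}) x \<partial>lborel)" if "X \<in> sets borel" for X
        unfolding M1_def using that
        by (subst emeasure_density) (auto intro!: nn_integral_cong simp: indicator_def)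
      have M2: "emeasure M2 X = emeasure N (X \<inter> {c<..})" if "X \<in> sets borel" for X
      proof -
        have "emeasure M2 X = (\<integral>\<^sup>+x. indicator {c<..} x * indicator X x \<partial>N)"
          unfolding M2_def using that sets_N by (intro emeasure_density) auto
        also have "\<dots> = (\<integral>\<^sup>+x. indicator (X \<inter> {c<..}) x \<partial>N)"
          by (intro nn_integral_cong) (auto simp: indicator_def)
        also have "\<dots> = emeasure N (X \<inter> {c<..})" using that sets_N by (intro nn_integral_indicator) auto
        finally show ?thesis .
      qed
      have "M1 = M2"
      proof (rule measure_eqI_generator_eq)
        let ?E = "range (\<lambda>(a, b). {a<..b::real})"
        show "Int_stable ?E"
        proof (rule Int_stableI)
          fix X Y assume "X \<in> ?E" "Y \<in> ?E"
          then obtain a b a' b' where "X = {a<..b}" "Y = {a'<..b'}" by auto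
          then have "X \<inter> Y = {max a a'<..min b b'}" by auto
          then show "X \<inter> Y \<in> ?E" by auto
        qed
        show "emeasure M1 X = emeasure M2 X" if "X \<in> ?E" for X
        proof -
          from that obtain a b where X: "X = {a<..b}" by auto
          \<comment> \<open>The part of a half-open interval inside (c, \<infinity>) is again
            half-open, with left end at least c, where F is given by g.\<close>
          have Xc: "X \<inter> {c<..} = {max a c<..b}" unfolding X by auto
          show ?thesis
          proof (cases "max a c < b")
            case True
            have "emeasure M1 X = ennreal (integral {max a c..b} g)"
              using emeasure_density_Ioc[OF g] by (subst M1) (auto simp: X Xc[unfolded X])
            also have "\<dots> = emeasure M2 X"
              using True by (subst M2) (auto simp: X Xc[unfolded X] N_Ioc Fg)
            finally show ?thesis .
          next
            case False
            then have "X \<inter> {c<..} = {}" unfolding Xc by auto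
            then show ?thesis by (subst M1, simp add: X, subst M2) (simp_all add: X)
          qed
        qed
        show "sets M1 = sigma_sets UNIV ?E" by (simp add: M1_def borel_sigma_sets_Ioc)
        show "sets M2 = sigma_sets UNIV ?E" by (simp add: M2_def sets_N borel_sigma_sets_Ioc)
        show "range (\<lambda>n::nat. {- real n<..real n}) \<subseteq> ?E" by auto
        show "(\<Union>n::nat. {- real n<..real n}) = UNIV"
        proof (intro set_eqI iffI UNIV_I)
          fix x :: real
          obtain n :: nat where "\<bar>x\<bar> < real n" using reals_Archimedean2 by blast
          then show "x \<in> (\<Union>n::nat. {- real n<..real n})" by (auto intro!: exI[of _ n])
        qed
        fix n :: nat
        have "{- real n<..real n} \<inter> {c<..} = {max (- real n) c<..real n}" by auto
        then show "emeasure M1 {- real n<..real n} \<noteq> \<infinity>"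
          using emeasure_density_Ioc[OF g] by (subst M1) auto
      qed auto
      have Ab: "A \<in> sets borel" using A(2) by (auto simp: null_sets_def)
      have "AE x in lborel. x \<notin> A" using A(2) by (rule AE_not_in)
      then have "emeasure M1 A = (\<integral>\<^sup>+x. 0 \<partial>(lborel :: real measure))"
        unfolding M1[OF Ab] by (intro nn_integral_cong_AE) (auto elim!: eventually_mono)
      then show ?thesis using M2[OF Ab] \<open>M1 = M2\<close> by simp
    qed
    have Ab: "A \<in> sets borel" using A(2) by (auto simp: null_sets_def)
    \<comment> \<open>Every positive number exceeds some 1 / (n + 1), so A is a countable union of
      pieces, each of which is null by its own density.\<close>
    have "A = (\<Union>n. A \<inter> {1 / real (Suc n)<..})"
    proof (intro set_eqI iffI)
      fix x assume "x \<in> A"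
      then have "0 < x" using A(1) by auto
      then obtain n where "1 / real (Suc n) < x" using nat_approx_posE by blast
      then show "x \<in> (\<Union>n. A \<inter> {1 / real (Suc n)<..})" using \<open>x \<in> A\<close> by auto
    qed auto
    moreover have "(\<Union>n. A \<inter> {1 / real (Suc n)<..}) \<in> null_sets N"
      by (intro null_sets_UN null_setsI null) (use Ab sets_N in auto)
    ultimately show ?thesis by auto
  qed
  show ?thesis
    unfolding absolutely_continuous_def
  proof (rule subsetI)
    fix A :: "real set" assume "A \<in> null_sets (restrict_space lborel {0<..})"
    then have A: "A \<subseteq> {0<..}" "A \<in> null_sets lborel"
      using null_sets_restrict_space[of "{0<..}" "lborel :: real measure" A] by auto
    then have "A \<in> sets N" using sets_N by (auto simp: null_sets_def)
    then have "A \<in> null_sets N" by (rule null_setsI[OF null[OF A]])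
    then show "A \<in> null_sets (restrict_space N {0<..})"
      using A(1) sets_N by (subst null_sets_restrict_space) auto
  qed
qed

section \<open>Amalgam spaces and integrability of the coefficients\<close>

lemma chop_sum:
  assumes "0 < x"
  shows "(\<lambda>n. norm (chop n f x) powr p) sums (norm (f x) powr p)"
proof -
  let ?n = "nat \<lfloor>x\<rfloor>"
  have "chop n f x = 0" if "n \<noteq> ?n" for n
  proof -
    have "x \<notin> {real n..<real n + 1}"
    proof
      assume "x \<in> {real n..<real n + 1}"
      then have "\<lfloor>x\<rfloor> = int n" by (intro floor_unique) auto
      with that show False by simp
    qed
    then show ?thesis by (simp add: chop_def)
  qed
  then have "(\<lambda>n. norm (chop n f x) powr p) sums (\<Sum>n\<in>{?n}. norm (chop n f x) powr p)"
    by (intro sums_finite) auto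
  moreover have "chop ?n f x = f x"
    using assms by (simp add: chop_def)
  ultimately show ?thesis by simp
qed

text \<open>At each x > 0 only the piece containing x is nonzero, so the function is the sum of its
  pieces and may be integrated term by term. The majorant b allows the pieces to be estimated before
  they are summed.\<close>

lemma integrable_chop_sum:
  fixes f :: "real \<Rightarrow> complex"
  assumes int: "\<And>n. integrable (lebesgue_on {0<..}) (\<lambda>x. norm (chop n f x) powr p)"
    and le: "\<And>n. (\<integral>x. norm (chop n f x) powr p \<partial>lebesgue_on {0<..}) \<le> b n" and b: "summable b"
  shows "set_integrable lebesgue {0<..} (\<lambda>x. norm (f x) powr p)"
proof -
  have pos: "AE x in lebesgue_on {0<..}. (0::real) < x"
    by (rule AE_I2) (auto simp: space_restrict_space)
  have "integrable (lebesgue_on {0<..}) (\<lambda>x. \<Sum>n. norm (chop n f x) powr p)"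
  proof (rule integrable_suminf[OF int])
    show "AE x in lebesgue_on {0<..}. summable (\<lambda>n. norm (norm (chop n f x) powr p))"
      using pos by eventually_elim (use chop_sum in \<open>auto intro: sums_summable\<close>)
    show "summable (\<lambda>n. \<integral>x. norm (norm (chop n f x) powr p) \<partial>lebesgue_on {0<..})"
      using le by (intro summable_comparison_test'[OF b, of 0]) (auto intro!: integral_nonneg_AE)
  qed
  moreover have "integrable (lebesgue_on {0<..}) (\<lambda>x. \<Sum>n. norm (chop n f x) powr p) \<longleftrightarrow>
      integrable (lebesgue_on {0<..}) (\<lambda>x. norm (f x) powr p)"
    by (intro Bochner_Integration.integrable_cong refl)
      (auto simp: space_restrict_space intro!: sums_unique[symmetric] chop_sum)
  ultimately show ?thesis by (simp add: set_integrable_half_line_iff)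
qed

lemma amalgam_1_1_integrable:
  assumes "f \<in> amalgam 1 1"
  shows "set_integrable lebesgue {0<..} (\<lambda>x. norm (f x))"
proof -
  have "set_integrable lebesgue {0<..} (\<lambda>x. norm (f x) powr 1)"
  proof (rule integrable_chop_sum)
    show "integrable (lebesgue_on {0<..}) (\<lambda>x. norm (chop n f x) powr 1)" for n
      using assms by (auto simp: amalgam_def Lq_space_def)
    show "summable (\<lambda>n. Lq_norm 1 (chop n f) powr 1)" using assms by (auto simp: amalgam_def)
    show "(\<integral>x. norm (chop n f x) powr 1 \<partial>lebesgue_on {0<..}) \<le> Lq_norm 1 (chop n f) powr 1" for n
      by (simp add: Lq_norm_def)
  qed
  then show ?thesis by simp
qed

text \<open>Let a n be the L^2 norm of f on the n-th cell. The sequence is summable, hence bounded,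
  so its squares are summable as well, which gives L^2. On a cell of length 1 the L^2 norm controls
  the L^1 norm; this Cauchy-Schwarz bound is used in the pointwise form 2 h y \<le> h^2 +
  y^2.\<close>

lemma amalgam_1_2_integrable:
  assumes f: "f \<in> amalgam 1 2"
  shows "set_integrable lebesgue {0<..} (\<lambda>x. norm (f x))" (is ?one)
    and "set_integrable lebesgue {0<..} (\<lambda>x. (norm (f x))\<^sup>2)" (is ?two)
proof -
  let ?L = "lebesgue_on {0<..} :: real measure"
  define I where "I n = (\<integral>x. norm (chop n f x) powr 2 \<partial>?L)" for n
  define a where "a n = Lq_norm 2 (chop n f)" for n
  have int: "integrable ?L (\<lambda>x. norm (chop n f x) powr 2)" and meas: "chop n f \<in> borel_measurable ?L" for n
    using f by (auto simp: amalgam_def Lq_space_def)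
  have I: "I n \<ge> 0" for n unfolding I_def by (intro integral_nonneg_AE) auto
  have "a n = I n powr (1 / 2)" for n by (simp only: a_def Lq_norm_def I_def)
  then have a: "a n \<ge> 0" "(a n)\<^sup>2 = I n" for n
    using I[of n] by (simp_all add: powr_half_sqrt)
  have "summable (\<lambda>n. a n powr 1)" using f by (auto simp: amalgam_def a_def)
  then have sum_a: "summable a" using a(1) by simp
  have "a \<longlonglongrightarrow> 0" by (rule summable_LIMSEQ_zero[OF sum_a])
  then have "Bseq a" by (rule convergent_imp_Bseq[OF convergentI])
  then obtain B where B: "B > 0" "\<And>n. norm (a n) \<le> B" by (auto elim: BseqE)
  have "set_integrable lebesgue {0<..} (\<lambda>x. norm (f x) powr 2)"
  proof (rule integrable_chop_sum[OF int])
    show "summable (\<lambda>n. B * a n)" using sum_a by (rule summable_mult)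
    show "(\<integral>x. norm (chop n f x) powr 2 \<partial>?L) \<le> B * a n" for n
      using a[of n] B(2)[of n] mult_right_mono[of "a n" B "a n"] by (simp add: I_def power2_eq_square)
  qed
  then show ?two by (simp add: powr_2_eq)
  \<comment> \<open>The term (1 / 2)^n keeps h summable and makes it positive: a n may vanish, and h
    n occurs as a divisor.\<close>
  define h where "h n = a n + (1 / 2) ^ n" for n
  have h: "h n > 0" for n using a(1)[of n] by (simp add: h_def add_nonneg_pos)
  have dom: "norm (chop n f x) powr 1 \<le> h n / 2 * indicator {real n..<real n + 1} x + norm (chop n f x) powr 2 / (2 * h n)" for n x
  proof (cases "x \<in> {real n..<real n + 1}")
    case True
    let ?y = "norm (chop n f x)"
    have "0 \<le> (?y - h n)\<^sup>2" by simp
    then have "2 * h n * ?y \<le> (h n)\<^sup>2 + ?y\<^sup>2" by (simp add: power2_eq_square algebra_simps)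
    then have "?y \<le> ((h n)\<^sup>2 + ?y\<^sup>2) / (2 * h n)" using h[of n] by (simp add: field_simps)
    also have "\<dots> = h n / 2 + ?y\<^sup>2 / (2 * h n)" using h[of n] by (simp add: field_simps power2_eq_square)
    finally show ?thesis using True by (simp add: powr_2_eq)
  next
    case False
    then show ?thesis by (simp add: chop_def)
  qed
  have ind: "integrable ?L (indicator {real n..<real n + 1} :: real \<Rightarrow> real)"
    "(\<integral>x. indicator {real n..<real n + 1} x \<partial>?L) \<le> (1::real)" for n
  proof -
    have i: "integrable lebesgue (indicator {real n..<real n + 1} :: real \<Rightarrow> real)"
      by (intro integrable_real_indicator) auto
    have i': "integrable lebesgue (\<lambda>x. indicator {0<..} x *\<^sub>R indicator {real n..<real n + 1} x :: real)"
      using i by (rule integrable_mult_indicator[rotated]) simp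
    then show "integrable ?L (indicator {real n..<real n + 1} :: real \<Rightarrow> real)"
      by (subst integrable_restrict_space) simp_all
    have "(\<integral>x. indicator {real n..<real n + 1} x \<partial>?L)
        = (LINT x|lebesgue. indicator {0<..} x *\<^sub>R indicator {real n..<real n + 1} x :: real)"
      by (subst integral_restrict_space) simp_all
    also have "\<dots> \<le> (LINT x|lebesgue. indicator {real n..<real n + 1} x)"
      by (rule integral_mono[OF i' i]) (simp add: indicator_def)
    also have "\<dots> = 1" by simp
    finally show "(\<integral>x. indicator {real n..<real n + 1} x \<partial>?L) \<le> (1::real)" .
  qed
  have rhs: "integrable ?L (\<lambda>x. h n / 2 * indicator {real n..<real n + 1} x + norm (chop n f x) powr 2 / (2 * h n))" for n
    using ind int by (intro Bochner_Integration.integrable_add integrable_mult_right integrable_divide) auto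
  have int1: "integrable ?L (\<lambda>x. norm (chop n f x) powr 1)" for n
  proof (rule Bochner_Integration.integrable_bound[OF rhs])
    show "(\<lambda>x. norm (chop n f x) powr 1) \<in> borel_measurable ?L" using meas[of n] by simp
    have "norm (norm (chop n f x) powr 1) \<le> norm (h n / 2 * indicator {real n..<real n + 1} x + norm (chop n f x) powr 2 / (2 * h n))" for x
      unfolding real_norm_def abs_of_nonneg[OF powr_ge_zero] by (rule order_trans[OF dom abs_ge_self])
    then show "AE x in ?L. norm (norm (chop n f x) powr 1)
        \<le> norm (h n / 2 * indicator {real n..<real n + 1} x + norm (chop n f x) powr 2 / (2 * h n))"
      by (rule AE_I2)
  qed
  have "set_integrable lebesgue {0<..} (\<lambda>x. norm (f x) powr 1)"
  proof (rule integrable_chop_sum[OF int1])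
    show "summable h" unfolding h_def using sum_a by (intro summable_add) auto
    fix n
    have "(\<integral>x. norm (chop n f x) powr 1 \<partial>?L) \<le> (\<integral>x. h n / 2 * indicator {real n..<real n + 1} x + norm (chop n f x) powr 2 / (2 * h n) \<partial>?L)"
      by (intro integral_mono int1 rhs dom)
    also have "\<dots> = h n / 2 * (\<integral>x. indicator {real n..<real n + 1} x \<partial>?L) + I n / (2 * h n)"
      unfolding I_def using ind int
      by (subst Bochner_Integration.integral_add) auto
    \<comment> \<open>Since I n = (a n)^2 \<le> (h n)^2, each of the two summands contributes at
      most h n / 2.\<close>
    also have "\<dots> \<le> h n / 2 * 1 + (h n)\<^sup>2 / (2 * h n)"
    proof (intro add_mono mult_left_mono divide_right_mono ind(2))
      have "(a n)\<^sup>2 \<le> (h n)\<^sup>2" using a(1)[of n] by (intro power_mono) (auto simp: h_def)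
      then show "I n \<le> (h n)\<^sup>2" using a(2) by simp
    qed (use h[of n] in auto)
    also have "\<dots> = h n" using h[of n] by (simp add: power2_eq_square)
    finally show "(\<integral>x. norm (chop n f x) powr 1 \<partial>?L) \<le> h n" .
  qed
  then show ?one by simp
qed

lemma set_integrable_norm_iff_real:
  fixes f :: "real \<Rightarrow> real"
  assumes "f \<in> borel_measurable (lebesgue_on {0<..})" "set_integrable lebesgue {0<..} (\<lambda>x. norm (complex_of_real (f x)))"
  shows "set_integrable lebesgue {0<..} f"
  unfolding set_integrable_half_line_iff
  by (rule Bochner_Integration.integrable_bound[OF assms(2)[unfolded set_integrable_half_line_iff] assms(1)]) simp

theorem theorem1p9:
  fixes \<sigma> \<tau> :: "real \<Rightarrow> real"
  assumes "\<sigma> \<in> borel_measurable (lebesgue_on {0<..})"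
    and "\<tau> \<in> borel_measurable (lebesgue_on {0<..})"
    and "(SUP y\<in>{0<..}. \<integral>\<^sup>+t\<in>{y..y + 1}. ennreal ((\<sigma> t)\<^sup>2) \<partial>lebesgue) < \<infinity>"
    and "(SUP y\<in>{0<..}. \<integral>\<^sup>+t\<in>{y..y + 1}. ennreal \<bar>\<tau> t\<bar> \<partial>lebesgue) < \<infinity>"
    and "(\<lambda>x. complex_of_real (\<sigma> x)) \<in> amalgam 1 2"
    and "(\<lambda>x. complex_of_real (\<tau> x)) \<in> amalgam 1 1"
  shows "\<forall>\<alpha>\<in>{0..<pi}. purely_ac_spectrum_on \<sigma> \<tau> \<alpha> {0<..}"
proof
  fix \<alpha> :: real assume "\<alpha> \<in> {0..<pi}"
  have \<sigma>: "set_integrable lebesgue {0<..} \<sigma>"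
    by (rule set_integrable_norm_iff_real[OF assms(1) amalgam_1_2_integrable(1)[OF assms(5)]])
  have \<sigma>2: "set_integrable lebesgue {0<..} (\<lambda>x. (\<sigma> x)\<^sup>2)"
    using amalgam_1_2_integrable(2)[OF assms(5)] by simp
  have \<tau>: "set_integrable lebesgue {0<..} \<tau>"
    by (rule set_integrable_norm_iff_real[OF assms(2) amalgam_1_1_integrable[OF assms(6)]])
  show "purely_ac_spectrum_on \<sigma> \<tau> \<alpha> {0<..}"
    unfolding purely_ac_spectrum_on_def spectral_measure_def
  proof (rule absolutely_continuous_extend_measure)
    fix c :: real assume "c > 0"
    show "\<exists>g. continuous_on UNIV g \<and> (\<forall>x. g x \<ge> 0) \<and> (\<forall>a b. c \<le> a \<longrightarrow> a < b \<longrightarrow>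
        stieltjes_inversion (m_function \<sigma> \<tau> \<alpha>) a b = integral {a..b} g)"
    proof (rule m_function_boundary_values[OF \<sigma> \<sigma>2 \<tau> \<open>c > 0\<close>, of \<alpha>])
      fix H :: "real \<Rightarrow> real \<Rightarrow> real"
      assume H: "continuous_on UNIV (\<lambda>p. H (fst p) (snd p))" "\<And>t \<epsilon>. H t \<epsilon> \<ge> 0"
        "\<And>t \<epsilon>. c \<le> t \<Longrightarrow> 0 < \<epsilon> \<Longrightarrow> Im (m_function \<sigma> \<tau> \<alpha> (Complex t \<epsilon>)) = H t \<epsilon>"
      show ?thesis
      proof (intro exI[of _ "\<lambda>t. 1 / pi * H t 0"] conjI allI impI)
        show "continuous_on UNIV (\<lambda>t. 1 / pi * H t 0)"
          using continuous_on_compose2[OF H(1), of UNIV "\<lambda>t. (t, 0)"]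
          by (intro continuous_intros) (simp add: continuous_on_Pair)
        show "0 \<le> 1 / pi * H x 0" for x using H(2) by simp
        show "stieltjes_inversion (m_function \<sigma> \<tau> \<alpha>) a b = integral {a..b} (\<lambda>t. 1 / pi * H t 0)"
          if "c \<le> a" "a < b" for a b
          by (simp only: stieltjes_inversion_continuous[OF H(1,3) that] integral_mult_right)
      qed
    qed
  qed
qed

end
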